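(* Let $(A,p_l)$ be a non-unital Montel Fréchet algebra and let $n\in\mathbb{N}$. Then: (i) if $A^{\#}$ is $2n$-weakly amenable, then $A$ is $2n$-weakly amenable; (ii) if $A$ is $(2n-1)$-weakly amenable, then $A^{\#}$ is $(2n-1)$-weakly amenable.
   Context: All spaces are complex and $\mathbb{N}=\{1,2,\dots\}$. A Fréchet algebra $(A,p_l)$ is an algebra that is complete and Hausdorff for the topology generated by a separating, increasing sequence $(p_l)_{l\in\mathbb{N}}$ of submultiplicative seminorms. It is a Montel Fréchet algebra if its underlying locally convex space is a Montel space (Hausdorff, barrelled, and every closed bounded subset is compact). The unitization of $A$ is $A^{\#}=A\oplus\mathbb{C}e$ with product $(a,\lambda)(b,\mu)=(ab+\mu a+\lambda b,\lambda\mu)$ and seminorms $q_l(a,\lambda)=p_l(a)+|\lambda|$; it is a Fréchet algebra with identity $e=(0,1)$. For a locally convex space $X$, $X^*$ is its continuous dual with the strong topology (uniform convergence on bounded subsets of $X$); $X^{(0)}=X$ and $X^{(n)}=(X^{(n-1)})^*$. If $B$ is a Fréchet algebra and $X$ a locally convex $B$-bimodule, then $X^*$ is a $B$-bimodule via $\langle b\cdot f,x\rangle=\langle f,x\cdot b\rangle$ and $\langle f\cdot b,x\rangle=\langle f,b\cdot x\rangle$; iterating, every $X^{(n)}$ is a $B$-bimodule. $B$ is a bimodule over itself by multiplication. A continuous derivation $D:B\to X$ is a continuous linear map with $D(ab)=a\cdot D(b)+D(a)\cdot b$ for all $a,b\in B$; it is inner if there is $x\in X$ with $D(b)=b\cdot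 x-x\cdot b$ for all $b\in B$. $B$ is $n$-weakly amenable if every continuous derivation $B\to B^{(n)}$ is inner. *)

theory Defs
  imports "HOL-Analysis.Analysis" "HOL-Algebra.Module"
begin

section \<open>Topological vector spaces and Frechet algebras\<close>

text \<open>
  Carrier-based complex vector spaces are HOL-Algebra modules over the field of complex numbers.
  The record type \<open>module\<close> also has fields \<open>mult\<close> and \<open>one\<close>: \<open>mult\<close> is
  the product when the space is an algebra and is otherwise unused; \<open>one\<close> is never used, in
  particular an algebra need not have an identity.
\<close>

definition complex_ring :: "complex ring" where
  "complex_ring = \<lparr>carrier = UNIV, mult = (*), one = 1, zero = 0, add = (+)\<rparr>"

lemma complex_ring_cring: "cring complex_ring"
proof -
  have "\<exists>y. x + y = 0" for x :: complex
    by (rule exI[of _ "- x"]) simp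
  then show ?thesis
    by (unfold_locales) (auto simp: complex_ring_def Units_def algebra_simps)
qed

record 'x top_vs = "(complex, 'x) module" +
  topo :: "'x topology"

abbreviation complex_vector_space :: "('x, 'm) top_vs_scheme \<Rightarrow> bool" where
  "complex_vector_space X \<equiv> Module.module complex_ring X"

definition seminorm_on :: "('x, 'm) top_vs_scheme \<Rightarrow> ('x \<Rightarrow> real) \<Rightarrow> bool" where
  "seminorm_on X p \<longleftrightarrow>
     (\<forall>x\<in>carrier X. 0 \<le> p x) \<and>
     (\<forall>x\<in>carrier X. \<forall>y\<in>carrier X. p (x \<oplus>\<^bsub>X\<^esub> y) \<le> p x + p y) \<and>
     (\<forall>c. \<forall>x\<in>carrier X. p (c \<odot>\<^bsub>X\<^esub> x) = cmod c * p x)"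

definition seminorm_topology :: "(complex, 'x, 'm) module_scheme \<Rightarrow> ('x \<Rightarrow> real) set \<Rightarrow> 'x topology" where
  "seminorm_topology X P = topology (\<lambda>U. U \<subseteq> carrier X \<and>
     (\<forall>x\<in>U. \<exists>F \<epsilon>. finite F \<and> F \<subseteq> P \<and> 0 < \<epsilon> \<and>
        {y \<in> carrier X. \<forall>p\<in>F. p (y \<ominus>\<^bsub>X\<^esub> x) < \<epsilon>} \<subseteq> U))"

text \<open>Completeness of the translation-invariant uniformity: every Cauchy filter converges.\<close>

definition complete_tvs :: "('x, 'm) top_vs_scheme \<Rightarrow> bool" where
  "complete_tvs X \<longleftrightarrow>
     (\<forall>F. F \<noteq> bot \<and> eventually (\<lambda>x. x \<in> carrier X) F \<and>
          (\<forall>U. openin (topo X) U \<and> \<zero>\<^bsub>X\<^esub> \<in> U \<longrightarrow>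
             (\<exists>S. eventually (\<lambda>x. x \<in> S) F \<and> (\<forall>x\<in>S. \<forall>y\<in>S. x \<ominus>\<^bsub>X\<^esub> y \<in> U)))
        \<longrightarrow> (\<exists>a. limitin (topo X) (\<lambda>x. x) a F))"

definition bounded_set :: "('x, 'm) top_vs_scheme \<Rightarrow> 'x set \<Rightarrow> bool" where
  "bounded_set X E \<longleftrightarrow> E \<subseteq> carrier X \<and>
     (\<forall>U. openin (topo X) U \<and> \<zero>\<^bsub>X\<^esub> \<in> U \<longrightarrow>
        (\<exists>s>0. \<forall>t>s. E \<subseteq> (\<lambda>u. complex_of_real t \<odot>\<^bsub>X\<^esub> u) ` U))"

definition barrel :: "('x, 'm) top_vs_scheme \<Rightarrow> 'x set \<Rightarrow> bool" where
  "barrel X T \<longleftrightarrow> closedin (topo X) T \<and>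
     (\<forall>x\<in>T. \<forall>y\<in>T. \<forall>c d. cmod c + cmod d \<le> 1 \<longrightarrow> c \<odot>\<^bsub>X\<^esub> x \<oplus>\<^bsub>X\<^esub> d \<odot>\<^bsub>X\<^esub> y \<in> T) \<and>
     (\<forall>x\<in>carrier X. \<exists>r>0. \<forall>c. cmod c \<le> r \<longrightarrow> c \<odot>\<^bsub>X\<^esub> x \<in> T)"

definition barrelled :: "('x, 'm) top_vs_scheme \<Rightarrow> bool" where
  "barrelled X \<longleftrightarrow>
     (\<forall>T. barrel X T \<longrightarrow> (\<exists>U. openin (topo X) U \<and> \<zero>\<^bsub>X\<^esub> \<in> U \<and> U \<subseteq> T))"

definition montel :: "('x, 'm) top_vs_scheme \<Rightarrow> bool" where
  "montel X \<longleftrightarrow> Hausdorff_space (topo X) \<and> barrelled X \<and>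
     (\<forall>K. closedin (topo X) K \<and> bounded_set X K \<longrightarrow> compactin (topo X) K)"

definition associative_algebra :: "('a, 'm) top_vs_scheme \<Rightarrow> bool" where
  "associative_algebra A \<longleftrightarrow> complex_vector_space A \<and>
     (\<forall>a\<in>carrier A. \<forall>b\<in>carrier A. a \<otimes>\<^bsub>A\<^esub> b \<in> carrier A) \<and>
     (\<forall>a\<in>carrier A. \<forall>b\<in>carrier A. \<forall>c\<in>carrier A.
        (a \<otimes>\<^bsub>A\<^esub> b) \<otimes>\<^bsub>A\<^esub> c = a \<otimes>\<^bsub>A\<^esub> (b \<otimes>\<^bsub>A\<^esub> c) \<and>
        (a \<oplus>\<^bsub>A\<^esub> b) \<otimes>\<^bsub>A\<^esub> c = a \<otimes>\<^bsub>A\<^esub> c \<oplus>\<^bsub>A\<^esub> b \<otimes>\<^bsub>A\<^esub> c \<and>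
        a \<otimes>\<^bsub>A\<^esub> (b \<oplus>\<^bsub>A\<^esub> c) = a \<otimes>\<^bsub>A\<^esub> b \<oplus>\<^bsub>A\<^esub> a \<otimes>\<^bsub>A\<^esub> c) \<and>
     (\<forall>z. \<forall>a\<in>carrier A. \<forall>b\<in>carrier A.
        (z \<odot>\<^bsub>A\<^esub> a) \<otimes>\<^bsub>A\<^esub> b = z \<odot>\<^bsub>A\<^esub> (a \<otimes>\<^bsub>A\<^esub> b) \<and>
        a \<otimes>\<^bsub>A\<^esub> (z \<odot>\<^bsub>A\<^esub> b) = z \<odot>\<^bsub>A\<^esub> (a \<otimes>\<^bsub>A\<^esub> b))"

definition has_identity :: "('a, 'm) top_vs_scheme \<Rightarrow> bool" where
  "has_identity A \<longleftrightarrow>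
     (\<exists>e\<in>carrier A. \<forall>a\<in>carrier A. e \<otimes>\<^bsub>A\<^esub> a = a \<and> a \<otimes>\<^bsub>A\<^esub> e = a)"

text \<open>The separation condition on the seminorms is what makes the topology Hausdorff.\<close>

definition frechet_algebra :: "'a top_vs \<Rightarrow> (nat \<Rightarrow> 'a \<Rightarrow> real) \<Rightarrow> bool" where
  "frechet_algebra A p \<longleftrightarrow> associative_algebra A \<and>
     (\<forall>l. seminorm_on A (p l)) \<and>
     (\<forall>l. \<forall>a\<in>carrier A. \<forall>b\<in>carrier A. p l (a \<otimes>\<^bsub>A\<^esub> b) \<le> p l a * p l b) \<and>
     (\<forall>l. \<forall>a\<in>carrier A. p l a \<le> p (Suc l) a) \<and>
     (\<forall>a\<in>carrier A. (\<forall>l. p l a = 0) \<longrightarrow> a = \<zero>\<^bsub>A\<^esub>) \<and>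
     topo A = seminorm_topology A (range p) \<and>
     complete_tvs A"

definition unitization_vs :: "'a top_vs \<Rightarrow> (complex, 'a \<times> complex) module" where
  "unitization_vs A = \<lparr>carrier = carrier A \<times> UNIV,
     mult = (\<lambda>(a, x) (b, y). (a \<otimes>\<^bsub>A\<^esub> b \<oplus>\<^bsub>A\<^esub> y \<odot>\<^bsub>A\<^esub> a \<oplus>\<^bsub>A\<^esub> x \<odot>\<^bsub>A\<^esub> b, x * y)),
     one = (\<zero>\<^bsub>A\<^esub>, 1),
     zero = (\<zero>\<^bsub>A\<^esub>, 0),
     add = (\<lambda>(a, x) (b, y). (a \<oplus>\<^bsub>A\<^esub> b, x + y)),
     smult = (\<lambda>c (a, x). (c \<odot>\<^bsub>A\<^esub> a, c * x))\<rparr>"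

definition unitization_seminorm :: "(nat \<Rightarrow> 'a \<Rightarrow> real) \<Rightarrow> nat \<Rightarrow> 'a \<times> complex \<Rightarrow> real" where
  "unitization_seminorm p l = (\<lambda>(a, x). p l a + cmod x)"

definition unitization :: "'a top_vs \<Rightarrow> (nat \<Rightarrow> 'a \<Rightarrow> real) \<Rightarrow> ('a \<times> complex) top_vs" where
  "unitization A p = module.extend (unitization_vs A)
     \<lparr>topo = seminorm_topology (unitization_vs A) (range (unitization_seminorm p))\<rparr>"


section \<open>Bimodules and their strong duals\<close>

record ('b, 'x) bimodule = "'x top_vs" +
  lact :: "'b \<Rightarrow> 'x \<Rightarrow> 'x"
  ract :: "'x \<Rightarrow> 'b \<Rightarrow> 'x"

definition regular_bimodule :: "('b, 'm) top_vs_scheme \<Rightarrow> ('b, 'b) bimodule" where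
  "regular_bimodule B = \<lparr>carrier = carrier B, mult = mult B, one = one B, zero = zero B,
     add = add B, smult = smult B, topo = topo B, lact = mult B, ract = mult B\<rparr>"

text \<open>Functionals are extensional, so that equality of functionals is equality on the carrier.\<close>

definition continuous_functionals :: "('x, 'm) top_vs_scheme \<Rightarrow> ('x \<Rightarrow> complex) set" where
  "continuous_functionals X = {f \<in> extensional (carrier X).
     (\<forall>x\<in>carrier X. \<forall>y\<in>carrier X. f (x \<oplus>\<^bsub>X\<^esub> y) = f x + f y) \<and>
     (\<forall>c. \<forall>x\<in>carrier X. f (c \<odot>\<^bsub>X\<^esub> x) = c * f x) \<and>
     continuous_map (topo X) euclidean f}"

definition strong_topology :: "('x, 'm) top_vs_scheme \<Rightarrow> ('x \<Rightarrow> complex) topology" where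
  "strong_topology X = topology (\<lambda>U. U \<subseteq> continuous_functionals X \<and>
     (\<forall>f\<in>U. \<exists>E \<epsilon>. bounded_set X E \<and> 0 < \<epsilon> \<and>
        {g \<in> continuous_functionals X. \<forall>x\<in>E. cmod (g x - f x) < \<epsilon>} \<subseteq> U))"

definition dual_bimodule :: "('b, 'x) bimodule \<Rightarrow> ('b, 'x \<Rightarrow> complex) bimodule" where
  "dual_bimodule X = \<lparr>carrier = continuous_functionals X,
     mult = (\<lambda>_ _. undefined),
     one = undefined,
     zero = (\<lambda>x\<in>carrier X. 0),
     add = (\<lambda>f g. \<lambda>x\<in>carrier X. f x + g x),
     smult = (\<lambda>c f. \<lambda>x\<in>carrier X. c * f x),
     topo = strong_topology X,
     lact = (\<lambda>b f. \<lambda>x\<in>carrier X. f (ract X x b)),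
     ract = (\<lambda>f b. \<lambda>x\<in>carrier X. f (lact X b x))\<rparr>"

definition bimodule_iso ::
  "('b, 'm) top_vs_scheme \<Rightarrow> ('b, 'x) bimodule \<Rightarrow> ('b, 'y) bimodule \<Rightarrow> ('x \<Rightarrow> 'y) \<Rightarrow> bool" where
  "bimodule_iso B X Y \<phi> \<longleftrightarrow>
     bij_betw \<phi> (carrier X) (carrier Y) \<and> homeomorphic_map (topo X) (topo Y) \<phi> \<and>
     \<phi> \<zero>\<^bsub>X\<^esub> = \<zero>\<^bsub>Y\<^esub> \<and>
     (\<forall>x\<in>carrier X. \<forall>y\<in>carrier X. \<phi> (x \<oplus>\<^bsub>X\<^esub> y) = \<phi> x \<oplus>\<^bsub>Y\<^esub> \<phi> y) \<and>
     (\<forall>c. \<forall>x\<in>carrier X. \<phi> (c \<odot>\<^bsub>X\<^esub> x) = c \<odot>\<^bsub>Y\<^esub> \<phi> x) \<and>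
     (\<forall>b\<in>carrier B. \<forall>x\<in>carrier X.
        \<phi> (lact X b x) = lact Y b (\<phi> x) \<and> \<phi> (ract X x b) = ract Y (\<phi> x) b)"

text \<open>
  The type of \<^const>\<open>dual_bimodule\<close> grows with each application, so for a variable \<open>n\<close> the
  \<open>n\<close>-th iterated dual has no type of its own.  Instead each dual is replaced by an
  isomorphic copy (as a topological bimodule) inside one fixed type \<open>'v\<close>:
  \<open>iterated_dual B n Y\<close> says that \<open>Y\<close> is such a copy of the \<open>n\<close>-th dual of \<open>B\<close>.
\<close>

inductive iterated_dual :: "('b, 'm) top_vs_scheme \<Rightarrow> nat \<Rightarrow> ('b, 'v) bimodule \<Rightarrow> bool"
  for B :: "('b, 'm) top_vs_scheme" where
  base: "bimodule_iso B (regular_bimodule B) Y \<phi> \<Longrightarrow> iterated_dual B 0 Y"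
| step: "iterated_dual B n X \<Longrightarrow> bimodule_iso B (dual_bimodule X) Y \<phi> \<Longrightarrow> iterated_dual B (Suc n) Y"


section \<open>Derivations and weak amenability\<close>

definition continuous_derivation ::
  "('b, 'm) top_vs_scheme \<Rightarrow> ('b, 'x) bimodule \<Rightarrow> ('b \<Rightarrow> 'x) \<Rightarrow> bool" where
  "continuous_derivation B X D \<longleftrightarrow>
     D \<in> carrier B \<rightarrow> carrier X \<and>
     (\<forall>a\<in>carrier B. \<forall>b\<in>carrier B. D (a \<oplus>\<^bsub>B\<^esub> b) = D a \<oplus>\<^bsub>X\<^esub> D b) \<and>
     (\<forall>c. \<forall>a\<in>carrier B. D (c \<odot>\<^bsub>B\<^esub> a) = c \<odot>\<^bsub>X\<^esub> D a) \<and>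
     continuous_map (topo B) (topo X) D \<and>
     (\<forall>a\<in>carrier B. \<forall>b\<in>carrier B. D (a \<otimes>\<^bsub>B\<^esub> b) = lact X a (D b) \<oplus>\<^bsub>X\<^esub> ract X (D a) b)"

definition inner_derivation ::
  "('b, 'm) top_vs_scheme \<Rightarrow> ('b, 'x) bimodule \<Rightarrow> ('b \<Rightarrow> 'x) \<Rightarrow> bool" where
  "inner_derivation B X D \<longleftrightarrow>
     (\<exists>x\<in>carrier X. \<forall>b\<in>carrier B. D b = lact X b x \<ominus>\<^bsub>X\<^esub> ract X x b)"

text \<open>
  \<open>n_weakly_amenable TYPE('v) n B\<close>: the \<open>n\<close>-th dual of \<open>B\<close> has a copy in \<open>'v\<close>, and every
  continuous derivation into it is inner.  If \<open>'v\<close> has room for the duals of order at most \<open>n\<close>,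
  this is \<open>n\<close>-weak amenability, whatever the copy; otherwise it is false, never vacuously true.
  The lemmas at the end show both the independence of the copy and that a large enough \<open>'v\<close>
  always exists.
\<close>

definition n_weakly_amenable :: "'v itself \<Rightarrow> nat \<Rightarrow> ('b, 'm) top_vs_scheme \<Rightarrow> bool" where
  "n_weakly_amenable U n B \<longleftrightarrow>
     (\<exists>Y :: ('b, 'v) bimodule. iterated_dual B n Y \<and>
        (\<forall>D. continuous_derivation B Y D \<longrightarrow> inner_derivation B Y D))"


section \<open>Well-definedness of iterated duals\<close>

lemma openin_seminorm_topology:
  "openin (seminorm_topology X P) U \<longleftrightarrow> U \<subseteq> carrier X \<and>
     (\<forall>x\<in>U. \<exists>F \<epsilon>. finite F \<and> F \<subseteq> P \<and> 0 < \<epsilon> \<and>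
        {y \<in> carrier X. \<forall>p\<in>F. p (y \<ominus>\<^bsub>X\<^esub> x) < \<epsilon>} \<subseteq> U)"
proof -
  let ?L = "\<lambda>U. U \<subseteq> carrier X \<and>
     (\<forall>x\<in>U. \<exists>F \<epsilon>. finite F \<and> F \<subseteq> P \<and> 0 < \<epsilon> \<and>
        {y \<in> carrier X. \<forall>p\<in>F. p (y \<ominus>\<^bsub>X\<^esub> x) < \<epsilon>} \<subseteq> U)"
  have "istopology ?L"
    unfolding istopology_def
  proof (intro conjI allI impI)
    fix S T assume S: "?L S" and T: "?L T"
    show "S \<inter> T \<subseteq> carrier X" using S by blast
    show "\<forall>x\<in>S \<inter> T. \<exists>F \<epsilon>. finite F \<and> F \<subseteq> P \<and> 0 < \<epsilon> \<and>
        {y \<in> carrier X. \<forall>p\<in>F. p (y \<ominus>\<^bsub>X\<^esub> x) < \<epsilon>} \<subseteq> S \<inter> T"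
    proof
      fix x assume x: "x \<in> S \<inter> T"
      obtain F d where F: "finite F" "F \<subseteq> P" "0 < d"
        "{y \<in> carrier X. \<forall>p\<in>F. p (y \<ominus>\<^bsub>X\<^esub> x) < d} \<subseteq> S" using S x by blast
      obtain G e where G: "finite G" "G \<subseteq> P" "0 < e"
        "{y \<in> carrier X. \<forall>p\<in>G. p (y \<ominus>\<^bsub>X\<^esub> x) < e} \<subseteq> T" using T x by blast
      show "\<exists>F \<epsilon>. finite F \<and> F \<subseteq> P \<and> 0 < \<epsilon> \<and>
        {y \<in> carrier X. \<forall>p\<in>F. p (y \<ominus>\<^bsub>X\<^esub> x) < \<epsilon>} \<subseteq> S \<inter> T"
        using F G by (intro exI[of _ "F \<union> G"] exI[of _ "min d e"]) auto
    qed
  next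
    fix K assume K: "\<forall>S\<in>K. ?L S"
    show "\<Union>K \<subseteq> carrier X" using K by blast
    show "\<forall>x\<in>\<Union>K. \<exists>F \<epsilon>. finite F \<and> F \<subseteq> P \<and> 0 < \<epsilon> \<and>
        {y \<in> carrier X. \<forall>p\<in>F. p (y \<ominus>\<^bsub>X\<^esub> x) < \<epsilon>} \<subseteq> \<Union>K"
      using K by (meson Sup_upper UnionE subset_trans)
  qed
  then show ?thesis
    by (simp add: seminorm_topology_def topology_inverse')
qed

lemma topspace_seminorm_topology [simp]: "topspace (seminorm_topology X P) = carrier X"
proof -
  have "openin (seminorm_topology X P) (carrier X)"
    unfolding openin_seminorm_topology by (auto intro!: exI[of _ "{}"] exI[of _ "1::real"])
  then show ?thesis
    by (metis openin_seminorm_topology openin_topspace openin_subset subset_antisym)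
qed

lemma bounded_set_Un: "bounded_set X E \<Longrightarrow> bounded_set X F \<Longrightarrow> bounded_set X (E \<union> F)"
  unfolding bounded_set_def
proof (intro conjI allI impI, blast)
  fix U
  assume E: "E \<subseteq> carrier X \<and> (\<forall>U. openin (topo X) U \<and> \<zero>\<^bsub>X\<^esub> \<in> U \<longrightarrow>
        (\<exists>s>0. \<forall>t>s. E \<subseteq> (\<lambda>u. complex_of_real t \<odot>\<^bsub>X\<^esub> u) ` U))"
    and F: "F \<subseteq> carrier X \<and> (\<forall>U. openin (topo X) U \<and> \<zero>\<^bsub>X\<^esub> \<in> U \<longrightarrow>
        (\<exists>s>0. \<forall>t>s. F \<subseteq> (\<lambda>u. complex_of_real t \<odot>\<^bsub>X\<^esub> u) ` U))"
    and U: "openin (topo X) U \<and> \<zero>\<^bsub>X\<^esub> \<in> U"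
  obtain s where s: "s > 0" "\<forall>t>s. E \<subseteq> (\<lambda>u. complex_of_real t \<odot>\<^bsub>X\<^esub> u) ` U" using E U by blast
  obtain r where r: "r > 0" "\<forall>t>r. F \<subseteq> (\<lambda>u. complex_of_real t \<odot>\<^bsub>X\<^esub> u) ` U" using F U by blast
  show "\<exists>s>0. \<forall>t>s. E \<union> F \<subseteq> (\<lambda>u. complex_of_real t \<odot>\<^bsub>X\<^esub> u) ` U"
    using s r by (intro exI[of _ "max s r"]) (simp add: less_max_iff_disj)
qed

lemma bounded_set_empty: "bounded_set X {}"
  unfolding bounded_set_def by (auto intro: exI[of _ "1::real"])

lemma openin_strong_topology:
  "openin (strong_topology X) U \<longleftrightarrow> U \<subseteq> continuous_functionals X \<and>
     (\<forall>f\<in>U. \<exists>E \<epsilon>. bounded_set X E \<and> 0 < \<epsilon> \<and>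
        {g \<in> continuous_functionals X. \<forall>x\<in>E. cmod (g x - f x) < \<epsilon>} \<subseteq> U)"
proof -
  let ?L = "\<lambda>U. U \<subseteq> continuous_functionals X \<and>
     (\<forall>f\<in>U. \<exists>E \<epsilon>. bounded_set X E \<and> 0 < \<epsilon> \<and>
        {g \<in> continuous_functionals X. \<forall>x\<in>E. cmod (g x - f x) < \<epsilon>} \<subseteq> U)"
  have "istopology ?L"
    unfolding istopology_def
  proof (intro conjI allI impI)
    fix S T assume S: "?L S" and T: "?L T"
    show "S \<inter> T \<subseteq> continuous_functionals X" using S by blast
    show "\<forall>f\<in>S \<inter> T. \<exists>E \<epsilon>. bounded_set X E \<and> 0 < \<epsilon> \<and>
        {g \<in> continuous_functionals X. \<forall>x\<in>E. cmod (g x - f x) < \<epsilon>} \<subseteq> S \<inter> T"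
    proof
      fix f assume f: "f \<in> S \<inter> T"
      obtain F d where F: "bounded_set X F" "0 < d"
        "{g \<in> continuous_functionals X. \<forall>x\<in>F. cmod (g x - f x) < d} \<subseteq> S" using S f by blast
      obtain G e where G: "bounded_set X G" "0 < e"
        "{g \<in> continuous_functionals X. \<forall>x\<in>G. cmod (g x - f x) < e} \<subseteq> T" using T f by blast
      show "\<exists>E \<epsilon>. bounded_set X E \<and> 0 < \<epsilon> \<and>
        {g \<in> continuous_functionals X. \<forall>x\<in>E. cmod (g x - f x) < \<epsilon>} \<subseteq> S \<inter> T"
        using F G by (intro exI[of _ "F \<union> G"] exI[of _ "min d e"]) (auto simp: bounded_set_Un)
    qed
  next
    fix K assume K: "\<forall>S\<in>K. ?L S"
    show "\<Union>K \<subseteq> continuous_functionals X" using K by blast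
    show "\<forall>f\<in>\<Union>K. \<exists>E \<epsilon>. bounded_set X E \<and> 0 < \<epsilon> \<and>
        {g \<in> continuous_functionals X. \<forall>x\<in>E. cmod (g x - f x) < \<epsilon>} \<subseteq> \<Union>K"
      using K by (meson Sup_upper UnionE subset_trans)
  qed
  then show ?thesis
    by (simp add: strong_topology_def topology_inverse')
qed

lemma topspace_strong_topology [simp]: "topspace (strong_topology X) = continuous_functionals X"
proof -
  have "openin (strong_topology X) (continuous_functionals X)"
    unfolding openin_strong_topology
    by (auto intro!: exI[of _ "{}"] exI[of _ "1::real"] bounded_set_empty)
  then show ?thesis
    by (metis openin_strong_topology openin_topspace openin_subset subset_antisym)
qed

definition continuous_linear ::
  "('x, 'm) top_vs_scheme \<Rightarrow> ('y, 'k) top_vs_scheme \<Rightarrow> ('x \<Rightarrow> 'y) \<Rightarrow> bool" where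
  "continuous_linear X Y T \<longleftrightarrow>
     T \<in> carrier X \<rightarrow> carrier Y \<and> T \<zero>\<^bsub>X\<^esub> = \<zero>\<^bsub>Y\<^esub> \<and>
     (\<forall>x\<in>carrier X. \<forall>y\<in>carrier X. T (x \<oplus>\<^bsub>X\<^esub> y) = T x \<oplus>\<^bsub>Y\<^esub> T y) \<and>
     (\<forall>c. \<forall>x\<in>carrier X. T (c \<odot>\<^bsub>X\<^esub> x) = c \<odot>\<^bsub>Y\<^esub> T x) \<and>
     continuous_map (topo X) (topo Y) T"

lemma bounded_set_image:
  assumes T: "continuous_linear X Y T" and E: "bounded_set X E"
    and X: "topspace (topo X) = carrier X" "\<zero>\<^bsub>X\<^esub> \<in> carrier X"
  shows "bounded_set Y (T ` E)"
  unfolding bounded_set_def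
proof (intro conjI allI impI)
  show "T ` E \<subseteq> carrier Y" using T E by (auto simp: continuous_linear_def bounded_set_def)
  fix U assume U: "openin (topo Y) U \<and> \<zero>\<^bsub>Y\<^esub> \<in> U"
  let ?V = "{x \<in> topspace (topo X). T x \<in> U}"
  have "openin (topo X) ?V"
    using T U unfolding continuous_linear_def by (blast intro: openin_continuous_map_preimage)
  moreover have "\<zero>\<^bsub>X\<^esub> \<in> ?V" using T U X by (simp add: continuous_linear_def)
  ultimately obtain s where s: "s > 0"
    "\<forall>t>s. E \<subseteq> (\<lambda>u. complex_of_real t \<odot>\<^bsub>X\<^esub> u) ` ?V"
    using E unfolding bounded_set_def by blast
  have "T ` E \<subseteq> (\<lambda>u. complex_of_real t \<odot>\<^bsub>Y\<^esub> u) ` U" if "t > s" for t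
  proof
    fix y assume "y \<in> T ` E"
    then obtain x where x: "x \<in> E" "y = T x" by blast
    have "E \<subseteq> (\<lambda>u. complex_of_real t \<odot>\<^bsub>X\<^esub> u) ` ?V" using s(2) that by simp
    then obtain u where u: "u \<in> ?V" "x = complex_of_real t \<odot>\<^bsub>X\<^esub> u" using x by blast
    have "y = complex_of_real t \<odot>\<^bsub>Y\<^esub> T u"
      using T u x X by (simp add: continuous_linear_def)
    then show "y \<in> (\<lambda>u. complex_of_real t \<odot>\<^bsub>Y\<^esub> u) ` U" using u by blast
  qed
  then show "\<exists>s>0. \<forall>t>s. T ` E \<subseteq> (\<lambda>u. complex_of_real t \<odot>\<^bsub>Y\<^esub> u) ` U"
    using s(1) by blast
qed

definition topological_bimodule :: "('b, 'm) top_vs_scheme \<Rightarrow> ('b, 'x) bimodule \<Rightarrow> bool" where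
  "topological_bimodule B X \<longleftrightarrow> complex_vector_space X \<and> topspace (topo X) = carrier X \<and>
     (\<forall>b\<in>carrier B. continuous_linear X X (lact X b) \<and> continuous_linear X X (\<lambda>x. ract X x b))"

lemma complex_vector_spaceD:
  assumes "complex_vector_space X"
  shows "\<zero>\<^bsub>X\<^esub> \<in> carrier X"
    "x \<in> carrier X \<Longrightarrow> y \<in> carrier X \<Longrightarrow> x \<oplus>\<^bsub>X\<^esub> y \<in> carrier X"
    "x \<in> carrier X \<Longrightarrow> c \<odot>\<^bsub>X\<^esub> x \<in> carrier X"
    "x \<in> carrier X \<Longrightarrow> 0 \<odot>\<^bsub>X\<^esub> x = \<zero>\<^bsub>X\<^esub>"
    "c \<odot>\<^bsub>X\<^esub> \<zero>\<^bsub>X\<^esub> = \<zero>\<^bsub>X\<^esub>"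
proof -
  interpret Module.module complex_ring X by fact
  show "\<zero>\<^bsub>X\<^esub> \<in> carrier X" by simp
  show "x \<in> carrier X \<Longrightarrow> y \<in> carrier X \<Longrightarrow> x \<oplus>\<^bsub>X\<^esub> y \<in> carrier X" by simp
  show "x \<in> carrier X \<Longrightarrow> c \<odot>\<^bsub>X\<^esub> x \<in> carrier X"
    using smult_closed[of c x] by (simp add: complex_ring_def)
  show "x \<in> carrier X \<Longrightarrow> 0 \<odot>\<^bsub>X\<^esub> x = \<zero>\<^bsub>X\<^esub>"
    using smult_l_null[of x] by (simp add: complex_ring_def)
  show "c \<odot>\<^bsub>X\<^esub> \<zero>\<^bsub>X\<^esub> = \<zero>\<^bsub>X\<^esub>"
    using smult_r_null[of c] by (simp add: complex_ring_def)
qed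

lemma complex_vector_spaceI:
  assumes "\<zero>\<^bsub>X\<^esub> \<in> carrier X"
    "\<And>x y. x \<in> carrier X \<Longrightarrow> y \<in> carrier X \<Longrightarrow> x \<oplus>\<^bsub>X\<^esub> y \<in> carrier X"
    "\<And>c x. x \<in> carrier X \<Longrightarrow> c \<odot>\<^bsub>X\<^esub> x \<in> carrier X"
    "\<And>x y z. x \<in> carrier X \<Longrightarrow> y \<in> carrier X \<Longrightarrow> z \<in> carrier X \<Longrightarrow>
       (x \<oplus>\<^bsub>X\<^esub> y) \<oplus>\<^bsub>X\<^esub> z = x \<oplus>\<^bsub>X\<^esub> (y \<oplus>\<^bsub>X\<^esub> z)"
    "\<And>x y. x \<in> carrier X \<Longrightarrow> y \<in> carrier X \<Longrightarrow> x \<oplus>\<^bsub>X\<^esub> y = y \<oplus>\<^bsub>X\<^esub> x"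
    "\<And>x. x \<in> carrier X \<Longrightarrow> \<zero>\<^bsub>X\<^esub> \<oplus>\<^bsub>X\<^esub> x = x"
    "\<And>x. x \<in> carrier X \<Longrightarrow> (-1) \<odot>\<^bsub>X\<^esub> x \<oplus>\<^bsub>X\<^esub> x = \<zero>\<^bsub>X\<^esub>"
    "\<And>c d x. x \<in> carrier X \<Longrightarrow> (c + d) \<odot>\<^bsub>X\<^esub> x = c \<odot>\<^bsub>X\<^esub> x \<oplus>\<^bsub>X\<^esub> d \<odot>\<^bsub>X\<^esub> x"
    "\<And>c x y. x \<in> carrier X \<Longrightarrow> y \<in> carrier X \<Longrightarrow>
       c \<odot>\<^bsub>X\<^esub> (x \<oplus>\<^bsub>X\<^esub> y) = c \<odot>\<^bsub>X\<^esub> x \<oplus>\<^bsub>X\<^esub> c \<odot>\<^bsub>X\<^esub> y"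
    "\<And>c d x. x \<in> carrier X \<Longrightarrow> (c * d) \<odot>\<^bsub>X\<^esub> x = c \<odot>\<^bsub>X\<^esub> (d \<odot>\<^bsub>X\<^esub> x)"
    "\<And>x. x \<in> carrier X \<Longrightarrow> 1 \<odot>\<^bsub>X\<^esub> x = x"
  shows "complex_vector_space X"
proof (rule Module.moduleI)
  show "cring complex_ring" by (rule complex_ring_cring)
  show "abelian_group X"
    by (rule abelian_groupI) (use assms in blast)+
qed (use assms in \<open>simp_all add: complex_ring_def\<close>)

lemma complex_vector_space_axioms:
  assumes "complex_vector_space X"
  shows "x \<in> carrier X \<Longrightarrow> y \<in> carrier X \<Longrightarrow> z \<in> carrier X \<Longrightarrow>
       (x \<oplus>\<^bsub>X\<^esub> y) \<oplus>\<^bsub>X\<^esub> z = x \<oplus>\<^bsub>X\<^esub> (y \<oplus>\<^bsub>X\<^esub> z)"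
    "x \<in> carrier X \<Longrightarrow> y \<in> carrier X \<Longrightarrow> x \<oplus>\<^bsub>X\<^esub> y = y \<oplus>\<^bsub>X\<^esub> x"
    "x \<in> carrier X \<Longrightarrow> \<zero>\<^bsub>X\<^esub> \<oplus>\<^bsub>X\<^esub> x = x"
    "x \<in> carrier X \<Longrightarrow> (-1) \<odot>\<^bsub>X\<^esub> x \<oplus>\<^bsub>X\<^esub> x = \<zero>\<^bsub>X\<^esub>"
    "x \<in> carrier X \<Longrightarrow> (c + d) \<odot>\<^bsub>X\<^esub> x = c \<odot>\<^bsub>X\<^esub> x \<oplus>\<^bsub>X\<^esub> d \<odot>\<^bsub>X\<^esub> x"
    "x \<in> carrier X \<Longrightarrow> y \<in> carrier X \<Longrightarrow>
       c \<odot>\<^bsub>X\<^esub> (x \<oplus>\<^bsub>X\<^esub> y) = c \<odot>\<^bsub>X\<^esub> x \<oplus>\<^bsub>X\<^esub> c \<odot>\<^bsub>X\<^esub> y"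
    "x \<in> carrier X \<Longrightarrow> (c * d) \<odot>\<^bsub>X\<^esub> x = c \<odot>\<^bsub>X\<^esub> (d \<odot>\<^bsub>X\<^esub> x)"
    "x \<in> carrier X \<Longrightarrow> 1 \<odot>\<^bsub>X\<^esub> x = x"
proof -
  interpret Module.module complex_ring X by fact
  show "x \<in> carrier X \<Longrightarrow> y \<in> carrier X \<Longrightarrow> z \<in> carrier X \<Longrightarrow>
       (x \<oplus>\<^bsub>X\<^esub> y) \<oplus>\<^bsub>X\<^esub> z = x \<oplus>\<^bsub>X\<^esub> (y \<oplus>\<^bsub>X\<^esub> z)" by (rule a_assoc)
  show "x \<in> carrier X \<Longrightarrow> y \<in> carrier X \<Longrightarrow> x \<oplus>\<^bsub>X\<^esub> y = y \<oplus>\<^bsub>X\<^esub> x" by (rule a_comm)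
  show "x \<in> carrier X \<Longrightarrow> \<zero>\<^bsub>X\<^esub> \<oplus>\<^bsub>X\<^esub> x = x" by simp
  show D: "x \<in> carrier X \<Longrightarrow> (c + d) \<odot>\<^bsub>X\<^esub> x = c \<odot>\<^bsub>X\<^esub> x \<oplus>\<^bsub>X\<^esub> d \<odot>\<^bsub>X\<^esub> x" for c d
    using smult_l_distr[of c d x] by (simp add: complex_ring_def)
  show "x \<in> carrier X \<Longrightarrow> y \<in> carrier X \<Longrightarrow>
       c \<odot>\<^bsub>X\<^esub> (x \<oplus>\<^bsub>X\<^esub> y) = c \<odot>\<^bsub>X\<^esub> x \<oplus>\<^bsub>X\<^esub> c \<odot>\<^bsub>X\<^esub> y"
    using smult_r_distr[of c x y] by (simp add: complex_ring_def)
  show "x \<in> carrier X \<Longrightarrow> (c * d) \<odot>\<^bsub>X\<^esub> x = c \<odot>\<^bsub>X\<^esub> (d \<odot>\<^bsub>X\<^esub> x)"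
    using smult_assoc1[of c d x] by (simp add: complex_ring_def)
  show O: "x \<in> carrier X \<Longrightarrow> 1 \<odot>\<^bsub>X\<^esub> x = x"
    using smult_one[of x] by (simp add: complex_ring_def)
  show "x \<in> carrier X \<Longrightarrow> (-1) \<odot>\<^bsub>X\<^esub> x \<oplus>\<^bsub>X\<^esub> x = \<zero>\<^bsub>X\<^esub>"
    using D[of "-1" 1] O complex_vector_spaceD(4)[OF assms, of x] by simp
qed

lemma minus_eq_smult:
  assumes "complex_vector_space X" "x \<in> carrier X" "y \<in> carrier X"
  shows "x \<ominus>\<^bsub>X\<^esub> y = x \<oplus>\<^bsub>X\<^esub> (-1) \<odot>\<^bsub>X\<^esub> y"
proof -
  interpret Module.module complex_ring X by fact
  have "\<ominus>\<^bsub>X\<^esub> y = (-1) \<odot>\<^bsub>X\<^esub> y"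
    using complex_vector_space_axioms(4)[OF assms(1) assms(3)] assms
    by (intro minus_equality) (auto simp: complex_vector_spaceD(3))
  then show ?thesis by (simp add: a_minus_def)
qed

definition dual_map :: "('x, 'm) top_vs_scheme \<Rightarrow> ('x \<Rightarrow> 'y) \<Rightarrow> ('y \<Rightarrow> complex) \<Rightarrow> 'x \<Rightarrow> complex" where
  "dual_map X T f = (\<lambda>x\<in>carrier X. f (T x))"

lemma dual_map_functional:
  assumes T: "continuous_linear X Y T" and X: "complex_vector_space X" "topspace (topo X) = carrier X"
    and f: "f \<in> continuous_functionals Y"
  shows "dual_map X T f \<in> continuous_functionals X"
proof -
  have T': "T x \<in> carrier Y" if "x \<in> carrier X" for x
    using T that by (auto simp: continuous_linear_def)
  have "continuous_map (topo X) euclidean (f \<circ> T)"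
    using T f by (auto simp: continuous_linear_def continuous_functionals_def intro: continuous_map_compose)
  then have "continuous_map (topo X) euclidean (dual_map X T f)"
    by (rule continuous_map_eq) (simp add: dual_map_def X)
  then show ?thesis
    using T f T' by (simp add: continuous_functionals_def dual_map_def complex_vector_spaceD[OF X(1)]
        continuous_linear_def)
qed

lemma dual_map_continuous:
  assumes T: "continuous_linear X Y T" and X: "complex_vector_space X" "topspace (topo X) = carrier X"
  shows "continuous_map (strong_topology Y) (strong_topology X) (dual_map X T)"
  unfolding continuous_map_def topspace_strong_topology
proof (intro conjI allI impI)
  show "dual_map X T \<in> continuous_functionals Y \<rightarrow> continuous_functionals X"
    using dual_map_functional[OF assms] by blast
  fix W assume W: "openin (strong_topology X) W"
  show "openin (strong_topology Y) {f \<in> continuous_functionals Y. dual_map X T f \<in> W}"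
    unfolding openin_strong_topology
  proof (intro conjI ballI)
    fix f assume f: "f \<in> {f \<in> continuous_functionals Y. dual_map X T f \<in> W}"
    then obtain E e where E: "bounded_set X E" "0 < e"
      "{g \<in> continuous_functionals X. \<forall>x\<in>E. cmod (g x - dual_map X T f x) < e} \<subseteq> W"
      using W unfolding openin_strong_topology by blast
    have EX: "E \<subseteq> carrier X" using E by (simp add: bounded_set_def)
    have "dual_map X T g \<in> W"
      if g: "g \<in> continuous_functionals Y" "\<forall>y\<in>T ` E. cmod (g y - f y) < e" for g
    proof -
      have "cmod (dual_map X T g x - dual_map X T f x) < e" if "x \<in> E" for x
        using that g(2) EX by (auto simp: dual_map_def)
      then show ?thesis using E(3) dual_map_functional[OF assms g(1)] by blast
    qed
    then have "{g \<in> continuous_functionals Y. \<forall>y\<in>T ` E. cmod (g y - f y) < e}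
        \<subseteq> {f \<in> continuous_functionals Y. dual_map X T f \<in> W}" by blast
    then show "\<exists>E \<epsilon>. bounded_set Y E \<and> 0 < \<epsilon> \<and>
         {g \<in> continuous_functionals Y. \<forall>x\<in>E. cmod (g x - f x) < \<epsilon>}
         \<subseteq> {f \<in> continuous_functionals Y. dual_map X T f \<in> W}"
      using bounded_set_image[OF T E(1) X(2)] E(2) complex_vector_spaceD(1)[OF X(1)] by blast
  qed blast
qed

lemma dual_bimodule_simps [simp]:
  "carrier (dual_bimodule X) = continuous_functionals X"
  "zero (dual_bimodule X) = (\<lambda>x\<in>carrier X. 0)"
  "add (dual_bimodule X) = (\<lambda>f g. \<lambda>x\<in>carrier X. f x + g x)"
  "smult (dual_bimodule X) = (\<lambda>c f. \<lambda>x\<in>carrier X. c * f x)"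
  "topo (dual_bimodule X) = strong_topology X"
  "lact (dual_bimodule X) b = dual_map X (\<lambda>x. ract X x b)"
  "ract (dual_bimodule X) f b = dual_map X (lact X b) f"
  by (simp_all add: dual_bimodule_def dual_map_def fun_eq_iff)

lemma dual_map_linear:
  assumes T: "continuous_linear X Y T" and X: "complex_vector_space X" "topspace (topo X) = carrier X"
  shows "continuous_linear (dual_bimodule Y) (dual_bimodule X) (dual_map X T)"
proof -
  have "T x \<in> carrier Y" if "x \<in> carrier X" for x
    using T that by (auto simp: continuous_linear_def)
  then show ?thesis
    unfolding continuous_linear_def
    using dual_map_functional[OF assms] dual_map_continuous[OF assms]
    by (auto simp: dual_map_def fun_eq_iff restrict_def)
qed

lemma complex_vector_space_dual:
  assumes X: "complex_vector_space X" "topspace (topo X) = carrier X"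
  shows "complex_vector_space (dual_bimodule X)"
proof (rule complex_vector_spaceI)
  note D = complex_vector_spaceD[OF X(1)]
  show "\<zero>\<^bsub>dual_bimodule X\<^esub> \<in> carrier (dual_bimodule X)"
  proof -
    have "continuous_map (topo X) euclidean (\<lambda>x\<in>carrier X. 0::complex)"
      by (rule continuous_map_eq[of _ _ "\<lambda>_. 0"]) (auto simp: X)
    then show ?thesis by (simp add: continuous_functionals_def D)
  qed
  show "f \<oplus>\<^bsub>dual_bimodule X\<^esub> g \<in> carrier (dual_bimodule X)"
    if "f \<in> carrier (dual_bimodule X)" "g \<in> carrier (dual_bimodule X)" for f g
  proof -
    have "continuous_map (topo X) euclidean (\<lambda>x\<in>carrier X. f x + g x)"
      by (rule continuous_map_eq[of _ _ "\<lambda>x. f x + g x"])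
        (use that in \<open>auto simp: X continuous_functionals_def intro!: continuous_map_add\<close>)
    then show ?thesis using that by (simp add: continuous_functionals_def D algebra_simps)
  qed
  show "c \<odot>\<^bsub>dual_bimodule X\<^esub> f \<in> carrier (dual_bimodule X)"
    if "f \<in> carrier (dual_bimodule X)" for c f
  proof -
    have "continuous_map (topo X) euclidean ((\<lambda>z. c * z) \<circ> f)"
      by (rule continuous_map_compose[of _ euclidean])
       (use that in \<open>auto simp: continuous_functionals_def intro!: continuous_intros\<close>)
    then have "continuous_map (topo X) euclidean (\<lambda>x\<in>carrier X. c * f x)"
      by (rule continuous_map_eq) (auto simp: X)
    then show ?thesis using that by (simp add: continuous_functionals_def D algebra_simps)
  qed
qed (auto simp: continuous_functionals_def extensional_def fun_eq_iff restrict_def algebra_simps)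

lemma topological_bimodule_dual:
  assumes "topological_bimodule B X"
  shows "topological_bimodule B (dual_bimodule X)"
  using assms by (auto simp: topological_bimodule_def complex_vector_space_dual intro!: dual_map_linear)

lemma bimodule_iso_continuous_linear:
  assumes "bimodule_iso B X Y \<phi>"
  shows "continuous_linear X Y \<phi>"
  using assms
  by (auto simp: bimodule_iso_def continuous_linear_def bij_betw_def homeomorphic_imp_continuous_map)

lemma bimodule_iso_refl: "bimodule_iso B X X id"
  by (simp add: bimodule_iso_def)

lemma bimodule_iso_trans:
  assumes "bimodule_iso B X Y \<phi>" "bimodule_iso B Y Z \<psi>"
  shows "bimodule_iso B X Z (\<psi> \<circ> \<phi>)"
proof -
  have "\<phi> x \<in> carrier Y" if "x \<in> carrier X" for x
    using assms(1) that by (auto simp: bimodule_iso_def bij_betw_def)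
  then show ?thesis
    using assms by (auto simp: bimodule_iso_def intro: bij_betw_trans homeomorphic_map_compose)
qed

lemma bimodule_iso_sym:
  assumes \<phi>: "bimodule_iso B X Y \<phi>" and X: "topological_bimodule B X"
  shows "bimodule_iso B Y X (inv_into (carrier X) \<phi>)"
proof -
  let ?\<psi> = "inv_into (carrier X) \<phi>"
  note D = complex_vector_spaceD[of X]
  have X': "complex_vector_space X" "topspace (topo X) = carrier X"
    and act: "\<And>b x. b \<in> carrier B \<Longrightarrow> x \<in> carrier X \<Longrightarrow> lact X b x \<in> carrier X"
    "\<And>b x. b \<in> carrier B \<Longrightarrow> x \<in> carrier X \<Longrightarrow> ract X x b \<in> carrier X"
    using X by (auto simp: topological_bimodule_def continuous_linear_def)
  have bij: "bij_betw \<phi> (carrier X) (carrier Y)" and hom: "homeomorphic_map (topo X) (topo Y) \<phi>"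
    using \<phi> by (auto simp: bimodule_iso_def)
  have inj: "inj_on \<phi> (carrier X)" using bij by (simp add: bij_betw_def)
  have \<psi>: "?\<psi> (\<phi> x) = x" if "x \<in> carrier X" for x using inj that by simp
  have surj: "\<exists>x\<in>carrier X. y = \<phi> x" if "y \<in> carrier Y" for y
    using bij that by (auto simp: bij_betw_def)
  obtain g where g: "homeomorphic_maps (topo X) (topo Y) \<phi> g" using hom
    by (auto simp: homeomorphic_map_maps)
  have top: "topspace (topo Y) = carrier Y"
    using homeomorphic_imp_surjective_map[OF hom] bij X' by (simp add: bij_betw_def)
  have "homeomorphic_map (topo Y) (topo X) g"
    using g homeomorphic_maps_sym homeomorphic_maps_map by blast
  then have hom': "homeomorphic_map (topo Y) (topo X) ?\<psi>"
  proof (rule homeomorphic_map_eq)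
    fix y assume "y \<in> topspace (topo Y)"
    then obtain x where "x \<in> carrier X" "y = \<phi> x" using surj top by blast
    then show "g y = ?\<psi> y" using g \<psi> X' by (simp add: homeomorphic_maps_def)
  qed
  show ?thesis
    unfolding bimodule_iso_def
  proof (intro conjI ballI allI)
    show "bij_betw ?\<psi> (carrier Y) (carrier X)" by (rule bij_betw_inv_into[OF bij])
    show "homeomorphic_map (topo Y) (topo X) ?\<psi>" by (rule hom')
    show "?\<psi> \<zero>\<^bsub>Y\<^esub> = \<zero>\<^bsub>X\<^esub>" using \<phi> \<psi>[OF D(1)[OF X'(1)]] by (simp add: bimodule_iso_def)
    fix u c assume "u \<in> carrier Y"
    then obtain x where x: "x \<in> carrier X" "u = \<phi> x" using surj by blast
    show "?\<psi> (c \<odot>\<^bsub>Y\<^esub> u) = c \<odot>\<^bsub>X\<^esub> ?\<psi> u"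
      using \<phi> x \<psi>[OF D(3)[OF X'(1) x(1)], of c] \<psi>[OF x(1)] by (simp add: bimodule_iso_def)
    { fix v assume "v \<in> carrier Y"
      then obtain y where y: "y \<in> carrier X" "v = \<phi> y" using surj by blast
      show "?\<psi> (u \<oplus>\<^bsub>Y\<^esub> v) = ?\<psi> u \<oplus>\<^bsub>X\<^esub> ?\<psi> v"
        using \<phi> x y \<psi>[OF D(2)[OF X'(1) x(1) y(1)]] \<psi>[OF x(1)] \<psi>[OF y(1)] by (simp add: bimodule_iso_def) }
    fix b assume b: "b \<in> carrier B"
    show "?\<psi> (lact Y b u) = lact X b (?\<psi> u)"
      using \<phi> x b \<psi>[OF act(1)[OF b x(1)]] \<psi>[OF x(1)] by (simp add: bimodule_iso_def)
    show "?\<psi> (ract Y u b) = ract X (?\<psi> u) b"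
      using \<phi> x b \<psi>[OF act(2)[OF b x(1)]] \<psi>[OF x(1)] by (simp add: bimodule_iso_def)
  qed
qed

lemma topological_bimodule_iso:
  assumes \<phi>: "bimodule_iso B X Y \<phi>" and X: "topological_bimodule B X"
  shows "topological_bimodule B Y"
proof -
  let ?\<psi> = "inv_into (carrier X) \<phi>"
  have X': "complex_vector_space X" "topspace (topo X) = carrier X"
    and act: "\<And>b x. b \<in> carrier B \<Longrightarrow> x \<in> carrier X \<Longrightarrow> lact X b x \<in> carrier X"
    "\<And>b x. b \<in> carrier B \<Longrightarrow> x \<in> carrier X \<Longrightarrow> ract X x b \<in> carrier X"
    using X by (auto simp: topological_bimodule_def continuous_linear_def)
  note D = complex_vector_spaceD[OF X'(1)] and Ax = complex_vector_space_axioms[OF X'(1)]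
  have bij: "bij_betw \<phi> (carrier X) (carrier Y)" and hom: "homeomorphic_map (topo X) (topo Y) \<phi>"
    using \<phi> by (auto simp: bimodule_iso_def)
  have Y: "carrier Y = \<phi> ` carrier X" using bij by (simp add: bij_betw_def)
  have zero: "\<zero>\<^bsub>Y\<^esub> = \<phi> \<zero>\<^bsub>X\<^esub>"
    and add: "\<And>x y. x \<in> carrier X \<Longrightarrow> y \<in> carrier X \<Longrightarrow> \<phi> x \<oplus>\<^bsub>Y\<^esub> \<phi> y = \<phi> (x \<oplus>\<^bsub>X\<^esub> y)"
    and smult: "\<And>c x. x \<in> carrier X \<Longrightarrow> c \<odot>\<^bsub>Y\<^esub> \<phi> x = \<phi> (c \<odot>\<^bsub>X\<^esub> x)"
    and lact: "\<And>b x. b \<in> carrier B \<Longrightarrow> x \<in> carrier X \<Longrightarrow> lact Y b (\<phi> x) = \<phi> (lact X b x)"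
    and ract: "\<And>b x. b \<in> carrier B \<Longrightarrow> x \<in> carrier X \<Longrightarrow> ract Y (\<phi> x) b = \<phi> (ract X x b)"
    using \<phi> by (simp_all add: bimodule_iso_def)
  have top: "topspace (topo Y) = carrier Y"
    using homeomorphic_imp_surjective_map[OF hom] X' Y by simp
  have \<psi>: "bimodule_iso B Y X ?\<psi>" by (rule bimodule_iso_sym[OF assms])
  have \<psi>\<phi>: "?\<psi> (\<phi> x) = x" if "x \<in> carrier X" for x
    using bij that by (simp add: bij_betw_def)
  have cv: "complex_vector_space Y"
    by (rule complex_vector_spaceI) (auto simp: Y zero add smult D Ax(1,3-8) intro!: arg_cong[of _ _ \<phi>] Ax(2))
  have conj: "continuous_map (topo Y) (topo Y) S"
    if T: "continuous_linear X X T" and S: "\<And>x. x \<in> carrier X \<Longrightarrow> S (\<phi> x) = \<phi> (T x)" for T S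
  proof -
    have "continuous_map (topo Y) (topo Y) (\<phi> \<circ> (T \<circ> ?\<psi>))"
      using T hom \<psi> unfolding bimodule_iso_def continuous_linear_def
      by (meson continuous_map_compose homeomorphic_imp_continuous_map)
    then show ?thesis
      by (rule continuous_map_eq) (auto simp: top Y \<psi>\<phi> S)
  qed
  have cl: "continuous_linear Y Y S"
    if T: "continuous_linear X X T" and S: "\<And>x. x \<in> carrier X \<Longrightarrow> S (\<phi> x) = \<phi> (T x)" for T S
  proof -
    have "T x \<in> carrier X" if "x \<in> carrier X" for x using T that by (auto simp: continuous_linear_def)
    moreover have "T \<zero>\<^bsub>X\<^esub> = \<zero>\<^bsub>X\<^esub>" "\<And>x y. x \<in> carrier X \<Longrightarrow> y \<in> carrier X \<Longrightarrow> T (x \<oplus>\<^bsub>X\<^esub> y) = T x \<oplus>\<^bsub>X\<^esub> T y"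
      "\<And>c x. x \<in> carrier X \<Longrightarrow> T (c \<odot>\<^bsub>X\<^esub> x) = c \<odot>\<^bsub>X\<^esub> T x"
      using T by (auto simp: continuous_linear_def)
    ultimately show ?thesis
      using conj[OF T S] unfolding continuous_linear_def
      by (auto simp: Y zero add smult D S)
  qed
  have "continuous_linear Y Y (lact Y b)" "continuous_linear Y Y (\<lambda>y. ract Y y b)"
    if b: "b \<in> carrier B" for b
    using X b cl[of "lact X b" "lact Y b"] cl[of "\<lambda>x. ract X x b" "\<lambda>y. ract Y y b"]
    by (simp_all add: topological_bimodule_def lact ract)
  then show ?thesis using cv top by (simp add: topological_bimodule_def)
qed

lemma bimodule_iso_dual:
  assumes \<phi>: "bimodule_iso B X Y \<phi>" and X: "topological_bimodule B X"
  shows "\<exists>\<psi>. bimodule_iso B (dual_bimodule X) (dual_bimodule Y) \<psi>"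
proof -
  let ?\<psi> = "inv_into (carrier X) \<phi>"
  have Y: "topological_bimodule B Y" by (rule topological_bimodule_iso[OF assms])
  have \<psi>: "bimodule_iso B Y X ?\<psi>" by (rule bimodule_iso_sym[OF assms])
  have bij: "bij_betw \<phi> (carrier X) (carrier Y)" using \<phi> by (simp add: bimodule_iso_def)
  have X': "complex_vector_space X" "topspace (topo X) = carrier X"
    and Y': "complex_vector_space Y" "topspace (topo Y) = carrier Y"
    and actY: "\<And>b x. b \<in> carrier B \<Longrightarrow> x \<in> carrier Y \<Longrightarrow> lact Y b x \<in> carrier Y"
    "\<And>b x. b \<in> carrier B \<Longrightarrow> x \<in> carrier Y \<Longrightarrow> ract Y x b \<in> carrier Y"
    using X Y by (auto simp: topological_bimodule_def continuous_linear_def)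
  have l\<phi>: "continuous_linear X Y \<phi>" and l\<psi>: "continuous_linear Y X ?\<psi>"
    using \<phi> \<psi> by (auto intro: bimodule_iso_continuous_linear)
  have in\<phi>: "\<phi> x \<in> carrier Y" "?\<psi> (\<phi> x) = x" if "x \<in> carrier X" for x
    using bij that by (auto simp: bij_betw_def)
  have in\<psi>: "?\<psi> y \<in> carrier X" "\<phi> (?\<psi> y) = y" if "y \<in> carrier Y" for y
    using bij that by (auto simp: bij_betw_def inv_into_into f_inv_into_f)
  have inv: "dual_map Y ?\<psi> (dual_map X \<phi> g) = g" if "g \<in> continuous_functionals Y" for g
    using that in\<psi> by (auto simp: dual_map_def fun_eq_iff restrict_def continuous_functionals_def extensional_def)
  have inv': "dual_map X \<phi> (dual_map Y ?\<psi> f) = f" if "f \<in> continuous_functionals X" for f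
    using that in\<phi> by (auto simp: dual_map_def fun_eq_iff restrict_def continuous_functionals_def extensional_def)
  have maps: "dual_map Y ?\<psi> f \<in> continuous_functionals Y" if "f \<in> continuous_functionals X" for f
    using dual_map_functional[OF l\<psi> Y' that] .
  have maps': "dual_map X \<phi> f \<in> continuous_functionals X" if "f \<in> continuous_functionals Y" for f
    using dual_map_functional[OF l\<phi> X' that] .
  have "bij_betw (dual_map Y ?\<psi>) (continuous_functionals X) (continuous_functionals Y)"
    by (rule bij_betwI[where g = "dual_map X \<phi>"]) (auto simp: maps maps' inv inv')
  moreover have "homeomorphic_map (strong_topology X) (strong_topology Y) (dual_map Y ?\<psi>)"
  proof (rule homeomorphic_maps_imp_map)
    show "homeomorphic_maps (strong_topology X) (strong_topology Y) (dual_map Y ?\<psi>) (dual_map X \<phi>)"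
      using dual_map_continuous[OF l\<phi> X'] dual_map_continuous[OF l\<psi> Y'] inv inv'
      by (simp add: homeomorphic_maps_def)
  qed
  moreover have "dual_map Y ?\<psi> (lact (dual_bimodule X) b f) = lact (dual_bimodule Y) b (dual_map Y ?\<psi> f)"
    "dual_map Y ?\<psi> (ract (dual_bimodule X) f b) = ract (dual_bimodule Y) (dual_map Y ?\<psi> f) b"
    if b: "b \<in> carrier B" for b f
    using \<psi> b in\<psi> actY by (auto simp: dual_map_def fun_eq_iff restrict_def bimodule_iso_def)
  ultimately have "bimodule_iso B (dual_bimodule X) (dual_bimodule Y) (dual_map Y ?\<psi>)"
    using dual_map_linear[OF l\<psi> Y'] unfolding bimodule_iso_def continuous_linear_def
    by auto
  then show ?thesis by blast
qed

lemma topological_bimodule_regular: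
  assumes A: "frechet_algebra A p"
  shows "topological_bimodule A (regular_bimodule A)"
proof -
  have R [simp]: "carrier (regular_bimodule A) = carrier A" "zero (regular_bimodule A) = zero A"
    "add (regular_bimodule A) = add A" "smult (regular_bimodule A) = smult A"
    "topo (regular_bimodule A) = topo A" "lact (regular_bimodule A) = mult A"
    "ract (regular_bimodule A) = mult A"
    by (simp_all add: regular_bimodule_def)
  have alg: "associative_algebra A" and vs: "complex_vector_space A"
    and sn: "\<And>l. seminorm_on A (p l)" and topA: "topo A = seminorm_topology A (range p)"
    and sub: "\<And>l a b. a \<in> carrier A \<Longrightarrow> b \<in> carrier A \<Longrightarrow> p l (a \<otimes>\<^bsub>A\<^esub> b) \<le> p l a * p l b"
    using A by (auto simp: frechet_algebra_def associative_algebra_def)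
  note D = complex_vector_spaceD[OF vs] and Ax = complex_vector_space_axioms[OF vs]
  have m: "a \<otimes>\<^bsub>A\<^esub> b \<in> carrier A" if "a \<in> carrier A" "b \<in> carrier A" for a b
    using alg that by (simp add: associative_algebra_def)
  have dl: "(a \<oplus>\<^bsub>A\<^esub> b) \<otimes>\<^bsub>A\<^esub> c = a \<otimes>\<^bsub>A\<^esub> c \<oplus>\<^bsub>A\<^esub> b \<otimes>\<^bsub>A\<^esub> c"
    "a \<otimes>\<^bsub>A\<^esub> (b \<oplus>\<^bsub>A\<^esub> c) = a \<otimes>\<^bsub>A\<^esub> b \<oplus>\<^bsub>A\<^esub> a \<otimes>\<^bsub>A\<^esub> c"
    if "a \<in> carrier A" "b \<in> carrier A" "c \<in> carrier A" for a b c
    using alg that by (simp_all add: associative_algebra_def)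
  have sl: "(z \<odot>\<^bsub>A\<^esub> a) \<otimes>\<^bsub>A\<^esub> b = z \<odot>\<^bsub>A\<^esub> (a \<otimes>\<^bsub>A\<^esub> b)"
    "a \<otimes>\<^bsub>A\<^esub> (z \<odot>\<^bsub>A\<^esub> b) = z \<odot>\<^bsub>A\<^esub> (a \<otimes>\<^bsub>A\<^esub> b)"
    if "a \<in> carrier A" "b \<in> carrier A" for z a b
    using alg that by (simp_all add: associative_algebra_def)
  have z: "\<zero>\<^bsub>A\<^esub> \<otimes>\<^bsub>A\<^esub> a = \<zero>\<^bsub>A\<^esub>" "a \<otimes>\<^bsub>A\<^esub> \<zero>\<^bsub>A\<^esub> = \<zero>\<^bsub>A\<^esub>" if "a \<in> carrier A" for a
    using sl[OF D(1) that, of 0] sl(2)[OF that D(1), of 0] D m that by auto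
  have cont: "continuous_map (topo A) (topo A) T"
    if T: "\<And>x. x \<in> carrier A \<Longrightarrow> T x \<in> carrier A"
      and diff: "\<And>x y. x \<in> carrier A \<Longrightarrow> y \<in> carrier A \<Longrightarrow> T (x \<ominus>\<^bsub>A\<^esub> y) = T x \<ominus>\<^bsub>A\<^esub> T y"
      and K: "\<And>l x. x \<in> carrier A \<Longrightarrow> p l (T x) \<le> K l * p l x" "\<And>l. 0 \<le> K l" for T K
    unfolding continuous_map_def topA topspace_seminorm_topology
  proof (intro conjI allI impI)
    show "T \<in> carrier A \<rightarrow> carrier A" using T by blast
    fix W assume W: "openin (seminorm_topology A (range p)) W"
    show "openin (seminorm_topology A (range p)) {x \<in> carrier A. T x \<in> W}"
      unfolding openin_seminorm_topology
    proof (intro conjI ballI)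
      fix x assume x: "x \<in> {x \<in> carrier A. T x \<in> W}"
      then obtain F e where F: "finite F" "F \<subseteq> range p" "0 < e"
        "{y \<in> carrier A. \<forall>q\<in>F. q (y \<ominus>\<^bsub>A\<^esub> T x) < e} \<subseteq> W"
        using W unfolding openin_seminorm_topology by blast
      obtain L where L: "finite L" "F = p ` L" using finite_subset_image[OF F(1,2)] by blast
      let ?M = "1 + (\<Sum>l\<in>L. K l)"
      have M: "K l \<le> ?M" "0 < ?M" if "l \<in> L" for l
        using member_le_sum[OF that, of K] K(2) L(1) that by (auto simp: add_pos_nonneg sum_nonneg)
      have "0 < ?M" using K(2) by (simp add: add_pos_nonneg sum_nonneg)
      have "{y \<in> carrier A. \<forall>q\<in>F. q (y \<ominus>\<^bsub>A\<^esub> x) < e / ?M} \<subseteq> {x \<in> carrier A. T x \<in> W}"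
      proof
        fix y assume "y \<in> {y \<in> carrier A. \<forall>q\<in>F. q (y \<ominus>\<^bsub>A\<^esub> x) < e / ?M}"
        then have y: "y \<in> carrier A" "\<forall>q\<in>F. q (y \<ominus>\<^bsub>A\<^esub> x) < e / ?M" by auto
        have yx: "y \<ominus>\<^bsub>A\<^esub> x \<in> carrier A"
          using x y minus_eq_smult[OF vs] D by simp
        have "p l (T y \<ominus>\<^bsub>A\<^esub> T x) < e" if l: "l \<in> L" for l
        proof -
          have "p l (T y \<ominus>\<^bsub>A\<^esub> T x) \<le> K l * p l (y \<ominus>\<^bsub>A\<^esub> x)"
            using K(1)[OF yx, of l] diff x y by simp
          also have "\<dots> \<le> ?M * p l (y \<ominus>\<^bsub>A\<^esub> x)"
            using M(1)[OF l] sn[of l] yx by (intro mult_right_mono) (auto simp: seminorm_on_def)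
          also have "\<dots> < e" using y(2) l L \<open>0 < ?M\<close> by (auto simp: field_simps)
          finally show ?thesis .
        qed
        then show "y \<in> {x \<in> carrier A. T x \<in> W}" using F(4) T y L by blast
      qed
      then show "\<exists>F \<epsilon>. finite F \<and> F \<subseteq> range p \<and> 0 < \<epsilon> \<and>
          {y \<in> carrier A. \<forall>p\<in>F. p (y \<ominus>\<^bsub>A\<^esub> x) < \<epsilon>} \<subseteq> {x \<in> carrier A. T x \<in> W}"
        using F \<open>0 < ?M\<close> by (intro exI[of _ F] exI[of _ "e / ?M"]) simp
    qed blast
  qed
  have nn: "0 \<le> p l a" if "a \<in> carrier A" for l a using sn[of l] that by (simp add: seminorm_on_def)
  have "continuous_linear (regular_bimodule A) (regular_bimodule A) (\<lambda>x. b \<otimes>\<^bsub>A\<^esub> x)"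
    "continuous_linear (regular_bimodule A) (regular_bimodule A) (\<lambda>x. x \<otimes>\<^bsub>A\<^esub> b)"
    if b: "b \<in> carrier A" for b
  proof -
    have "continuous_map (topo A) (topo A) (\<lambda>x. b \<otimes>\<^bsub>A\<^esub> x)"
      by (rule cont[where K = "\<lambda>l. p l b"]) (use b sub nn in \<open>auto simp: m minus_eq_smult[OF vs] dl sl D\<close>)
    moreover have "continuous_map (topo A) (topo A) (\<lambda>x. x \<otimes>\<^bsub>A\<^esub> b)"
    proof (rule cont[where K = "\<lambda>l. p l b"])
      show "p l (x \<otimes>\<^bsub>A\<^esub> b) \<le> p l b * p l x" if "x \<in> carrier A" for l x
        using sub[OF that b, of l] by (simp add: mult.commute)
    qed (use b sub nn in \<open>auto simp: m minus_eq_smult[OF vs] dl sl D\<close>)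
    ultimately show "continuous_linear (regular_bimodule A) (regular_bimodule A) (\<lambda>x. b \<otimes>\<^bsub>A\<^esub> x)"
      "continuous_linear (regular_bimodule A) (regular_bimodule A) (\<lambda>x. x \<otimes>\<^bsub>A\<^esub> b)"
      using b by (auto simp: continuous_linear_def m dl sl z)
  qed
  moreover have "complex_vector_space (regular_bimodule A)"
    by (rule complex_vector_spaceI) (auto simp: D Ax(1,3-8) intro: Ax(2))
  ultimately show ?thesis by (simp add: topological_bimodule_def topA)
qed

lemma topological_bimodule_iterated_dual:
  assumes "iterated_dual B n Y" "topological_bimodule B (regular_bimodule B)"
  shows "topological_bimodule B Y"
  using assms by induction (blast intro: topological_bimodule_iso topological_bimodule_dual)+

text \<open>Any two copies of the \<open>n\<close>-th dual, in possibly different types, are isomorphic.\<close>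

lemma iterated_dual_unique:
  fixes Y :: "('b, 'y) bimodule" and Z :: "('b, 'z) bimodule"
  assumes "iterated_dual B n Y" "iterated_dual B n Z" "topological_bimodule B (regular_bimodule B)"
  shows "\<exists>\<phi>. bimodule_iso B Y Z \<phi>"
  using assms
proof (induction arbitrary: Z)
  case (base Y \<phi>)
  from base.prems(1) obtain \<psi> where "bimodule_iso B (regular_bimodule B) Z \<psi>"
    by (cases rule: iterated_dual.cases) auto
  then show ?case
    using bimodule_iso_sym[OF base.hyps base.prems(2)] bimodule_iso_trans by blast
next
  case (step n X Y \<phi>)
  from step.prems(1) obtain X' :: "('b, 'z) bimodule" and \<psi>
    where X': "iterated_dual B n X'" "bimodule_iso B (dual_bimodule X') Z \<psi>"
    by (cases rule: iterated_dual.cases) blast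
  have X: "topological_bimodule B X"
    by (rule topological_bimodule_iterated_dual[OF step.hyps(1) step.prems(2)])
  obtain \<theta> where "bimodule_iso B X X' \<theta>" using step.IH[OF X'(1) step.prems(2)] by blast
  then obtain \<eta> where "bimodule_iso B (dual_bimodule X) (dual_bimodule X') \<eta>"
    using bimodule_iso_dual X by blast
  then show ?case
    using bimodule_iso_trans[OF bimodule_iso_trans[OF
        bimodule_iso_sym[OF step.hyps(2) topological_bimodule_dual[OF X]]] X'(2)]
    by blast
qed

lemma derivations_inner_iso:
  assumes \<phi>: "bimodule_iso B Y Z \<phi>" and Y: "topological_bimodule B Y"
    and inner: "\<And>D. continuous_derivation B Y D \<Longrightarrow> inner_derivation B Y D"
    and D: "continuous_derivation B Z D"
    and B: "\<And>a b. a \<in> carrier B \<Longrightarrow> b \<in> carrier B \<Longrightarrow> a \<otimes>\<^bsub>B\<^esub> b \<in> carrier B"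
      "complex_vector_space B"
  shows "inner_derivation B Z D"
proof -
  let ?\<psi> = "inv_into (carrier Y) \<phi>"
  have Z: "topological_bimodule B Z" by (rule topological_bimodule_iso[OF \<phi> Y])
  have \<psi>: "bimodule_iso B Z Y ?\<psi>" by (rule bimodule_iso_sym[OF \<phi> Y])
  have bij: "bij_betw \<phi> (carrier Y) (carrier Z)" using \<phi> by (simp add: bimodule_iso_def)
  have in\<psi>: "?\<psi> z \<in> carrier Y" "\<phi> (?\<psi> z) = z" if "z \<in> carrier Z" for z
    using bij that by (auto simp: bij_betw_def inv_into_into f_inv_into_f)
  have vsY: "complex_vector_space Y" and vsZ: "complex_vector_space Z"
    using Y Z by (auto simp: topological_bimodule_def)
  have DZ: "D b \<in> carrier Z" if "b \<in> carrier B" for b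
    using D that by (auto simp: continuous_derivation_def)
  have actZ: "lact Z b x \<in> carrier Z" "ract Z x b \<in> carrier Z" if "b \<in> carrier B" "x \<in> carrier Z" for b x
    using Z that by (auto simp: topological_bimodule_def continuous_linear_def)
  have actY: "lact Y b x \<in> carrier Y" "ract Y x b \<in> carrier Y" if "b \<in> carrier B" "x \<in> carrier Y" for b x
    using Y that by (auto simp: topological_bimodule_def continuous_linear_def)
  have "continuous_map (topo B) (topo Y) (?\<psi> \<circ> D)"
    using D \<psi> unfolding continuous_derivation_def bimodule_iso_def
    by (meson continuous_map_compose homeomorphic_imp_continuous_map)
  then have "continuous_derivation B Y (?\<psi> \<circ> D)"
    using D \<psi> DZ in\<psi> actZ by (auto simp: continuous_derivation_def bimodule_iso_def B)
  from inner[OF this] obtain y where y: "y \<in> carrier Y"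
    "\<And>b. b \<in> carrier B \<Longrightarrow> ?\<psi> (D b) = lact Y b y \<ominus>\<^bsub>Y\<^esub> ract Y y b"
    by (auto simp: inner_derivation_def)
  have \<phi>y: "\<phi> y \<in> carrier Z" using bij y by (auto simp: bij_betw_def)
  have "D b = lact Z b (\<phi> y) \<ominus>\<^bsub>Z\<^esub> ract Z (\<phi> y) b" if b: "b \<in> carrier B" for b
  proof -
    have "D b = \<phi> (?\<psi> (D b))" using in\<psi>(2)[OF DZ[OF b]] by simp
    also have "\<dots> = \<phi> (lact Y b y \<ominus>\<^bsub>Y\<^esub> ract Y y b)" using y(2)[OF b] by simp
    also have "\<dots> = lact Z b (\<phi> y) \<ominus>\<^bsub>Z\<^esub> ract Z (\<phi> y) b"
      using \<phi> b y(1) \<phi>y actY actZ complex_vector_spaceD(3)[OF vsY]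
      by (simp add: minus_eq_smult[OF vsY] minus_eq_smult[OF vsZ] bimodule_iso_def)
    finally show ?thesis .
  qed
  then show ?thesis using \<phi>y by (auto simp: inner_derivation_def)
qed

lemma n_weakly_amenable_iff:
  fixes Y :: "('a, 'v) bimodule"
  assumes A: "frechet_algebra A p" and Y: "iterated_dual A n Y"
  shows "n_weakly_amenable TYPE('v) n A \<longleftrightarrow>
    (\<forall>D. continuous_derivation A Y D \<longrightarrow> inner_derivation A Y D)"
proof
  have reg: "topological_bimodule A (regular_bimodule A)" by (rule topological_bimodule_regular[OF A])
  have AA: "associative_algebra A" using A by (simp add: frechet_algebra_def)
  assume "n_weakly_amenable TYPE('v) n A"
  then obtain X :: "('a, 'v) bimodule" where X: "iterated_dual A n X"
    "\<And>D. continuous_derivation A X D \<Longrightarrow> inner_derivation A X D"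
    unfolding n_weakly_amenable_def by blast
  obtain \<phi> where "bimodule_iso A X Y \<phi>" using iterated_dual_unique[OF X(1) Y reg] by blast
  then show "\<forall>D. continuous_derivation A Y D \<longrightarrow> inner_derivation A Y D"
    using derivations_inner_iso[OF _ topological_bimodule_iterated_dual[OF X(1) reg] X(2)] AA
    unfolding associative_algebra_def by blast
qed (use Y in \<open>auto simp: n_weakly_amenable_def\<close>)

text \<open>A bimodule can be copied along any injection, so a large enough type always exists.\<close>

lemma bimodule_copy:
  fixes X :: "('b, 'x) bimodule" and g :: "'x \<Rightarrow> 'y"
  assumes g: "inj g" and X: "topological_bimodule B X"
  shows "\<exists>Y. bimodule_iso B X Y g"
proof -
  let ?h = "inv_into UNIV g"
  have h [simp]: "?h (g x) = x" for x using g by simp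
  have top: "topspace (topo X) = carrier X" using X by (simp add: topological_bimodule_def)
  define Y :: "('b, 'y) bimodule" where
    "Y = \<lparr>carrier = g ` carrier X, mult = (\<lambda>_ _. undefined), one = undefined,
      zero = g \<zero>\<^bsub>X\<^esub>, add = (\<lambda>u v. g (?h u \<oplus>\<^bsub>X\<^esub> ?h v)), smult = (\<lambda>c u. g (c \<odot>\<^bsub>X\<^esub> ?h u)),
      topo = pullback_topology (g ` carrier X) ?h (topo X),
      lact = (\<lambda>b u. g (lact X b (?h u))), ract = (\<lambda>u b. g (ract X (?h u) b))\<rparr>"
  have tY: "topspace (topo Y) = g ` carrier X"
    by (auto simp: Y_def topspace_pullback_topology top)
  have "homeomorphic_maps (topo X) (topo Y) g ?h"
    unfolding homeomorphic_maps_def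
  proof (intro conjI ballI)
    show "continuous_map (topo X) (topo Y) g"
      unfolding Y_def bimodule.simps top_vs.simps
      by (rule continuous_map_pullback'; simp add: top o_def; auto)
    show "continuous_map (topo Y) (topo X) ?h"
      using continuous_map_pullback[of "topo X" "topo X" id "g ` carrier X" ?h]
      by (simp add: Y_def)
  qed (auto simp: tY)
  then have "homeomorphic_map (topo X) (topo Y) g" by (rule homeomorphic_maps_imp_map)
  then have "bimodule_iso B X Y g"
    using g by (auto simp: bimodule_iso_def Y_def bij_betw_def inj_on_def)
  then show ?thesis by blast
qed

lemma iterated_dual_copy:
  fixes X :: "('b, 'x) bimodule" and g :: "'x \<Rightarrow> 'y"
  assumes "iterated_dual B n X" "inj g" "topological_bimodule B (regular_bimodule B)"
  shows "\<exists>Y \<phi>. iterated_dual B n Y \<and> bimodule_iso B X Y (\<phi> :: 'x \<Rightarrow> 'y)"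
  using assms
proof induction
  case (base X \<phi>)
  then obtain Y where "bimodule_iso B X Y g"
    using bimodule_copy topological_bimodule_iso by blast
  then show ?case using iterated_dual.base[OF bimodule_iso_trans[OF base.hyps]] by blast
next
  case (step n W X \<phi>)
  then obtain V \<theta> where V: "iterated_dual B n V" "bimodule_iso B W V (\<theta> :: 'x \<Rightarrow> 'y)" by blast
  have W: "topological_bimodule B W"
    by (rule topological_bimodule_iterated_dual[OF step.hyps(1) step.prems(2)])
  have V': "topological_bimodule B V" by (rule topological_bimodule_iso[OF V(2) W])
  have X: "topological_bimodule B X"
    by (rule topological_bimodule_iso[OF step.hyps(2) topological_bimodule_dual[OF W]])
  obtain Y where Y: "bimodule_iso B X Y g" using bimodule_copy[OF step.prems(1) X] by blast
  obtain \<eta> where "bimodule_iso B (dual_bimodule V) (dual_bimodule W) \<eta>"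
    using bimodule_iso_dual[OF bimodule_iso_sym[OF V(2) W] V'] by blast
  then have "iterated_dual B (Suc n) Y"
    using iterated_dual.step[OF V(1)] bimodule_iso_trans step.hyps(2) Y by metis
  then show ?case using Y by blast
qed

lemma iterated_dual_0_exists: "\<exists>Y :: ('a, 'a) bimodule. iterated_dual A 0 Y"
  using iterated_dual.base bimodule_iso_refl by blast

lemma iterated_dual_Suc_exists:
  fixes X :: "('a, 'v) bimodule"
  assumes A: "frechet_algebra A p" and X: "iterated_dual A n X"
  shows "\<exists>Y :: ('a, 'v + ('v \<Rightarrow> complex)) bimodule. iterated_dual A (Suc n) Y"
proof -
  have reg: "topological_bimodule A (regular_bimodule A)" by (rule topological_bimodule_regular[OF A])
  obtain X' and \<theta> :: "'v \<Rightarrow> 'v + ('v \<Rightarrow> complex)" where X': "iterated_dual A n X'" "bimodule_iso A X X' \<theta>"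
    using iterated_dual_copy[OF X inj_Inl reg] by metis
  have tX: "topological_bimodule A X" by (rule topological_bimodule_iterated_dual[OF X reg])
  have tX': "topological_bimodule A X'" by (rule topological_bimodule_iterated_dual[OF X'(1) reg])
  obtain \<eta> where \<eta>: "bimodule_iso A (dual_bimodule X') (dual_bimodule X) \<eta>"
    using bimodule_iso_dual[OF bimodule_iso_sym[OF X'(2) tX] tX'] by blast
  obtain Y :: "('a, 'v + ('v \<Rightarrow> complex)) bimodule" where "bimodule_iso A (dual_bimodule X) Y Inr"
    using bimodule_copy[OF inj_Inr topological_bimodule_dual[OF tX]] by blast
  then have "iterated_dual A (Suc n) Y"
    using iterated_dual.step[OF X'(1) bimodule_iso_trans[OF \<eta>]] by blast
  then show ?thesis by blast
qed

end

theory Submission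
  imports Defs
begin

text \<open>
  As a bimodule, the \<open>n\<close>-th dual of the unitization is \<open>A\<^sup>(\<^sup>n\<^sup>) \<oplus> \<complex>\<close>.
  For even \<open>n\<close>, a derivation \<open>d\<close> of \<open>A\<close> extends to \<open>(a, z) \<mapsto> (d a, 0)\<close>, and the first component of an
  element implementing the extension implements \<open>d\<close>.
  For odd \<open>n\<close>, a derivation of the unitization kills the identity, hence has the form
  \<open>(a, z) \<mapsto> (d a, \<phi> a)\<close>, where \<open>d\<close> is a derivation of \<open>A\<close>. As \<open>d\<close> is inner, \<open>\<phi>\<close> vanishes on products.
  Then \<open>a \<mapsto> \<phi>(a) \<phi>\<close>, with \<open>\<phi>\<close> moved into \<open>A\<^sup>(\<^sup>n\<^sup>)\<close> by the canonical embedding, is a derivation of \<open>A\<close>, too,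
  so it is inner, and evaluating it at \<open>a\<close> gives \<open>\<phi>(a)\<^sup>2 = 0\<close>.
\<close>

section \<open>Seminorm topologies and strong duals\<close>

text \<open>The last coordinate of a derivation of the unitization satisfies \<open>\<phi>(ab) =
  \<epsilon> a (\<delta> b) + \<epsilon> b (\<delta> a)\<close>. When \<open>\<delta>\<close> is
  inner, the terms are pairings with \<open>ab\<close> and \<open>ba\<close> that cancel in pairs.
  Nothing says that products span a dense subspace of \<open>A\<close>, so this alone does not make
  \<open>\<phi>\<close> zero; hence the detour through its square. The detour works because a
  functional vanishing on products is annihilated by \<open>A\<close> on both sides. The encoding of
  duals by copies in one fixed type \<open>'v\<close> is the other obstacle: each transfer must
  produce a copy of the dual of the other algebra inside the same \<open>'v\<close>. Passing down to
  \<open>A\<close>, pairs with scalar zero provide it. Passing up to the unitization,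
  \<open>'v\<close> has to absorb a factor \<open>complex\<close>; the multiples of a nonzero
  element of \<open>A\<close> embed the scalars into \<open>'v\<close>, and such an element exists
  because the zero algebra has an identity.\<close>

lemma continuous_map_seminorm_topologyI:
  assumes "f \<in> topspace T \<rightarrow> carrier X"
    and "\<And>x q e. x \<in> topspace T \<Longrightarrow> q \<in> P \<Longrightarrow> 0 < e \<Longrightarrow>
      \<exists>U. openin T U \<and> x \<in> U \<and> (\<forall>y\<in>U. q (f y \<ominus>\<^bsub>X\<^esub> f x) < e)"
  shows "continuous_map T (seminorm_topology X P) f"
  unfolding continuous_map_def topspace_seminorm_topology
proof (intro conjI allI impI)
  fix W assume W: "openin (seminorm_topology X P) W"
  have "\<exists>U. openin T U \<and> x \<in> U \<and> U \<subseteq> {x \<in> topspace T. f x \<in> W}" if x: "x \<in> topspace T" "f x \<in> W" for x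
  proof -
    obtain F e where F: "finite F" "F \<subseteq> P" "0 < e" "{y \<in> carrier X. \<forall>q\<in>F. q (y \<ominus>\<^bsub>X\<^esub> f x) < e} \<subseteq> W"
      using W x unfolding openin_seminorm_topology by blast
    have "\<forall>q\<in>F. \<exists>U. openin T U \<and> x \<in> U \<and> (\<forall>y\<in>U. q (f y \<ominus>\<^bsub>X\<^esub> f x) < e)"
      using assms(2) x F by blast
    then obtain U where U: "\<And>q. q \<in> F \<Longrightarrow> openin T (U q) \<and> x \<in> U q \<and> (\<forall>y\<in>U q. q (f y \<ominus>\<^bsub>X\<^esub> f x) < e)"
      by metis
    \<comment> \<open>The factor \<open>topspace T\<close> takes care of empty \<open>F\<close>,
      where the intersection over \<open>F\<close> is the whole type.\<close>
    have "openin T (topspace T \<inter> (\<Inter>q\<in>F. U q))"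
      using F(1) U by (cases "F = {}") (auto intro!: openin_Int openin_Inter)
    then show ?thesis
      using U x F(4) assms(1) by (intro exI[of _ "topspace T \<inter> (\<Inter>q\<in>F. U q)"]) blast
  qed
  then show "openin T {x \<in> topspace T. f x \<in> W}"
    by (subst openin_subopen) blast
qed (use assms(1) in blast)

text \<open>Open sets are defined by containing a ball around each of their points, so a ball is not
  open by definition. Around \<open>y\<close> the radius that the triangle inequality leaves over is
  enough.\<close>

lemma openin_seminorm_ball:
  fixes X :: "('x, 'm) top_vs_scheme"
  assumes X: "complex_vector_space X" and q: "seminorm_on X q" "q \<in> P" and x: "x \<in> carrier X"
  shows "openin (seminorm_topology X P) {y \<in> carrier X. q (y \<ominus>\<^bsub>X\<^esub> x) < e}"
  unfolding openin_seminorm_topology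
proof (intro conjI ballI)
  fix y assume y: "y \<in> {y \<in> carrier X. q (y \<ominus>\<^bsub>X\<^esub> x) < e}"
  interpret Module.module complex_ring X by fact
  have "q (w \<ominus>\<^bsub>X\<^esub> x) < e" if w: "w \<in> carrier X" "q (w \<ominus>\<^bsub>X\<^esub> y) < e - q (y \<ominus>\<^bsub>X\<^esub> x)" for w
  proof -
    have "(w \<ominus>\<^bsub>X\<^esub> y) \<oplus>\<^bsub>X\<^esub> (y \<ominus>\<^bsub>X\<^esub> x) = w \<ominus>\<^bsub>X\<^esub> x"
      using w y x by (simp add: a_minus_def a_assoc r_neg1)
    moreover have "q ((w \<ominus>\<^bsub>X\<^esub> y) \<oplus>\<^bsub>X\<^esub> (y \<ominus>\<^bsub>X\<^esub> x)) \<le> q (w \<ominus>\<^bsub>X\<^esub> y) + q (y \<ominus>\<^bsub>X\<^esub> x)"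
      using q(1) w y x by (simp add: seminorm_on_def)
    ultimately show ?thesis using w by simp
  qed
  then show "\<exists>F \<epsilon>. finite F \<and> F \<subseteq> P \<and> 0 < \<epsilon> \<and>
      {w \<in> carrier X. \<forall>p\<in>F. p (w \<ominus>\<^bsub>X\<^esub> y) < \<epsilon>} \<subseteq> {y \<in> carrier X. q (y \<ominus>\<^bsub>X\<^esub> x) < e}"
    using y q(2) by (intro exI[of _ "{q}"] exI[of _ "e - q (y \<ominus>\<^bsub>X\<^esub> x)"]) auto
qed blast

lemma seminorm_on_minus_self:
  fixes X :: "('x, 'm) top_vs_scheme"
  assumes "complex_vector_space X" "seminorm_on X q" "x \<in> carrier X"
  shows "q (x \<ominus>\<^bsub>X\<^esub> x) = 0"
proof -
  interpret Module.module complex_ring X by fact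
  have "q \<zero>\<^bsub>X\<^esub> = cmod 0 * q \<zero>\<^bsub>X\<^esub>"
    using assms(2) complex_vector_spaceD(4)[OF assms(1), of "\<zero>\<^bsub>X\<^esub>"] unfolding seminorm_on_def
    by (metis zero_closed)
  then show ?thesis using assms(3) by (simp add: a_minus_def r_neg)
qed

text \<open>The first coordinate of a product in the unitization is a sum of three terms; this lemma
  reduces its continuity to that of each term.\<close>

lemma continuous_map_seminorm_add:
  fixes X :: "('x, 'm) top_vs_scheme"
  assumes X: "complex_vector_space X" and P: "\<And>q. q \<in> P \<Longrightarrow> seminorm_on X q"
  shows "continuous_map (prod_topology (seminorm_topology X P) (seminorm_topology X P))
    (seminorm_topology X P) (\<lambda>(x, y). x \<oplus>\<^bsub>X\<^esub> y)"
proof (rule continuous_map_seminorm_topologyI)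
  interpret Module.module complex_ring X by fact
  show "(\<lambda>(x, y). x \<oplus>\<^bsub>X\<^esub> y) \<in> topspace (prod_topology (seminorm_topology X P) (seminorm_topology X P)) \<rightarrow> carrier X"
    by auto
  fix xy q and e :: real
  assume "xy \<in> topspace (prod_topology (seminorm_topology X P) (seminorm_topology X P))" and q: "q \<in> P" and e: "0 < e"
  then obtain x y where xy: "xy = (x, y)" "x \<in> carrier X" "y \<in> carrier X" by auto
  let ?B = "\<lambda>x. {w \<in> carrier X. q (w \<ominus>\<^bsub>X\<^esub> x) < e / 2}"
  have "q ((u \<oplus>\<^bsub>X\<^esub> v) \<ominus>\<^bsub>X\<^esub> (x \<oplus>\<^bsub>X\<^esub> y)) < e" if uv: "u \<in> ?B x" "v \<in> ?B y" for u v
  proof -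
    have "(u \<oplus>\<^bsub>X\<^esub> v) \<ominus>\<^bsub>X\<^esub> (x \<oplus>\<^bsub>X\<^esub> y) = (u \<ominus>\<^bsub>X\<^esub> x) \<oplus>\<^bsub>X\<^esub> (v \<ominus>\<^bsub>X\<^esub> y)"
      using uv xy by (simp add: a_minus_def minus_add a_ac)
    moreover have "q ((u \<ominus>\<^bsub>X\<^esub> x) \<oplus>\<^bsub>X\<^esub> (v \<ominus>\<^bsub>X\<^esub> y)) \<le> q (u \<ominus>\<^bsub>X\<^esub> x) + q (v \<ominus>\<^bsub>X\<^esub> y)"
      using P[OF q] uv xy by (simp add: seminorm_on_def)
    ultimately show ?thesis using uv by simp
  qed
  then show "\<exists>U. openin (prod_topology (seminorm_topology X P) (seminorm_topology X P)) U \<and> xy \<in> U \<and>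
      (\<forall>w\<in>U. q ((case w of (x, y) \<Rightarrow> x \<oplus>\<^bsub>X\<^esub> y) \<ominus>\<^bsub>X\<^esub> (case xy of (x, y) \<Rightarrow> x \<oplus>\<^bsub>X\<^esub> y)) < e)"
    using openin_seminorm_ball[OF X P[OF q] q, of _ "e / 2"] seminorm_on_minus_self[OF X P[OF q]] xy e
    by (intro exI[of _ "?B x \<times> ?B y"]) (simp add: openin_prod_Times_iff del: less_divide_eq_numeral1)
qed

lemma smult_minus:
  fixes X :: "('x, 'm) top_vs_scheme"
  assumes X: "complex_vector_space X" and x: "x \<in> carrier X"
  shows "(c \<odot>\<^bsub>X\<^esub> x) \<ominus>\<^bsub>X\<^esub> (d \<odot>\<^bsub>X\<^esub> x) = (c - d) \<odot>\<^bsub>X\<^esub> x"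
  using complex_vector_space_axioms(5)[OF X x, of c "- d"] complex_vector_space_axioms(7)[OF X x, of "- 1" d]
    complex_vector_spaceD(3)[OF X x]
  by (simp add: minus_eq_smult[OF X])

lemma continuous_map_seminorm_smult:
  fixes X :: "('x, 'm) top_vs_scheme"
  assumes X: "complex_vector_space X" and P: "\<And>q. q \<in> P \<Longrightarrow> seminorm_on X q"
  shows "x \<in> carrier X \<Longrightarrow> continuous_map euclidean (seminorm_topology X P) (\<lambda>c. c \<odot>\<^bsub>X\<^esub> x)"
    and "continuous_map (seminorm_topology X P) (seminorm_topology X P) (\<lambda>x. c \<odot>\<^bsub>X\<^esub> x)"
proof -
  note D = complex_vector_spaceD[OF X]
  assume x: "x \<in> carrier X"
  show "continuous_map euclidean (seminorm_topology X P) (\<lambda>c. c \<odot>\<^bsub>X\<^esub> x)"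
  proof (rule continuous_map_seminorm_topologyI)
    fix c :: complex and q and e :: real assume q: "q \<in> P" and e: "0 < e"
    have qx: "0 \<le> q x" using P[OF q] x by (simp add: seminorm_on_def)
    \<comment> \<open>The \<open>+ 1\<close> keeps the radius positive and finite when
      \<open>q x\<close> is zero.\<close>
    have "q ((d \<odot>\<^bsub>X\<^esub> x) \<ominus>\<^bsub>X\<^esub> (c \<odot>\<^bsub>X\<^esub> x)) < e" if "cmod (c - d) < e / (q x + 1)" for d
    proof -
      have "cmod (c - d) * q x \<le> cmod (c - d) * (q x + 1)" by (simp add: mult_left_mono)
      also have "\<dots> < e" using that qx by (simp add: field_simps)
      finally show ?thesis
        using P[OF q] x smult_minus[OF X x] by (simp add: seminorm_on_def norm_minus_commute)
    qed
    then show "\<exists>U. openin euclidean U \<and> c \<in> U \<and> (\<forall>d\<in>U. q ((d \<odot>\<^bsub>X\<^esub> x) \<ominus>\<^bsub>X\<^esub> (c \<odot>\<^bsub>X\<^esub> x)) < e)"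
      using e qx by (intro exI[of _ "ball c (e / (q x + 1))"]) (auto simp: dist_norm)
  qed (use x D in auto)
next
  note D = complex_vector_spaceD[OF X] and Ax = complex_vector_space_axioms[OF X]
  show "continuous_map (seminorm_topology X P) (seminorm_topology X P) (\<lambda>x. c \<odot>\<^bsub>X\<^esub> x)"
  proof (rule continuous_map_seminorm_topologyI)
    fix x q and e :: real assume "x \<in> topspace (seminorm_topology X P)" and q: "q \<in> P" and e: "0 < e"
    then have x: "x \<in> carrier X" by simp
    let ?B = "{y \<in> carrier X. q (y \<ominus>\<^bsub>X\<^esub> x) < e / (cmod c + 1)}"
    have "q ((c \<odot>\<^bsub>X\<^esub> y) \<ominus>\<^bsub>X\<^esub> (c \<odot>\<^bsub>X\<^esub> x)) < e" if y: "y \<in> ?B" for y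
    proof -
      have "(c \<odot>\<^bsub>X\<^esub> y) \<ominus>\<^bsub>X\<^esub> (c \<odot>\<^bsub>X\<^esub> x) = c \<odot>\<^bsub>X\<^esub> (y \<ominus>\<^bsub>X\<^esub> x)"
        using x y D by (simp add: minus_eq_smult[OF X] Ax(6) flip: Ax(7))
      moreover have yx: "y \<ominus>\<^bsub>X\<^esub> x \<in> carrier X" using x y D by (simp add: minus_eq_smult[OF X])
      ultimately have "q ((c \<odot>\<^bsub>X\<^esub> y) \<ominus>\<^bsub>X\<^esub> (c \<odot>\<^bsub>X\<^esub> x)) = cmod c * q (y \<ominus>\<^bsub>X\<^esub> x)" "0 \<le> q (y \<ominus>\<^bsub>X\<^esub> x)"
        using P[OF q] by (auto simp: seminorm_on_def)
      moreover have "cmod c * q (y \<ominus>\<^bsub>X\<^esub> x) \<le> (cmod c + 1) * q (y \<ominus>\<^bsub>X\<^esub> x)"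
        using calculation by (simp add: mult_right_mono)
      moreover have "(cmod c + 1) * q (y \<ominus>\<^bsub>X\<^esub> x) < e"
        using y by (simp add: field_simps add_pos_nonneg pos_less_divide_eq)
      ultimately show ?thesis by linarith
    qed
    then show "\<exists>U. openin (seminorm_topology X P) U \<and> x \<in> U \<and>
        (\<forall>y\<in>U. q ((c \<odot>\<^bsub>X\<^esub> y) \<ominus>\<^bsub>X\<^esub> (c \<odot>\<^bsub>X\<^esub> x)) < e)"
      using openin_seminorm_ball[OF X P[OF q] q x] seminorm_on_minus_self[OF X P[OF q] x] x e
      by (intro exI[of _ ?B]) (auto simp: add_pos_nonneg intro!: divide_pos_pos add_nonneg_pos)
  qed (use D in auto)
qed

section \<open>Bounded sets, point evaluations and neighbourhoods in the strong dual\<close>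

lemma bounded_set_singleton:
  fixes X :: "('x, 'm) top_vs_scheme"
  assumes X: "complex_vector_space X" and x: "x \<in> carrier X"
    and cont: "continuous_map euclidean (topo X) (\<lambda>c. c \<odot>\<^bsub>X\<^esub> x)"
  shows "bounded_set X {x}"
  unfolding bounded_set_def
proof (intro conjI allI impI)
  fix U assume U: "openin (topo X) U \<and> \<zero>\<^bsub>X\<^esub> \<in> U"
  \<comment> \<open>Boundedness is drawn from continuity of the scalar multiples of \<open>x\<close>
    and not from seminorms, because the former property is passed on from each dual to the
    next.\<close>
  have "openin euclidean {c \<in> topspace euclidean. c \<odot>\<^bsub>X\<^esub> x \<in> U}"
    by (rule openin_continuous_map_preimage[OF cont]) (use U in blast)
  then have "open {c. c \<odot>\<^bsub>X\<^esub> x \<in> U}" by simp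
  moreover have "0 \<in> {c. c \<odot>\<^bsub>X\<^esub> x \<in> U}" using U complex_vector_spaceD(4)[OF X x] by simp
  ultimately obtain r where r: "r > 0" "ball 0 r \<subseteq> {c. c \<odot>\<^bsub>X\<^esub> x \<in> U}"
    by (meson openE)
  have "{x} \<subseteq> (\<lambda>u. complex_of_real t \<odot>\<^bsub>X\<^esub> u) ` U" if t: "t > 1 / r" for t
  proof -
    have t0: "t > 0" using t r by (meson divide_pos_pos less_trans zero_less_one)
    have "complex_of_real (1 / t) \<in> ball 0 r"
      using t t0 r by (simp add: norm_divide field_simps)
    moreover have "complex_of_real t \<odot>\<^bsub>X\<^esub> (complex_of_real (1 / t) \<odot>\<^bsub>X\<^esub> x) = x"
      using t0 complex_vector_space_axioms(7)[OF X x, of "complex_of_real t" "complex_of_real (1 / t)"]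
        complex_vector_space_axioms(8)[OF X x] by simp
    ultimately show ?thesis
      using r(2) by (intro subsetI image_eqI[of _ _ "complex_of_real (1 / t) \<odot>\<^bsub>X\<^esub> x"]) auto
  qed
  then show "\<exists>s>0. \<forall>t>s. {x} \<subseteq> (\<lambda>u. complex_of_real t \<odot>\<^bsub>X\<^esub> u) ` U"
    using r(1) by (intro exI[of _ "1 / r"]) simp
qed (use x in simp)

lemma continuous_functionals_zero:
  assumes "f \<in> continuous_functionals X" "complex_vector_space X"
  shows "f \<zero>\<^bsub>X\<^esub> = 0"
proof -
  have "f (0 \<odot>\<^bsub>X\<^esub> \<zero>\<^bsub>X\<^esub>) = 0 * f \<zero>\<^bsub>X\<^esub>"
    using assms(1) complex_vector_spaceD(1)[OF assms(2)] unfolding continuous_functionals_def by blast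
  then show ?thesis using complex_vector_spaceD(5)[OF assms(2)] by simp
qed

lemma bounded_on_bounded_set:
  fixes X :: "('x, 'm) top_vs_scheme"
  assumes X: "complex_vector_space X" "topspace (topo X) = carrier X"
    and E: "bounded_set X E" and f: "f \<in> continuous_functionals X"
  obtains M where "0 < M" "\<And>x. x \<in> E \<Longrightarrow> cmod (f x) < M"
proof -
  let ?U = "{x \<in> topspace (topo X). f x \<in> ball 0 1}"
  have "openin (topo X) ?U"
    by (rule openin_continuous_map_preimage[of _ euclidean])
      (use f in \<open>simp_all add: continuous_functionals_def\<close>)
  moreover have "\<zero>\<^bsub>X\<^esub> \<in> ?U"
    using X(2) complex_vector_spaceD(1)[OF X(1)] continuous_functionals_zero[OF f X(1)] by simp
  ultimately obtain s where s: "s > 0" "\<forall>t>s. E \<subseteq> (\<lambda>u. complex_of_real t \<odot>\<^bsub>X\<^esub> u) ` ?U"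
    using E unfolding bounded_set_def by blast
  have "cmod (f x) < s + 1" if xE: "x \<in> E" for x
  proof -
    \<comment> \<open>Absorption is known only for factors strictly above \<open>s\<close>, hence
      \<open>s + 1\<close>. Pulling this factor out of \<open>f\<close> scales the bound 1 on the
      neighbourhood to a bound on \<open>E\<close>.\<close>
    have "E \<subseteq> (\<lambda>u. complex_of_real (s + 1) \<odot>\<^bsub>X\<^esub> u) ` ?U" using s(2)[rule_format, of "s + 1"] by simp
    then obtain u where u: "u \<in> carrier X" "cmod (f u) < 1" "x = complex_of_real (s + 1) \<odot>\<^bsub>X\<^esub> u"
      using xE X(2) by auto
    then have "cmod (f x) = cmod (complex_of_real (s + 1)) * cmod (f u)"
      using f by (simp add: continuous_functionals_def norm_mult)
    also have "\<dots> < s + 1" unfolding norm_of_real using u(2) s(1) by simp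
    finally show ?thesis .
  qed
  then show thesis using that[of "s + 1"] s(1) by simp
qed

text \<open>This makes singletons of the dual bounded, so that point evaluations are again available
  one dual higher. The radius works because \<open>f\<close> is bounded on the bounded set that
  defines the neighbourhood.\<close>

lemma continuous_map_smult_dual:
  fixes X :: "('b, 'x) bimodule"
  assumes X: "complex_vector_space X" "topspace (topo X) = carrier X"
    and f: "f \<in> continuous_functionals X"
  shows "continuous_map euclidean (strong_topology X) (\<lambda>c. \<lambda>x\<in>carrier X. c * f x)"
  unfolding continuous_map_def topspace_strong_topology
proof (intro conjI allI impI)
  have "c \<odot>\<^bsub>dual_bimodule X\<^esub> f \<in> carrier (dual_bimodule X)" for c
    using complex_vector_spaceD(3)[OF complex_vector_space_dual[OF X]] f by simp
  then show "(\<lambda>c. \<lambda>x\<in>carrier X. c * f x) \<in> topspace euclidean \<rightarrow> continuous_functionals X"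
    by simp
  then have cf: "(\<lambda>x\<in>carrier X. c * f x) \<in> continuous_functionals X" for c by auto
  fix W assume W: "openin (strong_topology X) W"
  have "\<exists>d>0. ball c d \<subseteq> {c. (\<lambda>x\<in>carrier X. c * f x) \<in> W}" if c: "(\<lambda>x\<in>carrier X. c * f x) \<in> W" for c
  proof -
    obtain E e where E: "bounded_set X E" "0 < e"
      "{g \<in> continuous_functionals X. \<forall>x\<in>E. cmod (g x - (\<lambda>x\<in>carrier X. c * f x) x) < e} \<subseteq> W"
      using W c unfolding openin_strong_topology by blast
    obtain M where M: "0 < M" "\<And>x. x \<in> E \<Longrightarrow> cmod (f x) < M" using bounded_on_bounded_set[OF X E(1) f] by blast
    have "(\<lambda>x\<in>carrier X. d * f x) \<in> W" if d: "d \<in> ball c (e / M)" for d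
    proof -
      have "cmod (d * f x - c * f x) < e" if x: "x \<in> E" for x
      proof -
        have "cmod (d * f x - c * f x) = cmod (d - c) * cmod (f x)"
          by (simp add: norm_mult flip: left_diff_distrib)
        also have "\<dots> \<le> cmod (d - c) * M" using M(2)[OF x] by (simp add: mult_left_mono)
        also have "\<dots> < e" using d M(1) by (simp add: dist_norm norm_minus_commute field_simps)
        finally show ?thesis .
      qed
      then show ?thesis using E cf by (auto simp: bounded_set_def subset_iff)
    qed
    then show ?thesis using E M by (intro exI[of _ "e / M"]) auto
  qed
  then show "openin euclidean {c \<in> topspace euclidean. (\<lambda>x\<in>carrier X. c * f x) \<in> W}"
    by (simp add: open_contains_ball)
qed

text \<open>The canonical image of \<open>x\<close> in the bidual. As \<open>{x}\<close> is bounded,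
  closeness of two functionals at \<open>x\<close> is already a condition of the strong
  topology.\<close>

lemma evaluation_functional:
  fixes X :: "('b, 'x) bimodule"
  assumes X: "complex_vector_space X" "topspace (topo X) = carrier X" and x: "bounded_set X {x}"
  shows "(\<lambda>f\<in>continuous_functionals X. f x) \<in> continuous_functionals (dual_bimodule X)"
proof -
  have xX: "x \<in> carrier X" using x by (simp add: bounded_set_def)
  have "continuous_map (strong_topology X) euclidean (\<lambda>f. f x)"
    unfolding continuous_map_def topspace_strong_topology
  proof (intro conjI allI impI)
    fix W :: "complex set" assume "openin euclidean W"
    then have W: "open W" by simp
    show "openin (strong_topology X) {f \<in> continuous_functionals X. f x \<in> W}"
      unfolding openin_strong_topology
    proof (intro conjI ballI)
      fix f assume f: "f \<in> {f \<in> continuous_functionals X. f x \<in> W}"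
      then obtain e where "0 < e" "ball (f x) e \<subseteq> W" using W by (auto elim: openE)
      then show "\<exists>E \<epsilon>. bounded_set X E \<and> 0 < \<epsilon> \<and>
          {g \<in> continuous_functionals X. \<forall>x\<in>E. cmod (g x - f x) < \<epsilon>}
          \<subseteq> {f \<in> continuous_functionals X. f x \<in> W}"
        using x by (intro exI[of _ "{x}"] exI[of _ e]) (auto simp: dist_norm norm_minus_commute subset_iff)
    qed blast
  qed simp
  then have "continuous_map (strong_topology X) euclidean (\<lambda>f\<in>continuous_functionals X. f x)"
    by (rule continuous_map_eq) simp
  moreover have "f \<oplus>\<^bsub>dual_bimodule X\<^esub> g \<in> continuous_functionals X \<and> c \<odot>\<^bsub>dual_bimodule X\<^esub> f \<in> continuous_functionals X"
    if "f \<in> continuous_functionals X" "g \<in> continuous_functionals X" for f g c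
    using complex_vector_spaceD(2,3)[OF complex_vector_space_dual[OF X]] that by auto
  ultimately show ?thesis using xX
    by (subst continuous_functionals_def) auto
qed

text \<open>The functionals within \<open>e\<close> of \<open>f\<close> at each point of
  \<open>E\<close> need not form an open set, since the differences may come arbitrarily close to
  \<open>e\<close>. A common bound \<open>d < e\<close> leaves a gap, and half of it serves as
  radius.\<close>

lemma strong_neighbourhood:
  assumes E: "bounded_set X E" "0 < e" and f: "f \<in> continuous_functionals X"
  shows "\<exists>U. openin (strong_topology X) U \<and> f \<in> U \<and> (\<forall>g\<in>U. \<forall>x\<in>E. cmod (g x - f x) < e)"
proof -
  let ?U = "{g \<in> continuous_functionals X. \<exists>d<e. \<forall>x\<in>E. cmod (g x - f x) \<le> d}"
  have "openin (strong_topology X) ?U"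
    unfolding openin_strong_topology
  proof (intro conjI ballI)
    fix g assume "g \<in> ?U"
    then obtain d where d: "d < e" "\<forall>x\<in>E. cmod (g x - f x) \<le> d" by blast
    have "\<forall>x\<in>E. cmod (h x - f x) \<le> (d + e) / 2" if h: "\<forall>x\<in>E. cmod (h x - g x) < (e - d) / 2" for h
    proof
      fix x assume x: "x \<in> E"
      have "cmod (h x - f x) \<le> cmod (h x - g x) + cmod (g x - f x)"
        using norm_triangle_ineq[of "h x - g x" "g x - f x"] by simp
      also have "\<dots> \<le> (d + e) / 2" using h d x by (force simp: field_simps)
      finally show "cmod (h x - f x) \<le> (d + e) / 2" .
    qed
    then have "{h \<in> continuous_functionals X. \<forall>x\<in>E. cmod (h x - g x) < (e - d) / 2} \<subseteq> ?U"
      using d(1) by (auto intro!: exI[of _ "(d + e) / 2"])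
    then show "\<exists>E \<epsilon>. bounded_set X E \<and> 0 < \<epsilon> \<and>
        {h \<in> continuous_functionals X. \<forall>x\<in>E. cmod (h x - g x) < \<epsilon>} \<subseteq> ?U"
      using E d(1) by (intro exI[of _ E] exI[of _ "(e - d) / 2"]) simp
  qed blast
  then show ?thesis using E f by (intro exI[of _ ?U]) (auto intro: exI[of _ 0])
qed

section \<open>Bimodules over the unitization\<close>

text \<open>
  The dual of the unitization of \<open>A\<close> is \<open>A\<^sup>* \<oplus> \<complex>\<close> with
  \<open>(a, z) \<cdot> (f, t) = (a \<cdot> f + z f, f(a) + z t)\<close>, and its bidual is \<open>A\<^sup>*\<^sup>* \<oplus> \<complex>\<close> with
  \<open>(a, z) \<cdot> (F, s) = (a \<cdot> F + z F + s a, z s)\<close>. The maps \<open>\<epsilon>\<close> (pairing with \<open>a\<close>) and \<open>\<iota>\<close>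
  (canonical image of \<open>a\<close>) cover both parities by one construction, and dualising
  exchanges them.
\<close>

definition unitization_bimodule ::
  "('a, 'x) bimodule \<Rightarrow> ('a \<Rightarrow> 'x) \<Rightarrow> ('a \<Rightarrow> 'x \<Rightarrow> complex) \<Rightarrow> ('a \<times> complex, 'x \<times> complex) bimodule" where
  "unitization_bimodule X \<iota> \<epsilon> = \<lparr>carrier = carrier X \<times> UNIV, mult = (\<lambda>_ _. undefined), one = undefined,
     zero = (\<zero>\<^bsub>X\<^esub>, 0),
     add = (\<lambda>(x, s) (y, t). (x \<oplus>\<^bsub>X\<^esub> y, s + t)),
     smult = (\<lambda>c (x, s). (c \<odot>\<^bsub>X\<^esub> x, c * s)),
     topo = prod_topology (topo X) euclidean,
     lact = (\<lambda>(a, z) (x, t). (lact X a x \<oplus>\<^bsub>X\<^esub> t \<odot>\<^bsub>X\<^esub> \<iota> a \<oplus>\<^bsub>X\<^esub> z \<odot>\<^bsub>X\<^esub> x, \<epsilon> a x + z * t)),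
     ract = (\<lambda>(x, t) (a, z). (ract X x a \<oplus>\<^bsub>X\<^esub> z \<odot>\<^bsub>X\<^esub> x \<oplus>\<^bsub>X\<^esub> t \<odot>\<^bsub>X\<^esub> \<iota> a, \<epsilon> a x + t * z))\<rparr>"

lemma unitization_bimodule_simps [simp]:
  "carrier (unitization_bimodule X \<iota> \<epsilon>) = carrier X \<times> UNIV"
  "zero (unitization_bimodule X \<iota> \<epsilon>) = (\<zero>\<^bsub>X\<^esub>, 0)"
  "add (unitization_bimodule X \<iota> \<epsilon>) (x, s) (y, t) = (x \<oplus>\<^bsub>X\<^esub> y, s + t)"
  "smult (unitization_bimodule X \<iota> \<epsilon>) c (x, s) = (c \<odot>\<^bsub>X\<^esub> x, c * s)"
  "topo (unitization_bimodule X \<iota> \<epsilon>) = prod_topology (topo X) euclidean"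
  "lact (unitization_bimodule X \<iota> \<epsilon>) (a, z) (x, t) =
     (lact X a x \<oplus>\<^bsub>X\<^esub> t \<odot>\<^bsub>X\<^esub> \<iota> a \<oplus>\<^bsub>X\<^esub> z \<odot>\<^bsub>X\<^esub> x, \<epsilon> a x + z * t)"
  "ract (unitization_bimodule X \<iota> \<epsilon>) (x, t) (a, z) =
     (ract X x a \<oplus>\<^bsub>X\<^esub> z \<odot>\<^bsub>X\<^esub> x \<oplus>\<^bsub>X\<^esub> t \<odot>\<^bsub>X\<^esub> \<iota> a, \<epsilon> a x + t * z)"
  by (simp_all add: unitization_bimodule_def)

lemma unitization_simps [simp]:
  "carrier (unitization A p) = carrier A \<times> UNIV"
  "zero (unitization A p) = (\<zero>\<^bsub>A\<^esub>, 0)"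
  "add (unitization A p) (x, s) (y, t) = (x \<oplus>\<^bsub>A\<^esub> y, s + t)"
  "smult (unitization A p) c (x, s) = (c \<odot>\<^bsub>A\<^esub> x, c * s)"
  "mult (unitization A p) (x, s) (y, t) = (x \<otimes>\<^bsub>A\<^esub> y \<oplus>\<^bsub>A\<^esub> t \<odot>\<^bsub>A\<^esub> x \<oplus>\<^bsub>A\<^esub> s \<odot>\<^bsub>A\<^esub> y, s * t)"
  by (simp_all add: unitization_def module.extend_def unitization_vs_def)

lemma regular_bimodule_simps [simp]:
  "carrier (regular_bimodule B) = carrier B" "zero (regular_bimodule B) = zero B"
  "add (regular_bimodule B) = add B" "smult (regular_bimodule B) = smult B"
  "topo (regular_bimodule B) = topo B" "lact (regular_bimodule B) = mult B"
  "ract (regular_bimodule B) = mult B"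
  by (simp_all add: regular_bimodule_def)

text \<open>The topology is defined over the record that still lacks the field \<open>topo\<close>.
  Subtraction depends only on carrier, zero and addition, so the extended record gives the same open
  sets.\<close>

lemma topo_unitization:
  "topo (unitization A p) = seminorm_topology (unitization A p) (range (unitization_seminorm p))"
proof -
  have "x \<ominus>\<^bsub>unitization A p\<^esub> y = x \<ominus>\<^bsub>unitization_vs A\<^esub> y" for x y
    by (simp add: a_minus_def a_inv_def unitization_def module.extend_def unitization_vs_def m_inv_def)
  moreover have "carrier (unitization A p) = carrier (unitization_vs A)"
    by (simp add: unitization_def module.extend_def)
  moreover have "topo (unitization A p) = seminorm_topology (unitization_vs A) (range (unitization_seminorm p))"
    by (simp add: unitization_def module.extend_def)
  ultimately show ?thesis by (simp add: seminorm_topology_def)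
qed

lemma complex_vector_space_unitization:
  assumes A: "complex_vector_space A"
  shows "complex_vector_space (unitization A p)"
proof -
  note D = complex_vector_spaceD[OF A] and Ax = complex_vector_space_axioms[OF A]
  show ?thesis
    by (rule complex_vector_spaceI)
      (auto simp: D Ax(1,3-8) distrib_left distrib_right intro: Ax(2))
qed

lemma complex_vector_space_unitization_bimodule:
  assumes X: "complex_vector_space X"
  shows "complex_vector_space (unitization_bimodule X \<iota> \<epsilon>)"
proof -
  note D = complex_vector_spaceD[OF X] and Ax = complex_vector_space_axioms[OF X]
  show ?thesis
    by (rule complex_vector_spaceI)
      (auto simp: D Ax(1,3-8) distrib_left distrib_right intro: Ax(2))
qed

lemma unitization_bimodule_iso:
  fixes A :: "'a top_vs"
  assumes \<theta>: "bimodule_iso A X Y \<theta>" and X: "topological_bimodule A X"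
    and \<iota>: "\<And>a. a \<in> carrier A \<Longrightarrow> \<iota> a \<in> carrier X" "\<And>a. a \<in> carrier A \<Longrightarrow> \<theta> (\<iota> a) = \<iota>' a"
    and \<epsilon>: "\<And>a x. a \<in> carrier A \<Longrightarrow> x \<in> carrier X \<Longrightarrow> \<epsilon>' a (\<theta> x) = \<epsilon> a x"
  shows "bimodule_iso (unitization A p) (unitization_bimodule X \<iota> \<epsilon>) (unitization_bimodule Y \<iota>' \<epsilon>')
    (map_prod \<theta> id)"
proof -
  have bij: "bij_betw \<theta> (carrier X) (carrier Y)" using \<theta> by (simp add: bimodule_iso_def)
  have vs: "complex_vector_space X" using X by (simp add: topological_bimodule_def)
  note D = complex_vector_spaceD[OF vs]
  have act: "lact X a x \<in> carrier X" "ract X x a \<in> carrier X" if "a \<in> carrier A" "x \<in> carrier X" for a x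
    using X that by (auto simp: topological_bimodule_def continuous_linear_def)
  have "homeomorphic_map (topo X) (topo Y) \<theta>" using \<theta> by (simp add: bimodule_iso_def)
  then obtain \<psi> where "homeomorphic_maps (topo X) (topo Y) \<theta> \<psi>" by (auto simp: homeomorphic_map_maps)
  then have "homeomorphic_maps (prod_topology (topo X) euclidean) (prod_topology (topo Y) (euclidean :: complex topology))
      (\<lambda>(x, y). (\<theta> x, id y)) (\<lambda>(x, y). (\<psi> x, id y))"
    by (simp only: homeomorphic_maps_prod homeomorphic_maps_id simp_thms)
  then have "homeomorphic_map (prod_topology (topo X) euclidean) (prod_topology (topo Y) (euclidean :: complex topology))
      (map_prod \<theta> id)"
    using homeomorphic_maps_map by (fastforce simp: map_prod_def)
  moreover have "bij_betw (map_prod \<theta> id) (carrier X \<times> (UNIV :: complex set)) (carrier Y \<times> UNIV)"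
    using bij_betw_map_prod[OF bij, of id UNIV UNIV] by simp
  moreover have "\<theta> \<zero>\<^bsub>X\<^esub> = \<zero>\<^bsub>Y\<^esub>"
    "\<And>x y. x \<in> carrier X \<Longrightarrow> y \<in> carrier X \<Longrightarrow> \<theta> (x \<oplus>\<^bsub>X\<^esub> y) = \<theta> x \<oplus>\<^bsub>Y\<^esub> \<theta> y"
    "\<And>c x. x \<in> carrier X \<Longrightarrow> \<theta> (c \<odot>\<^bsub>X\<^esub> x) = c \<odot>\<^bsub>Y\<^esub> \<theta> x"
    "\<And>a x. a \<in> carrier A \<Longrightarrow> x \<in> carrier X \<Longrightarrow> \<theta> (lact X a x) = lact Y a (\<theta> x) \<and> \<theta> (ract X x a) = ract Y (\<theta> x) a"
    using \<theta> by (auto simp: bimodule_iso_def)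
  ultimately show ?thesis
    unfolding bimodule_iso_def by (auto simp: D act \<iota> \<epsilon>)
qed

text \<open>The tools for identifying the strong dual of the sum: the inclusion transposes to
  restriction, the projection keeps sets bounded, the last coordinate is bounded on bounded sets,
  and evaluation at \<open>(0, 1)\<close> is strongly continuous.\<close>

lemma unitization_bimodule_maps:
  fixes X :: "('a, 'x) bimodule"
  assumes X: "complex_vector_space X" "topspace (topo X) = carrier X"
    and cont: "\<And>x. x \<in> carrier X \<Longrightarrow> continuous_map euclidean (topo X) (\<lambda>c. c \<odot>\<^bsub>X\<^esub> x)"
  shows "continuous_linear X (unitization_bimodule X \<iota> \<epsilon>) (\<lambda>x. (x, 0))"
    and "continuous_linear (unitization_bimodule X \<iota> \<epsilon>) X fst"
    and "(\<lambda>y\<in>carrier X \<times> UNIV. snd y) \<in> continuous_functionals (unitization_bimodule X \<iota> \<epsilon>)"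
    and "x \<in> carrier X \<Longrightarrow> bounded_set (unitization_bimodule X \<iota> \<epsilon>) {(x, t)}"
proof -
  note D = complex_vector_spaceD[OF X(1)]
  show "continuous_linear X (unitization_bimodule X \<iota> \<epsilon>) (\<lambda>x. (x, 0))"
    by (auto simp: continuous_linear_def continuous_map_paired)
  show "continuous_linear (unitization_bimodule X \<iota> \<epsilon>) X fst"
    by (auto simp: continuous_linear_def continuous_map_fst)
  have "continuous_map (prod_topology (topo X) (euclidean :: complex topology)) euclidean (\<lambda>y\<in>carrier X \<times> UNIV. snd y)"
    by (rule continuous_map_eq[OF continuous_map_snd]) (auto simp: X)
  then show "(\<lambda>y\<in>carrier X \<times> UNIV. snd y) \<in> continuous_functionals (unitization_bimodule X \<iota> \<epsilon>)"
    by (auto simp: continuous_functionals_def D)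
  assume x: "x \<in> carrier X"
  have "continuous_map euclidean euclidean (\<lambda>c. c * t)" by (auto intro!: continuous_intros)
  then show "bounded_set (unitization_bimodule X \<iota> \<epsilon>) {(x, t)}"
    using x cont[OF x]
    by (intro bounded_set_singleton complex_vector_space_unitization_bimodule X) (auto simp: continuous_map_paired)
qed

lemma unitization_functional:
  fixes X :: "('a, 'x) bimodule"
  assumes X: "complex_vector_space X" "topspace (topo X) = carrier X"
    and f: "f \<in> continuous_functionals X"
  shows "(\<lambda>(x, t)\<in>carrier X \<times> UNIV. f x + s * t) \<in> continuous_functionals (unitization_bimodule X \<iota> \<epsilon>)"
proof -
  note D = complex_vector_spaceD[OF X(1)]
  have "continuous_map (prod_topology (topo X) (euclidean :: complex topology)) euclidean (\<lambda>y. f (fst y) + s * snd y)"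
  proof (rule continuous_map_add)
    show "continuous_map (prod_topology (topo X) (euclidean :: complex topology)) euclidean (\<lambda>y. f (fst y))"
      using continuous_map_compose[OF continuous_map_fst, of "topo X" euclidean f euclidean] f
      by (simp add: o_def continuous_functionals_def)
    have "continuous_map euclidean euclidean (\<lambda>t. s * t)" by (auto intro!: continuous_intros)
    then show "continuous_map (prod_topology (topo X) (euclidean :: complex topology)) euclidean (\<lambda>y. s * snd y)"
      using continuous_map_compose[OF continuous_map_snd, of euclidean euclidean "\<lambda>t. s * t" "topo X"]
      by (simp add: o_def)
  qed
  then have "continuous_map (prod_topology (topo X) (euclidean :: complex topology)) euclidean
      (\<lambda>(x, t)\<in>carrier X \<times> UNIV. f x + s * t)"
    by (rule continuous_map_eq) (auto simp: X)
  then show ?thesis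
    using f by (auto simp: continuous_functionals_def D algebra_simps)
qed

text \<open>A functional on the sum is determined by its restriction \<open>f\<close> to
  \<open>X\<close> and its value \<open>s\<close> at \<open>(0, 1)\<close>. Acting by
  \<open>(a, z)\<close> from the left and splitting again gives the functional that sends
  \<open>x\<close> to \<open>f(x a) + z f(x) + s \<epsilon> a x\<close>, and the scalar
  \<open>f(\<iota> a) + z s\<close>. This is the same construction with \<open>\<iota>\<close> and
  \<open>\<epsilon>\<close> exchanged.\<close>

lemma dual_unitization_bimodule:
  fixes A :: "'a top_vs" and X :: "('a, 'x) bimodule"
  assumes X: "topological_bimodule A X"
    and cont: "\<And>x. x \<in> carrier X \<Longrightarrow> continuous_map euclidean (topo X) (\<lambda>c. c \<odot>\<^bsub>X\<^esub> x)"
    and \<iota>: "\<And>a. a \<in> carrier A \<Longrightarrow> \<iota> a \<in> carrier X"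
    and \<epsilon>: "\<And>a. a \<in> carrier A \<Longrightarrow> (\<lambda>x\<in>carrier X. \<epsilon> a x) \<in> continuous_functionals X"
  shows "bimodule_iso (unitization A p) (dual_bimodule (unitization_bimodule X \<iota> \<epsilon>))
    (unitization_bimodule (dual_bimodule X) (\<lambda>a. \<lambda>x\<in>carrier X. \<epsilon> a x) (\<lambda>a f. f (\<iota> a)))
    (\<lambda>F. (\<lambda>x\<in>carrier X. F (x, 0), F (\<zero>\<^bsub>X\<^esub>, 1)))"
proof -
  have vs: "complex_vector_space X" and top: "topspace (topo X) = carrier X"
    using X by (auto simp: topological_bimodule_def)
  note D = complex_vector_spaceD[OF vs] and Ax = complex_vector_space_axioms[OF vs]
  have act: "lact X a x \<in> carrier X" "ract X x a \<in> carrier X" if "a \<in> carrier A" "x \<in> carrier X" for a x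
    using X that by (auto simp: topological_bimodule_def continuous_linear_def)
  have act0: "lact X a \<zero>\<^bsub>X\<^esub> = \<zero>\<^bsub>X\<^esub>" "ract X \<zero>\<^bsub>X\<^esub> a = \<zero>\<^bsub>X\<^esub>" if "a \<in> carrier A" for a
    using X that by (auto simp: topological_bimodule_def continuous_linear_def)
  have zr: "x \<oplus>\<^bsub>X\<^esub> \<zero>\<^bsub>X\<^esub> = x" if "x \<in> carrier X" for x using Ax(2)[OF that D(1)] Ax(3)[OF that] by simp
  have \<epsilon>0: "\<epsilon> a \<zero>\<^bsub>X\<^esub> = 0" if "a \<in> carrier A" for a
    using continuous_functionals_zero[OF \<epsilon>[OF that] vs] D(1) by simp
  let ?E = "unitization_bimodule X \<iota> \<epsilon>"
  have vsE: "complex_vector_space ?E" "topspace (topo ?E) = carrier ?E"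
    by (auto simp: complex_vector_space_unitization_bimodule vs top)
  define \<Theta> where "\<Theta> = (\<lambda>F :: 'x \<times> complex \<Rightarrow> complex. (\<lambda>x\<in>carrier X. F (x, 0), F (\<zero>\<^bsub>X\<^esub>, 1)))"
  define \<Psi> where "\<Psi> = (\<lambda>(f, s). \<lambda>(x, t)\<in>carrier X \<times> UNIV. f x + s * t :: complex)"
  have j: "continuous_linear X ?E (\<lambda>x. (x, 0))"
    and \<pi>: "continuous_linear ?E X fst"
    and \<tau>: "(\<lambda>y\<in>carrier X \<times> UNIV. snd y) \<in> continuous_functionals ?E"
    and bnd: "\<And>x t. x \<in> carrier X \<Longrightarrow> bounded_set ?E {(x, t)}"
    using unitization_bimodule_maps[OF vs top cont] by blast+
  have \<Theta>1: "fst (\<Theta> F) = dual_map X (\<lambda>x. (x, 0)) F" for F by (simp add: \<Theta>_def dual_map_def)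
  have split: "F (x, t) = F (x, 0) + t * F (\<zero>\<^bsub>X\<^esub>, 1)"
    if F: "F \<in> continuous_functionals ?E" and x: "x \<in> carrier X" for F x t
  proof -
    have "F (x \<oplus>\<^bsub>X\<^esub> \<zero>\<^bsub>X\<^esub>, 0 + t) = F (x, 0) + F (\<zero>\<^bsub>X\<^esub>, t)"
      using F x D(1) by (simp add: continuous_functionals_def del: add_0)
    moreover have "F (t \<odot>\<^bsub>X\<^esub> \<zero>\<^bsub>X\<^esub>, t * 1) = t * F (\<zero>\<^bsub>X\<^esub>, 1)"
      using F D(1) by (simp add: continuous_functionals_def del: mult_1_right)
    ultimately show ?thesis using x D zr by simp
  qed
  have \<Theta>: "\<Theta> F \<in> continuous_functionals X \<times> UNIV" if "F \<in> continuous_functionals ?E" for F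
    using dual_map_functional[OF j vs top that] \<Theta>1[of F] by (simp add: mem_Times_iff)
  have \<Psi>: "\<Psi> y \<in> continuous_functionals ?E" if "y \<in> continuous_functionals X \<times> UNIV" for y
    using unitization_functional[OF vs top, of "fst y" "snd y" \<iota> \<epsilon>] that by (auto simp: \<Psi>_def)
  have \<Psi>\<Theta>: "\<Psi> (\<Theta> F) = F" if F: "F \<in> continuous_functionals ?E" for F
  proof
    fix y
    show "\<Psi> (\<Theta> F) y = F y"
    proof (cases "y \<in> carrier X \<times> UNIV")
      case True
      then show ?thesis using split[OF F, of "fst y" "snd y"] by (auto simp: \<Psi>_def \<Theta>_def mult.commute)
    next
      case False
      then show ?thesis
        using F by (cases y) (simp add: \<Psi>_def \<Theta>_def continuous_functionals_def extensional_def)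
    qed
  qed
  have \<Theta>\<Psi>: "\<Theta> (\<Psi> y) = y" if "y \<in> continuous_functionals X \<times> UNIV" for y
  proof -
    have f: "fst y \<in> continuous_functionals X" using that by auto
    have "fst y \<zero>\<^bsub>X\<^esub> = 0" by (rule continuous_functionals_zero[OF f vs])
    then show ?thesis
      using f by (auto simp: \<Psi>_def \<Theta>_def prod_eq_iff fun_eq_iff restrict_def continuous_functionals_def extensional_def D
          split: prod.split)
  qed
  let ?S = "strong_topology ?E" and ?P = "prod_topology (strong_topology X) (euclidean :: complex topology)"
  \<comment> \<open>The first coordinate is the transpose of the inclusion of \<open>X\<close>, the
    second the evaluation at the point \<open>(0, 1)\<close>.\<close>
  have "continuous_map ?S ?P \<Theta>"
  proof -
    have "continuous_map ?S (strong_topology X) (fst \<circ> \<Theta>)"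
      using dual_map_continuous[OF j vs top] by (rule continuous_map_eq) (simp add: \<Theta>1)
    moreover have "continuous_map ?S euclidean (snd \<circ> \<Theta>)"
      using evaluation_functional[OF vsE bnd[OF D(1), of 1]]
      by (auto simp: continuous_functionals_def \<Theta>_def o_def elim: continuous_map_eq)
    ultimately show ?thesis by (simp add: continuous_map_pairwise)
  qed
  moreover have "continuous_map ?P ?S \<Psi>"
    unfolding continuous_map_def
  proof (intro conjI allI impI)
    show "\<Psi> \<in> topspace ?P \<rightarrow> topspace ?S" using \<Psi> by auto
    fix W assume W: "openin ?S W"
    have "\<exists>U. openin ?P U \<and> y \<in> U \<and> U \<subseteq> {y \<in> topspace ?P. \<Psi> y \<in> W}"
      if y: "y \<in> topspace ?P" "\<Psi> y \<in> W" for y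
    proof -
      obtain f s where fs: "y = (f, s)" "f \<in> continuous_functionals X" using y(1) by auto
      obtain E e where E: "bounded_set ?E E" "0 < e"
        "{g \<in> continuous_functionals ?E. \<forall>x\<in>E. cmod (g x - \<Psi> y x) < e} \<subseteq> W"
        using W y(2) unfolding openin_strong_topology by blast
      have EX: "E \<subseteq> carrier X \<times> UNIV" using E(1) by (simp add: bounded_set_def)
      \<comment> \<open>A bounded set of the sum has a bounded projection to \<open>X\<close> and
        scalars bounded by some \<open>M\<close>. Each coordinate is allotted half of
        \<open>e\<close>, which gives the scalar the radius \<open>e / (2 * M)\<close>.\<close>
      have fE: "bounded_set X (fst ` E)"
        using bounded_set_image[OF \<pi> E(1) vsE(2)] D(1) by simp
      obtain M where M: "0 < M" "\<And>x. x \<in> E \<Longrightarrow> cmod (snd x) < M"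
        using bounded_on_bounded_set[OF vsE E(1) \<tau>] EX by (metis (no_types, lifting) restrict_apply' subsetD)
      obtain V where V: "openin (strong_topology X) V" "f \<in> V"
        "\<forall>g\<in>V. \<forall>x\<in>fst ` E. cmod (g x - f x) < e / 2"
        using strong_neighbourhood[OF fE, of "e / 2" f] E(2) fs(2) by auto
      have VX: "V \<subseteq> continuous_functionals X" using V(1) openin_subset by fastforce
      have "\<Psi> (g, r) \<in> W" if g: "g \<in> V" "r \<in> ball s (e / (2 * M))" for g r
      proof -
        have "cmod (\<Psi> (g, r) x - \<Psi> y x) < e" if x: "x \<in> E" for x
        proof -
          have "\<Psi> (g, r) x - \<Psi> y x = (g (fst x) - f (fst x)) + (r - s) * snd x"
            using EX x by (auto simp: \<Psi>_def fs(1) algebra_simps)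
          then have "cmod (\<Psi> (g, r) x - \<Psi> y x) \<le> cmod (g (fst x) - f (fst x)) + cmod (r - s) * cmod (snd x)"
            by (metis norm_mult norm_triangle_ineq)
          moreover have "cmod (g (fst x) - f (fst x)) < e / 2" using V(3) g(1) x by blast
          moreover have "cmod (r - s) * cmod (snd x) \<le> cmod (r - s) * M"
            using M(2)[OF x] by (simp add: mult_left_mono)
          moreover have "cmod (r - s) * M < e / 2"
            using g(2) M(1) by (simp add: dist_norm norm_minus_commute field_simps)
          ultimately show ?thesis by linarith
        qed
        moreover have "\<Psi> (g, r) \<in> continuous_functionals ?E" using \<Psi>[of "(g, r)"] g(1) VX by blast
        ultimately show ?thesis using E(3) by blast
      qed
      then show ?thesis
        using V(1,2) VX E(2) M(1) fs
        by (intro exI[of _ "V \<times> ball s (e / (2 * M))"]) (auto simp: openin_prod_Times_iff)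
    qed
    then show "openin ?P {y \<in> topspace ?P. \<Psi> y \<in> W}"
      by (subst openin_subopen) blast
  qed
  ultimately have "homeomorphic_maps ?S ?P \<Theta> \<Psi>"
    using \<Psi>\<Theta> \<Theta>\<Psi> by (auto simp: homeomorphic_maps_def)
  then have "homeomorphic_map ?S ?P \<Theta>" by (rule homeomorphic_maps_imp_map)
  moreover have "bij_betw \<Theta> (continuous_functionals ?E) (continuous_functionals X \<times> UNIV)"
    by (rule bij_betwI[where g = \<Psi>]) (use \<Theta> \<Psi> \<Theta>\<Psi> \<Psi>\<Theta> in auto)
  moreover have "\<Theta> (lact (dual_bimodule ?E) (a, z) F) =
      lact (unitization_bimodule (dual_bimodule X) (\<lambda>a. \<lambda>x\<in>carrier X. \<epsilon> a x) (\<lambda>a f. f (\<iota> a))) (a, z) (\<Theta> F)"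
    "\<Theta> (ract (dual_bimodule ?E) F (a, z)) =
      ract (unitization_bimodule (dual_bimodule X) (\<lambda>a. \<lambda>x\<in>carrier X. \<epsilon> a x) (\<lambda>a f. f (\<iota> a))) (\<Theta> F) (a, z)"
    if a: "a \<in> carrier A" and F: "F \<in> continuous_functionals ?E" for a z F
  proof -
    have F_add: "F (x \<oplus>\<^bsub>X\<^esub> y, 0) = F (x, 0) + F (y, 0)" if "x \<in> carrier X" "y \<in> carrier X" for x y
    proof -
      have "F ((x, 0) \<oplus>\<^bsub>?E\<^esub> (y, 0)) = F (x, 0) + F (y, 0)"
        using F that unfolding continuous_functionals_def by (simp del: unitization_bimodule_simps(3))
      then show ?thesis by simp
    qed
    have F_smult: "F (c \<odot>\<^bsub>X\<^esub> x, 0) = c * F (x, 0)" if "x \<in> carrier X" for x c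
    proof -
      have "F (c \<odot>\<^bsub>?E\<^esub> (x, 0)) = c * F (x, 0)"
        using F that unfolding continuous_functionals_def by (simp del: unitization_bimodule_simps(4))
      then show ?thesis by simp
    qed
    have F0: "F (\<zero>\<^bsub>X\<^esub>, 0) = 0" using F_smult[OF D(1), of 0] D by simp
    \<comment> \<open>The general rule applies to \<open>F (x, 0)\<close> on its own right side and
      would loop. The instances cover the shapes that the last coordinate takes after acting on
      \<open>(x, 0)\<close> and \<open>(0, 1)\<close>.\<close>
    note S = split[OF F, where t = "t + u" for t u] split[OF F, where t = "\<epsilon> a x" for x] split[OF F, where t = z]
    show "\<Theta> (lact (dual_bimodule ?E) (a, z) F) =
      lact (unitization_bimodule (dual_bimodule X) (\<lambda>a. \<lambda>x\<in>carrier X. \<epsilon> a x) (\<lambda>a f. f (\<iota> a))) (a, z) (\<Theta> F)"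
      using a by (auto simp: \<Theta>_def dual_map_def fun_eq_iff D act act0 \<epsilon>0 \<iota> S F_add F_smult F0 algebra_simps)
    show "\<Theta> (ract (dual_bimodule ?E) F (a, z)) =
      ract (unitization_bimodule (dual_bimodule X) (\<lambda>a. \<lambda>x\<in>carrier X. \<epsilon> a x) (\<lambda>a f. f (\<iota> a))) (\<Theta> F) (a, z)"
      using a by (auto simp: \<Theta>_def dual_map_def fun_eq_iff D act act0 \<epsilon>0 \<iota> S F_add F_smult F0 algebra_simps)
  qed
  ultimately have "bimodule_iso (unitization A p) (dual_bimodule ?E)
    (unitization_bimodule (dual_bimodule X) (\<lambda>a. \<lambda>x\<in>carrier X. \<epsilon> a x) (\<lambda>a f. f (\<iota> a))) \<Theta>"
    unfolding bimodule_iso_def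
    by (auto simp: \<Theta>_def D fun_eq_iff simp del: dual_bimodule_simps(6,7) unitization_bimodule_simps(6,7))
  then show ?thesis by (simp add: \<Theta>_def)
qed

section \<open>The unitization as a topological product and as a bimodule over itself\<close>

lemma frechet_algebraD:
  assumes "frechet_algebra A p"
  shows "complex_vector_space A" "associative_algebra A" "seminorm_on A (p l)"
    "topo A = seminorm_topology A (range p)"
    "a \<in> carrier A \<Longrightarrow> b \<in> carrier A \<Longrightarrow> a \<otimes>\<^bsub>A\<^esub> b \<in> carrier A"
    "topspace (topo A) = carrier A"
  using assms by (auto simp: frechet_algebra_def associative_algebra_def)

lemma minus_unitization:
  assumes A: "complex_vector_space A" and "x \<in> carrier A" "y \<in> carrier A"
  shows "(x, s) \<ominus>\<^bsub>unitization A p\<^esub> (y, t) = (x \<ominus>\<^bsub>A\<^esub> y, s - t)"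
  using assms minus_eq_smult[OF complex_vector_space_unitization[OF A], of "(x, s)" p "(y, t)"]
  by (simp add: minus_eq_smult)

lemma seminorm_on_unitization:
  assumes A: "complex_vector_space A" and p: "seminorm_on A (p l)"
  shows "seminorm_on (unitization A p) (unitization_seminorm p l)"
proof -
  have "p l (x \<oplus>\<^bsub>A\<^esub> y) + cmod (s + t) \<le> p l x + cmod s + (p l y + cmod t)"
    if "x \<in> carrier A" "y \<in> carrier A" for x y s t
  proof -
    have "p l (x \<oplus>\<^bsub>A\<^esub> y) \<le> p l x + p l y" using p that by (simp add: seminorm_on_def)
    then show ?thesis using norm_triangle_ineq[of s t] by linarith
  qed
  then show ?thesis
    using p by (auto simp: seminorm_on_def unitization_seminorm_def norm_mult distrib_left)
qed

text \<open>The identity is continuous into the seminorm topology by splitting \<open>e\<close> into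
  halves, and out of it because each seminorm of the unitization dominates both of its summands. A
  homeomorphism that is the identity means equality of topologies.\<close>

lemma topo_unitization_eq_prod:
  assumes A: "frechet_algebra A p"
  shows "topo (unitization A p) = prod_topology (topo A) euclidean"
proof -
  note vs = frechet_algebraD(1)[OF A] and sn = frechet_algebraD(3)[OF A] and topA = frechet_algebraD(4)[OF A]
  let ?U = "unitization A p"
  note vsU = complex_vector_space_unitization[OF vs, of p] and snU = seminorm_on_unitization[OF vs sn]
  have "continuous_map (prod_topology (topo A) euclidean) (topo ?U) id"
    unfolding topo_unitization
  proof (rule continuous_map_seminorm_topologyI)
    fix x q and e :: real
    assume "x \<in> topspace (prod_topology (topo A) (euclidean :: complex topology))"
      and "q \<in> range (unitization_seminorm p)" and e: "0 < e"
    then obtain a s l where x: "x = (a, s)" "a \<in> carrier A" and q: "q = unitization_seminorm p l"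
      by (auto simp: frechet_algebraD(6)[OF A])
    let ?B = "{b \<in> carrier A. p l (b \<ominus>\<^bsub>A\<^esub> a) < e / 2}"
    have "p l (b \<ominus>\<^bsub>A\<^esub> a) + cmod (t - s) < e" if "b \<in> ?B" "t \<in> ball s (e / 2)" for b t
    proof -
      have "cmod (t - s) < e / 2" using that(2) by (simp add: dist_norm norm_minus_commute)
      moreover have "p l (b \<ominus>\<^bsub>A\<^esub> a) < e / 2" using that(1) by blast
      ultimately show ?thesis by linarith
    qed
    moreover have "openin (topo A) ?B"
      unfolding topA by (rule openin_seminorm_ball[OF vs sn _ x(2)]) simp
    moreover have "a \<in> ?B" using x e seminorm_on_minus_self[OF vs sn x(2)] by simp
    ultimately show "\<exists>U. openin (prod_topology (topo A) euclidean) U \<and> x \<in> U \<and> (\<forall>y\<in>U. q (id y \<ominus>\<^bsub>?U\<^esub> id x) < e)"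
      using e x(2) unfolding x(1) q
      by (intro exI[of _ "?B \<times> ball s (e / 2)"])
        (simp add: openin_prod_Times_iff minus_unitization[OF vs] unitization_seminorm_def del: mem_ball less_divide_eq_numeral1)
  qed (simp add: frechet_algebraD(6)[OF A])
  moreover have "continuous_map (topo ?U) (topo A) fst"
    unfolding topA
  proof (rule continuous_map_seminorm_topologyI)
    fix x q and e :: real assume "x \<in> topspace (topo ?U)" and "q \<in> range p" and e: "0 < e"
    then obtain a s l where x: "x = (a, s)" "a \<in> carrier A" and q: "q = p l"
      by (auto simp: topo_unitization)
    let ?B = "{y \<in> carrier ?U. unitization_seminorm p l (y \<ominus>\<^bsub>?U\<^esub> x) < e}"
    have "q (fst y \<ominus>\<^bsub>A\<^esub> fst x) < e" if y: "y \<in> ?B" for y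
    proof -
      obtain b t where bt: "y = (b, t)" "b \<in> carrier A" using y by auto
      have "p l (b \<ominus>\<^bsub>A\<^esub> a) + cmod (t - s) < e"
        using y x bt by (simp add: minus_unitization[OF vs] unitization_seminorm_def)
      then have "p l (b \<ominus>\<^bsub>A\<^esub> a) < e" using norm_ge_zero[of "t - s"] by linarith
      then show ?thesis using bt x q by simp
    qed
    moreover have "openin (topo ?U) ?B"
      unfolding topo_unitization by (rule openin_seminorm_ball[OF vsU snU]) (use x in auto)
    moreover have "x \<in> ?B" using x e seminorm_on_minus_self[OF vsU snU, of x l] by simp
    ultimately show "\<exists>U. openin (topo ?U) U \<and> x \<in> U \<and> (\<forall>y\<in>U. q (fst y \<ominus>\<^bsub>A\<^esub> fst x) < e)"
      by blast
  qed (auto simp: topo_unitization)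
  moreover have "continuous_map (topo ?U) euclidean snd"
    unfolding continuous_map_def
  proof (intro conjI allI impI)
    fix W :: "complex set" assume "openin euclidean W"
    then have W: "open W" by simp
    have "\<exists>U. openin (topo ?U) U \<and> x \<in> U \<and> U \<subseteq> {x \<in> topspace (topo ?U). snd x \<in> W}"
      if x': "x \<in> topspace (topo ?U)" "snd x \<in> W" for x
    proof -
      obtain a s where x: "x = (a, s)" "a \<in> carrier A" "s \<in> W" using x' by (auto simp: topo_unitization)
      obtain e where e: "e > 0" "ball s e \<subseteq> W" using W x(3) by (auto elim: openE)
      \<comment> \<open>Every seminorm of the unitization dominates the modulus of the scalar; the
        index \<open>0\<close> is an arbitrary choice.\<close>
      let ?B = "{y \<in> carrier ?U. unitization_seminorm p 0 (y \<ominus>\<^bsub>?U\<^esub> x) < e}"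
      have "snd y \<in> W" if y: "y \<in> ?B" for y
      proof -
        obtain b t where bt: "y = (b, t)" "b \<in> carrier A" using y by auto
        have "p 0 (b \<ominus>\<^bsub>A\<^esub> a) + cmod (t - s) < e"
          using y x bt by (simp add: minus_unitization[OF vs] unitization_seminorm_def)
        moreover have "0 \<le> p 0 (b \<ominus>\<^bsub>A\<^esub> a)"
          using sn[of 0] bt x complex_vector_spaceD[OF vs] by (simp add: seminorm_on_def minus_eq_smult[OF vs])
        ultimately have "t \<in> ball s e" by (simp add: dist_norm norm_minus_commute)
        then show ?thesis using bt e by auto
      qed
      moreover have "openin (topo ?U) ?B"
        unfolding topo_unitization by (rule openin_seminorm_ball[OF vsU snU]) (use x in auto)
      moreover have "x \<in> ?B" using x e seminorm_on_minus_self[OF vsU snU, of x 0] by simp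
      ultimately show ?thesis by (intro exI[of _ ?B]) (auto simp: topo_unitization)
    qed
    then show "openin (topo ?U) {x \<in> topspace (topo ?U). snd x \<in> W}" by (subst openin_subopen) blast
  qed simp
  ultimately have "homeomorphic_maps (topo ?U) (prod_topology (topo A) euclidean) id id"
    by (simp add: homeomorphic_maps_def continuous_map_pairwise)
  then show ?thesis by (simp only: homeomorphic_maps_id)
qed

text \<open>The start of the recursion: with \<open>\<iota>\<close> the identity and
  \<open>\<epsilon>\<close> zero, the action formula becomes the product of the unitization.\<close>

lemma unitization_bimodule_regular:
  assumes A: "frechet_algebra A p"
  shows "bimodule_iso (unitization A p) (regular_bimodule (unitization A p))
    (unitization_bimodule (regular_bimodule A) (\<lambda>a. a) (\<lambda>_ _. 0)) id"
  by (auto simp: bimodule_iso_def topo_unitization_eq_prod[OF A] homeomorphic_map_id)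

text \<open>Separate continuity of the product is checked coordinatewise in the product topology,
  without first establishing that the unitization is a Frechet algebra.\<close>

lemma topological_bimodule_regular_unitization:
  assumes A: "frechet_algebra A p"
  shows "topological_bimodule (unitization A p) (regular_bimodule (unitization A p))"
proof -
  note vs = frechet_algebraD(1)[OF A] and sn = frechet_algebraD(3)[OF A] and topA = frechet_algebraD(4)[OF A]
    and m = frechet_algebraD(5)[OF A]
  note D = complex_vector_spaceD[OF vs] and Ax = complex_vector_space_axioms[OF vs]
  let ?U = "unitization A p" and ?P = "prod_topology (topo A) (euclidean :: complex topology)"
  note vsU = complex_vector_space_unitization[OF vs, of p]
  have alg: "(a \<oplus>\<^bsub>A\<^esub> b) \<otimes>\<^bsub>A\<^esub> c = a \<otimes>\<^bsub>A\<^esub> c \<oplus>\<^bsub>A\<^esub> b \<otimes>\<^bsub>A\<^esub> c"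
    "a \<otimes>\<^bsub>A\<^esub> (b \<oplus>\<^bsub>A\<^esub> c) = a \<otimes>\<^bsub>A\<^esub> b \<oplus>\<^bsub>A\<^esub> a \<otimes>\<^bsub>A\<^esub> c"
    "(z \<odot>\<^bsub>A\<^esub> a) \<otimes>\<^bsub>A\<^esub> b = z \<odot>\<^bsub>A\<^esub> (a \<otimes>\<^bsub>A\<^esub> b)" "a \<otimes>\<^bsub>A\<^esub> (z \<odot>\<^bsub>A\<^esub> b) = z \<odot>\<^bsub>A\<^esub> (a \<otimes>\<^bsub>A\<^esub> b)"
    if "a \<in> carrier A" "b \<in> carrier A" "c \<in> carrier A" for a b c z
    using frechet_algebraD(2)[OF A] that by (simp_all add: associative_algebra_def)
  have tb: "topological_bimodule A (regular_bimodule A)" by (rule topological_bimodule_regular[OF A])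
  have mult: "continuous_map (topo A) (topo A) (\<lambda>x. a \<otimes>\<^bsub>A\<^esub> x)" "continuous_map (topo A) (topo A) (\<lambda>x. x \<otimes>\<^bsub>A\<^esub> a)"
    "a \<otimes>\<^bsub>A\<^esub> \<zero>\<^bsub>A\<^esub> = \<zero>\<^bsub>A\<^esub>" "\<zero>\<^bsub>A\<^esub> \<otimes>\<^bsub>A\<^esub> a = \<zero>\<^bsub>A\<^esub>" if "a \<in> carrier A" for a
    using tb that by (auto simp: topological_bimodule_def continuous_linear_def)
  have add: "continuous_map T (topo A) (\<lambda>y. f y \<oplus>\<^bsub>A\<^esub> g y)"
    if "continuous_map T (topo A) f" "continuous_map T (topo A) g" for T :: "'b topology" and f g
  proof -
    have "continuous_map (prod_topology (topo A) (topo A)) (topo A) (\<lambda>(x, y). x \<oplus>\<^bsub>A\<^esub> y)"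
      unfolding topA by (rule continuous_map_seminorm_add[OF vs]) (use sn in auto)
    moreover have "continuous_map T (prod_topology (topo A) (topo A)) (\<lambda>y. (f y, g y))"
      using that by (simp add: continuous_map_paired)
    ultimately show ?thesis
      using continuous_map_compose[of T _ "\<lambda>y. (f y, g y)"] by (fastforce simp: o_def)
  qed
  have smult: "a \<in> carrier A \<Longrightarrow> continuous_map euclidean (topo A) (\<lambda>c. c \<odot>\<^bsub>A\<^esub> a)"
    "continuous_map (topo A) (topo A) (\<lambda>x. c \<odot>\<^bsub>A\<^esub> x)" for a c
    unfolding topA by (rule continuous_map_seminorm_smult[OF vs]; use sn in auto)+
  have fst: "continuous_map ?P (topo A) (\<lambda>y. f (fst y))" if "continuous_map (topo A) (topo A) f" for f
    using continuous_map_compose[OF continuous_map_fst that] by (simp add: o_def)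
  have snd: "continuous_map ?P T (\<lambda>y. f (snd y))" if "continuous_map euclidean T f" for f :: "complex \<Rightarrow> 'c" and T
    using continuous_map_compose[OF continuous_map_snd that] by (simp add: o_def)
  have cm: "continuous_map euclidean euclidean (\<lambda>t::complex. z * t)" for z
    by (auto intro!: continuous_intros)
  have cont: "continuous_map ?P ?P (\<lambda>y. (a \<otimes>\<^bsub>A\<^esub> fst y \<oplus>\<^bsub>A\<^esub> snd y \<odot>\<^bsub>A\<^esub> a \<oplus>\<^bsub>A\<^esub> z \<odot>\<^bsub>A\<^esub> fst y, z * snd y))"
    "continuous_map ?P ?P (\<lambda>y. (fst y \<otimes>\<^bsub>A\<^esub> a \<oplus>\<^bsub>A\<^esub> z \<odot>\<^bsub>A\<^esub> fst y \<oplus>\<^bsub>A\<^esub> snd y \<odot>\<^bsub>A\<^esub> a, z * snd y))"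
    if a: "a \<in> carrier A" for a z
    unfolding continuous_map_paired
    by (intro conjI add fst[OF mult(1)] fst[OF mult(2)] fst[OF smult(2)] snd[OF smult(1)] snd[OF cm] a)+
  interpret M: Module.module complex_ring A by (rule vs)
  have rearr: "(x \<oplus>\<^bsub>A\<^esub> x') \<oplus>\<^bsub>A\<^esub> (y \<oplus>\<^bsub>A\<^esub> y') \<oplus>\<^bsub>A\<^esub> (z \<oplus>\<^bsub>A\<^esub> z') = (x \<oplus>\<^bsub>A\<^esub> y \<oplus>\<^bsub>A\<^esub> z) \<oplus>\<^bsub>A\<^esub> (x' \<oplus>\<^bsub>A\<^esub> y' \<oplus>\<^bsub>A\<^esub> z')"
    if "x \<in> carrier A" "y \<in> carrier A" "z \<in> carrier A" "x' \<in> carrier A" "y' \<in> carrier A" "z' \<in> carrier A"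
    for x y z x' y' z'
    using that by (simp add: M.a_ac)
  have "continuous_linear (regular_bimodule ?U) (regular_bimodule ?U) (\<lambda>y. b \<otimes>\<^bsub>?U\<^esub> y)"
    "continuous_linear (regular_bimodule ?U) (regular_bimodule ?U) (\<lambda>y. y \<otimes>\<^bsub>?U\<^esub> b)"
    if bU: "b \<in> carrier ?U" for b
  proof -
    obtain a z where b: "b = (a, z)" "a \<in> carrier A" using bU by auto
    have "continuous_map ?P ?P (\<lambda>y. b \<otimes>\<^bsub>?U\<^esub> y)" "continuous_map ?P ?P (\<lambda>y. y \<otimes>\<^bsub>?U\<^esub> b)"
      by (rule continuous_map_eq[OF cont(1)[OF b(2), of z]] continuous_map_eq[OF cont(2)[OF b(2), of z]];
        auto simp: b)+
    then show "continuous_linear (regular_bimodule ?U) (regular_bimodule ?U) (\<lambda>y. b \<otimes>\<^bsub>?U\<^esub> y)"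
      "continuous_linear (regular_bimodule ?U) (regular_bimodule ?U) (\<lambda>y. y \<otimes>\<^bsub>?U\<^esub> b)"
      using b by (auto simp: continuous_linear_def topo_unitization_eq_prod[OF A] m D mult alg Ax(3,5,6) rearr
          distrib_left distrib_right Ax(7)[symmetric] mult.commute)
  qed
  moreover have "complex_vector_space (regular_bimodule ?U)"
    by (rule complex_vector_spaceI)
      (use complex_vector_spaceD[OF vsU] complex_vector_space_axioms[OF vsU] in \<open>simp_all only: regular_bimodule_simps\<close>)
  ultimately show ?thesis
    by (simp add: topological_bimodule_def topo_unitization_eq_prod[OF A] frechet_algebraD(6)[OF A])
qed

section \<open>Iterated duals of the unitization\<close>

text \<open>
  The last clause records that a functional on \<open>A\<close> vanishing on products extends to every even
  dual and embeds in every odd dual, where it is annihilated by \<open>A\<close>. The pair \<open>(z, \<kappa>)\<close> lets both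
  parities be treated at once: \<open>z\<close> matters for odd \<open>n\<close>, \<open>\<kappa>\<close> for even \<open>n\<close>.
\<close>

definition unitization_data ::
  "'a top_vs \<Rightarrow> nat \<Rightarrow> ('a, 'x) bimodule \<Rightarrow> ('a \<Rightarrow> 'x) \<Rightarrow> ('a \<Rightarrow> 'x \<Rightarrow> complex) \<Rightarrow> bool" where
  "unitization_data A n X \<iota> \<epsilon> \<longleftrightarrow>
     (\<forall>x\<in>carrier X. continuous_map euclidean (topo X) (\<lambda>c. c \<odot>\<^bsub>X\<^esub> x)) \<and>
     (\<forall>a\<in>carrier A. \<iota> a \<in> carrier X \<and> (\<lambda>x\<in>carrier X. \<epsilon> a x) \<in> continuous_functionals X) \<and>
     \<iota> \<zero>\<^bsub>A\<^esub> = \<zero>\<^bsub>X\<^esub> \<and>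
     (\<forall>x\<in>carrier X. \<epsilon> \<zero>\<^bsub>A\<^esub> x = 0 \<and> lact X \<zero>\<^bsub>A\<^esub> x = \<zero>\<^bsub>X\<^esub> \<and> ract X x \<zero>\<^bsub>A\<^esub> = \<zero>\<^bsub>X\<^esub>) \<and>
     (\<forall>a\<in>carrier A. \<forall>b\<in>carrier A. lact X a (\<iota> b) = \<iota> (a \<otimes>\<^bsub>A\<^esub> b) \<and> ract X (\<iota> a) b = \<iota> (a \<otimes>\<^bsub>A\<^esub> b)) \<and>
     (\<forall>a\<in>carrier A. \<forall>b\<in>carrier A. \<forall>x\<in>carrier X.
        \<epsilon> a (lact X b x) = \<epsilon> (a \<otimes>\<^bsub>A\<^esub> b) x \<and> \<epsilon> a (ract X x b) = \<epsilon> (b \<otimes>\<^bsub>A\<^esub> a) x) \<and>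
     (if even n then \<forall>a\<in>carrier A. \<forall>x\<in>carrier X. \<epsilon> a x = 0 else \<forall>a\<in>carrier A. \<iota> a = \<zero>\<^bsub>X\<^esub>) \<and>
     (\<forall>\<phi>\<in>continuous_functionals A. (\<forall>a\<in>carrier A. \<forall>b\<in>carrier A. \<phi> (a \<otimes>\<^bsub>A\<^esub> b) = 0) \<longrightarrow>
        (\<exists>z\<in>carrier X. \<exists>\<kappa>\<in>continuous_functionals X.
          \<forall>a\<in>carrier A. lact X a z = \<zero>\<^bsub>X\<^esub> \<and> ract X z a = \<zero>\<^bsub>X\<^esub> \<and> \<kappa> (\<iota> a) + \<epsilon> a z = \<phi> a \<and>
            (\<forall>x\<in>carrier X. \<kappa> (lact X a x) = 0 \<and> \<kappa> (ract X x a) = 0)))"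

lemma unitization_dataD:
  assumes "unitization_data A n X \<iota> \<epsilon>"
  shows "x \<in> carrier X \<Longrightarrow> continuous_map euclidean (topo X) (\<lambda>c. c \<odot>\<^bsub>X\<^esub> x)"
    "a \<in> carrier A \<Longrightarrow> \<iota> a \<in> carrier X"
    "a \<in> carrier A \<Longrightarrow> (\<lambda>x\<in>carrier X. \<epsilon> a x) \<in> continuous_functionals X"
    "\<iota> \<zero>\<^bsub>A\<^esub> = \<zero>\<^bsub>X\<^esub>" "x \<in> carrier X \<Longrightarrow> \<epsilon> \<zero>\<^bsub>A\<^esub> x = 0"
    "x \<in> carrier X \<Longrightarrow> lact X \<zero>\<^bsub>A\<^esub> x = \<zero>\<^bsub>X\<^esub>"
    "x \<in> carrier X \<Longrightarrow> ract X x \<zero>\<^bsub>A\<^esub> = \<zero>\<^bsub>X\<^esub>"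
    "a \<in> carrier A \<Longrightarrow> b \<in> carrier A \<Longrightarrow> lact X a (\<iota> b) = \<iota> (a \<otimes>\<^bsub>A\<^esub> b)"
    "a \<in> carrier A \<Longrightarrow> b \<in> carrier A \<Longrightarrow> ract X (\<iota> a) b = \<iota> (a \<otimes>\<^bsub>A\<^esub> b)"
    "a \<in> carrier A \<Longrightarrow> b \<in> carrier A \<Longrightarrow> x \<in> carrier X \<Longrightarrow> \<epsilon> a (lact X b x) = \<epsilon> (a \<otimes>\<^bsub>A\<^esub> b) x"
    "a \<in> carrier A \<Longrightarrow> b \<in> carrier A \<Longrightarrow> x \<in> carrier X \<Longrightarrow> \<epsilon> a (ract X x b) = \<epsilon> (b \<otimes>\<^bsub>A\<^esub> a) x"
    "even n \<Longrightarrow> a \<in> carrier A \<Longrightarrow> x \<in> carrier X \<Longrightarrow> \<epsilon> a x = 0"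
    "odd n \<Longrightarrow> a \<in> carrier A \<Longrightarrow> \<iota> a = \<zero>\<^bsub>X\<^esub>"
  using assms by (simp_all add: unitization_data_def)

lemma unitization_data_annihilator:
  assumes "unitization_data A n X \<iota> \<epsilon>"
    and "\<phi> \<in> continuous_functionals A" "\<forall>a\<in>carrier A. \<forall>b\<in>carrier A. \<phi> (a \<otimes>\<^bsub>A\<^esub> b) = 0"
  shows "\<exists>z\<in>carrier X. \<exists>\<kappa>\<in>continuous_functionals X. \<forall>a\<in>carrier A. lact X a z = \<zero>\<^bsub>X\<^esub> \<and> ract X z a = \<zero>\<^bsub>X\<^esub> \<and> \<kappa> (\<iota> a) + \<epsilon> a z = \<phi> a \<and>
        (\<forall>x\<in>carrier X. \<kappa> (lact X a x) = 0 \<and> \<kappa> (ract X x a) = 0)"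
proof -
  have "\<forall>\<phi>\<in>continuous_functionals A. (\<forall>a\<in>carrier A. \<forall>b\<in>carrier A. \<phi> (a \<otimes>\<^bsub>A\<^esub> b) = 0) \<longrightarrow>
      (\<exists>z\<in>carrier X. \<exists>\<kappa>\<in>continuous_functionals X. \<forall>a\<in>carrier A. lact X a z = \<zero>\<^bsub>X\<^esub> \<and> ract X z a = \<zero>\<^bsub>X\<^esub> \<and> \<kappa> (\<iota> a) + \<epsilon> a z = \<phi> a \<and>
        (\<forall>x\<in>carrier X. \<kappa> (lact X a x) = 0 \<and> \<kappa> (ract X x a) = 0))"
    using assms(1) unfolding unitization_data_def by (elim conjE)
  from mp[OF bspec[OF this assms(2)] assms(3)] show ?thesis .
qed

lemma zero_functional:
  assumes "complex_vector_space X" "topspace (topo X) = carrier X"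
  shows "(\<lambda>x\<in>carrier X. 0) \<in> continuous_functionals X"
proof -
  have "continuous_map (topo X) euclidean (\<lambda>x\<in>carrier X. 0 :: complex)"
    by (rule continuous_map_eq[of _ _ "\<lambda>_. 0"]) (auto simp: assms)
  then show ?thesis by (simp add: continuous_functionals_def complex_vector_spaceD[OF assms(1)])
qed

section \<open>The data for the algebra itself, their transport to copies and their
  dualisation\<close>

lemma unitization_data_regular:
  assumes A: "frechet_algebra A p"
  shows "unitization_data A 0 (regular_bimodule A) (\<lambda>a. a) (\<lambda>_ _. 0)"
proof -
  note vs = frechet_algebraD(1)[OF A] and sn = frechet_algebraD(3)[OF A]
    and topA = frechet_algebraD(4)[OF A] and m = frechet_algebraD(5)[OF A]
  note D = complex_vector_spaceD[OF vs]
  have tb: "topological_bimodule A (regular_bimodule A)" by (rule topological_bimodule_regular[OF A])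
  have cf: "continuous_functionals (regular_bimodule A) = continuous_functionals A"
    by (simp add: continuous_functionals_def)
  have m0: "a \<otimes>\<^bsub>A\<^esub> \<zero>\<^bsub>A\<^esub> = \<zero>\<^bsub>A\<^esub>" "\<zero>\<^bsub>A\<^esub> \<otimes>\<^bsub>A\<^esub> a = \<zero>\<^bsub>A\<^esub>" if "a \<in> carrier A" for a
    using tb that by (auto simp: topological_bimodule_def continuous_linear_def)
  have smult: "continuous_map euclidean (topo A) (\<lambda>c. c \<odot>\<^bsub>A\<^esub> a)" if "a \<in> carrier A" for a
    unfolding topA by (rule continuous_map_seminorm_smult(1)[OF vs _ that]) (use sn in auto)
  \<comment> \<open>In the last clause \<open>z\<close> is zero. Since \<open>\<iota>\<close> is the
    identity and \<open>\<epsilon>\<close> is zero, \<open>\<kappa>\<close> has to be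
    \<open>\<phi>\<close> itself, and killing both actions is then the hypothesis on
    products.\<close>
  show ?thesis
    using zero_functional[OF vs frechet_algebraD(6)[OF A]]
    unfolding unitization_data_def by (auto simp: cf m D m0 smult intro!: bexI[of _ "\<zero>\<^bsub>A\<^esub>"])
qed

lemma unitization_data_iso:
  assumes \<theta>: "bimodule_iso A X Y \<theta>" and X: "topological_bimodule A X"
    and data: "unitization_data A n X \<iota> \<epsilon>"
    and mult: "\<And>a b. a \<in> carrier A \<Longrightarrow> b \<in> carrier A \<Longrightarrow> a \<otimes>\<^bsub>A\<^esub> b \<in> carrier A"
    and zero: "\<zero>\<^bsub>A\<^esub> \<in> carrier A"
  shows "unitization_data A n Y (\<theta> \<circ> \<iota>) (\<lambda>a. \<epsilon> a \<circ> inv_into (carrier X) \<theta>)"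
proof -
  let ?\<psi> = "inv_into (carrier X) \<theta>"
  have vs: "complex_vector_space X" and top: "topspace (topo X) = carrier X"
    using X by (auto simp: topological_bimodule_def)
  have Y: "topological_bimodule A Y" by (rule topological_bimodule_iso[OF \<theta> X])
  have vsY: "complex_vector_space Y" and topY: "topspace (topo Y) = carrier Y"
    using Y by (auto simp: topological_bimodule_def)
  have \<psi>: "bimodule_iso A Y X ?\<psi>" by (rule bimodule_iso_sym[OF \<theta> X])
  have l\<theta>: "continuous_linear X Y \<theta>" and l\<psi>: "continuous_linear Y X ?\<psi>"
    using \<theta> \<psi> by (auto intro: bimodule_iso_continuous_linear)
  have in\<theta>: "\<theta> x \<in> carrier Y" "?\<psi> (\<theta> x) = x" if "x \<in> carrier X" for x
    using \<theta> that by (auto simp: bimodule_iso_def bij_betw_def)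
  have ball: "(\<forall>y\<in>carrier Y. P y) \<longleftrightarrow> (\<forall>x\<in>carrier X. P (\<theta> x))" for P
  proof -
    have "carrier Y = \<theta> ` carrier X" using \<theta> by (simp add: bimodule_iso_def bij_betw_def)
    then show ?thesis by simp
  qed
  have act: "lact X a x \<in> carrier X" "ract X x a \<in> carrier X" if "a \<in> carrier A" "x \<in> carrier X" for a x
    using X that by (auto simp: topological_bimodule_def continuous_linear_def)
  have hom: "\<theta> \<zero>\<^bsub>X\<^esub> = \<zero>\<^bsub>Y\<^esub>" "\<And>c x. x \<in> carrier X \<Longrightarrow> c \<odot>\<^bsub>Y\<^esub> \<theta> x = \<theta> (c \<odot>\<^bsub>X\<^esub> x)"
    "\<And>a x. a \<in> carrier A \<Longrightarrow> x \<in> carrier X \<Longrightarrow> lact Y a (\<theta> x) = \<theta> (lact X a x)"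
    "\<And>a x. a \<in> carrier A \<Longrightarrow> x \<in> carrier X \<Longrightarrow> ract Y (\<theta> x) a = \<theta> (ract X x a)"
    using \<theta> by (simp_all add: bimodule_iso_def)
  have transfer: "dual_map Y ?\<psi> f \<in> continuous_functionals Y" if "f \<in> continuous_functionals X" for f
    using dual_map_functional[OF l\<psi> vsY topY that] .
  have c1: "continuous_map euclidean (topo Y) (\<lambda>c. c \<odot>\<^bsub>Y\<^esub> \<theta> x)" if x: "x \<in> carrier X" for x
  proof -
    have "continuous_map euclidean (topo X) (\<lambda>c. c \<odot>\<^bsub>X\<^esub> x)" using data x by (simp add: unitization_data_def)
    moreover have "continuous_map (topo X) (topo Y) \<theta>" using l\<theta> by (simp add: continuous_linear_def)
    ultimately show ?thesis
      using continuous_map_compose[of euclidean "topo X" _ "topo Y" \<theta>] x by (fastforce simp: hom o_def)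
  qed
  have \<iota>: "\<iota> a \<in> carrier X" if "a \<in> carrier A" for a using data that by (simp add: unitization_data_def)
  have c2: "(\<lambda>y\<in>carrier Y. (\<epsilon> a \<circ> ?\<psi>) y) \<in> continuous_functionals Y" if a: "a \<in> carrier A" for a
  proof -
    have "dual_map Y ?\<psi> (\<lambda>x\<in>carrier X. \<epsilon> a x) \<in> continuous_functionals Y"
      using data a by (intro transfer) (simp add: unitization_data_def)
    moreover have "dual_map Y ?\<psi> (\<lambda>x\<in>carrier X. \<epsilon> a x) = (\<lambda>y\<in>carrier Y. (\<epsilon> a \<circ> ?\<psi>) y)"
      using l\<psi> by (auto simp: dual_map_def continuous_linear_def fun_eq_iff)
    ultimately show ?thesis by simp
  qed
  have c3: "\<exists>z\<in>carrier Y. \<exists>\<kappa>\<in>continuous_functionals Y. \<forall>a\<in>carrier A.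
      lact Y a z = \<zero>\<^bsub>Y\<^esub> \<and> ract Y z a = \<zero>\<^bsub>Y\<^esub> \<and> \<kappa> ((\<theta> \<circ> \<iota>) a) + (\<epsilon> a \<circ> ?\<psi>) z = \<phi> a \<and>
      (\<forall>x\<in>carrier Y. \<kappa> (lact Y a x) = 0 \<and> \<kappa> (ract Y x a) = 0)"
    if \<phi>: "\<phi> \<in> continuous_functionals A" "\<forall>a\<in>carrier A. \<forall>b\<in>carrier A. \<phi> (a \<otimes>\<^bsub>A\<^esub> b) = 0" for \<phi>
  proof -
    obtain z \<kappa> where z: "z \<in> carrier X" "\<kappa> \<in> continuous_functionals X"
      "\<forall>a\<in>carrier A. lact X a z = \<zero>\<^bsub>X\<^esub> \<and> ract X z a = \<zero>\<^bsub>X\<^esub> \<and> \<kappa> (\<iota> a) + \<epsilon> a z = \<phi> a \<and>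
        (\<forall>x\<in>carrier X. \<kappa> (lact X a x) = 0 \<and> \<kappa> (ract X x a) = 0)"
      using unitization_data_annihilator[OF data \<phi>] by (elim bexE)
    \<comment> \<open>The annihilated element \<open>z\<close> moves forward along
      \<open>\<theta>\<close>, while \<open>\<kappa>\<close> is composed with the inverse; both
      pairings keep their values.\<close>
    show ?thesis
      by (intro bexI[of _ "\<theta> z"] bexI[of _ "dual_map Y ?\<psi> \<kappa>"])
        (use z \<iota> in \<open>auto simp: ball in\<theta> hom act transfer[unfolded dual_map_def] dual_map_def\<close>)
  qed
  show ?thesis
    unfolding unitization_data_def
  proof (intro conjI)
    show "if even n then \<forall>a\<in>carrier A. \<forall>x\<in>carrier Y. (\<epsilon> a \<circ> ?\<psi>) x = 0 else \<forall>a\<in>carrier A. (\<theta> \<circ> \<iota>) a = \<zero>\<^bsub>Y\<^esub>"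
      by (simp add: ball in\<theta> hom unitization_dataD(12,13)[OF data])
  qed (use c1 c2 c3 in \<open>simp_all add: o_def ball in\<theta> hom act \<iota> mult zero unitization_dataD(4-11)[OF data]\<close>)
qed

text \<open>The pair \<open>(z, \<kappa>)\<close> swaps roles as \<open>\<iota>\<close> and
  \<open>\<epsilon>\<close> do: \<open>\<kappa>\<close> is the new element, and evaluation at
  \<open>z\<close> the new functional. The sum \<open>\<kappa> (\<iota> a) + \<epsilon> a z\<close>
  is symmetric under this exchange, and "killed by the actions" turns into "kills the actions" by
  transposition.\<close>

lemma unitization_data_dual:
  assumes X: "topological_bimodule A X"
    and data: "unitization_data A n X \<iota> \<epsilon>"
    and mult: "\<And>a b. a \<in> carrier A \<Longrightarrow> b \<in> carrier A \<Longrightarrow> a \<otimes>\<^bsub>A\<^esub> b \<in> carrier A"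
    and zero: "\<zero>\<^bsub>A\<^esub> \<in> carrier A"
  shows "unitization_data A (Suc n) (dual_bimodule X) (\<lambda>a. \<lambda>x\<in>carrier X. \<epsilon> a x) (\<lambda>a f. f (\<iota> a))"
proof -
  have vs: "complex_vector_space X" and top: "topspace (topo X) = carrier X"
    using X by (auto simp: topological_bimodule_def)
  note D = complex_vector_spaceD[OF vs]
  have act: "lact X a x \<in> carrier X" "ract X x a \<in> carrier X" if "a \<in> carrier A" "x \<in> carrier X" for a x
    using X that by (auto simp: topological_bimodule_def continuous_linear_def)
  have f0: "f \<zero>\<^bsub>X\<^esub> = 0" if "f \<in> continuous_functionals X" for f
    using continuous_functionals_zero[OF that vs] .
  note data' = unitization_dataD[OF data]
  have c1: "continuous_map euclidean (strong_topology X) (\<lambda>c. \<lambda>x\<in>carrier X. c * f x)"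
    if "f \<in> continuous_functionals X" for f
    by (rule continuous_map_smult_dual[OF vs top that])
  have ev: "(\<lambda>f\<in>continuous_functionals X. f x) \<in> continuous_functionals (dual_bimodule X)"
    if "x \<in> carrier X" for x
    by (intro evaluation_functional vs top bounded_set_singleton that data'(1))
  have c3: "\<exists>z\<in>carrier (dual_bimodule X). \<exists>\<kappa>\<in>continuous_functionals (dual_bimodule X). \<forall>a\<in>carrier A.
      lact (dual_bimodule X) a z = \<zero>\<^bsub>dual_bimodule X\<^esub> \<and> ract (dual_bimodule X) z a = \<zero>\<^bsub>dual_bimodule X\<^esub> \<and>
      \<kappa> (\<lambda>x\<in>carrier X. \<epsilon> a x) + z (\<iota> a) = \<phi> a \<and>
      (\<forall>f\<in>carrier (dual_bimodule X). \<kappa> (lact (dual_bimodule X) a f) = 0 \<and> \<kappa> (ract (dual_bimodule X) f a) = 0)"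
    if \<phi>: "\<phi> \<in> continuous_functionals A" "\<forall>a\<in>carrier A. \<forall>b\<in>carrier A. \<phi> (a \<otimes>\<^bsub>A\<^esub> b) = 0" for \<phi>
  proof -
    obtain z \<kappa> where z: "z \<in> carrier X" "\<kappa> \<in> continuous_functionals X"
      "\<forall>a\<in>carrier A. lact X a z = \<zero>\<^bsub>X\<^esub> \<and> ract X z a = \<zero>\<^bsub>X\<^esub> \<and> \<kappa> (\<iota> a) + \<epsilon> a z = \<phi> a \<and>
        (\<forall>x\<in>carrier X. \<kappa> (lact X a x) = 0 \<and> \<kappa> (ract X x a) = 0)"
      using unitization_data_annihilator[OF data \<phi>] by (elim bexE)
    have dact: "dual_map X (\<lambda>x. ract X x a) f \<in> continuous_functionals X" "dual_map X (lact X a) f \<in> continuous_functionals X"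
      if "a \<in> carrier A" "f \<in> continuous_functionals X" for a f
      using topological_bimodule_dual[OF X] that by (auto simp: topological_bimodule_def continuous_linear_def)
    show ?thesis
      by (rule bexI[of _ \<kappa>], rule bexI[of _ "\<lambda>f\<in>continuous_functionals X. f z"])
        (use z in \<open>auto simp: dual_map_def[of X] data'(3) ev f0 dact[unfolded dual_map_def] add.commute fun_eq_iff\<close>)
  qed
  show ?thesis
    unfolding unitization_data_def
  proof (intro conjI)
    show "if even (Suc n) then \<forall>a\<in>carrier A. \<forall>f\<in>carrier (dual_bimodule X). f (\<iota> a) = 0
      else \<forall>a\<in>carrier A. (\<lambda>x\<in>carrier X. \<epsilon> a x) = \<zero>\<^bsub>dual_bimodule X\<^esub>"
      by (simp add: f0 fun_eq_iff unitization_dataD(12,13)[OF data])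
    show "\<forall>a\<in>carrier A. (\<lambda>x\<in>carrier X. \<epsilon> a x) \<in> carrier (dual_bimodule X) \<and>
       (\<lambda>f\<in>carrier (dual_bimodule X). f (\<iota> a)) \<in> continuous_functionals (dual_bimodule X)"
      using ev data'(2,3) by simp
  qed (use c1 c3 in \<open>auto simp: f0 dual_map_def fun_eq_iff mult zero act data'\<close>)
qed

text \<open>One extra scalar coordinate suffices at every stage: if the duals of \<open>A\<close>
  have copies in \<open>'v\<close>, those of the unitization have copies in
  \<open>'v \<times> complex\<close>, whatever \<open>n\<close> is.\<close>

lemma iterated_dual_unitization:
  fixes A :: "'a top_vs" and X :: "('a, 'v) bimodule"
  assumes A: "frechet_algebra A p" and X: "iterated_dual A n X"
  shows "\<exists>\<iota> \<epsilon>. unitization_data A n X \<iota> \<epsilon> \<and> iterated_dual (unitization A p) n (unitization_bimodule X \<iota> \<epsilon>)"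
  using X
proof induction
  case (base Y \<theta>)
  note reg = topological_bimodule_regular[OF A] and vs = frechet_algebraD(1)[OF A] and m = frechet_algebraD(5)[OF A]
  let ?\<iota> = "\<theta> \<circ> (\<lambda>a. a)" and ?\<epsilon> = "\<lambda>a. (\<lambda>_. 0) \<circ> inv_into (carrier (regular_bimodule A)) \<theta>"
  have "bimodule_iso (unitization A p) (unitization_bimodule (regular_bimodule A) (\<lambda>a. a) (\<lambda>_ _. 0))
      (unitization_bimodule Y ?\<iota> ?\<epsilon>) (map_prod \<theta> id)"
    by (rule unitization_bimodule_iso[OF base reg]) auto
  then have "iterated_dual (unitization A p) 0 (unitization_bimodule Y ?\<iota> ?\<epsilon>)"
    by (rule iterated_dual.base[OF bimodule_iso_trans[OF unitization_bimodule_regular[OF A]]])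
  moreover have "unitization_data A 0 Y ?\<iota> ?\<epsilon>"
    by (rule unitization_data_iso[OF base reg unitization_data_regular[OF A] m complex_vector_spaceD(1)[OF vs]])
  ultimately show ?case by blast
next
  case (step n X Y \<theta>)
  note reg = topological_bimodule_regular[OF A] and vs = frechet_algebraD(1)[OF A] and m = frechet_algebraD(5)[OF A]
  obtain \<iota> \<epsilon> where data: "unitization_data A n X \<iota> \<epsilon>"
    and E: "iterated_dual (unitization A p) n (unitization_bimodule X \<iota> \<epsilon>)" using step.IH by blast
  have X: "topological_bimodule A X" by (rule topological_bimodule_iterated_dual[OF step.hyps(1) reg])
  have dX: "topological_bimodule A (dual_bimodule X)" by (rule topological_bimodule_dual[OF X])
  let ?\<iota> = "\<lambda>a. \<lambda>x\<in>carrier X. \<epsilon> a x" and ?\<epsilon> = "\<lambda>a f. f (\<iota> a)"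
  let ?\<iota>' = "\<theta> \<circ> ?\<iota>" and ?\<epsilon>' = "\<lambda>a. ?\<epsilon> a \<circ> inv_into (carrier (dual_bimodule X)) \<theta>"
  have inv: "inv_into (carrier (dual_bimodule X)) \<theta> (\<theta> f) = f" if "f \<in> carrier (dual_bimodule X)" for f
    using step.hyps(2) that by (simp add: bimodule_iso_def bij_betw_def del: dual_bimodule_simps)
  have data': "unitization_data A (Suc n) (dual_bimodule X) ?\<iota> ?\<epsilon>"
    by (rule unitization_data_dual[OF X data m complex_vector_spaceD(1)[OF vs]])
  have "bimodule_iso (unitization A p) (dual_bimodule (unitization_bimodule X \<iota> \<epsilon>))
      (unitization_bimodule (dual_bimodule X) ?\<iota> ?\<epsilon>) (\<lambda>F. (\<lambda>x\<in>carrier X. F (x, 0), F (\<zero>\<^bsub>X\<^esub>, 1)))"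
    by (rule dual_unitization_bimodule[OF X]) (use data in \<open>auto simp: unitization_data_def\<close>)
  moreover have "bimodule_iso (unitization A p) (unitization_bimodule (dual_bimodule X) ?\<iota> ?\<epsilon>)
      (unitization_bimodule Y ?\<iota>' ?\<epsilon>') (map_prod \<theta> id)"
    by (rule unitization_bimodule_iso[OF step.hyps(2) dX])
      (use data' inv in \<open>auto simp: unitization_data_def\<close>)
  ultimately have "iterated_dual (unitization A p) (Suc n) (unitization_bimodule Y ?\<iota>' ?\<epsilon>')"
    by (rule iterated_dual.step[OF E bimodule_iso_trans])
  moreover have "unitization_data A (Suc n) Y ?\<iota>' ?\<epsilon>'"
    by (rule unitization_data_iso[OF step.hyps(2) dX data' m complex_vector_spaceD(1)[OF vs]])
  ultimately show ?case by blast
qed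

text \<open>
  Unlike in \<open>bimodule_copy\<close>, the map is injective on the carrier only: the whole type
  \<open>'a\<close> need not embed into the type that holds the duals of the unitization.
\<close>

lemma bimodule_copy_on:
  fixes X :: "('b, 'x) bimodule" and g :: "'x \<Rightarrow> 'y"
  assumes g: "inj_on g (carrier X)" and X: "topological_bimodule B X"
  shows "\<exists>Y. bimodule_iso B X Y g"
proof -
  let ?h = "inv_into (carrier X) g"
  have h [simp]: "?h (g x) = x" if "x \<in> carrier X" for x using g that by simp
  have top: "topspace (topo X) = carrier X" using X by (simp add: topological_bimodule_def)
  have closed: "\<zero>\<^bsub>X\<^esub> \<in> carrier X" "x \<in> carrier X \<Longrightarrow> y \<in> carrier X \<Longrightarrow> x \<oplus>\<^bsub>X\<^esub> y \<in> carrier X"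
    "x \<in> carrier X \<Longrightarrow> c \<odot>\<^bsub>X\<^esub> x \<in> carrier X" for x y c
    using X complex_vector_spaceD[of X] by (auto simp: topological_bimodule_def)
  define Y :: "('b, 'y) bimodule" where
    "Y = \<lparr>carrier = g ` carrier X, mult = (\<lambda>_ _. undefined), one = undefined,
      zero = g \<zero>\<^bsub>X\<^esub>, add = (\<lambda>u v. g (?h u \<oplus>\<^bsub>X\<^esub> ?h v)), smult = (\<lambda>c u. g (c \<odot>\<^bsub>X\<^esub> ?h u)),
      topo = pullback_topology (g ` carrier X) ?h (topo X),
      lact = (\<lambda>b u. g (lact X b (?h u))), ract = (\<lambda>u b. g (ract X (?h u) b))\<rparr>"
  have tY: "topspace (topo Y) = g ` carrier X"
    by (auto simp: Y_def topspace_pullback_topology top)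
  have "homeomorphic_maps (topo X) (topo Y) g ?h"
    unfolding homeomorphic_maps_def
  proof (intro conjI ballI)
    have "continuous_map (topo X) (topo X) (?h \<circ> g)"
      by (rule continuous_map_eq[OF continuous_map_id]) (simp add: top)
    then show "continuous_map (topo X) (topo Y) g"
      unfolding Y_def bimodule.simps top_vs.simps
      by (rule continuous_map_pullback') (auto simp: top)
    show "continuous_map (topo Y) (topo X) ?h"
      using continuous_map_pullback[of "topo X" "topo X" id "g ` carrier X" ?h]
      by (simp add: Y_def)
  qed (auto simp: tY top)
  then have "homeomorphic_map (topo X) (topo Y) g" by (rule homeomorphic_maps_imp_map)
  then have "bimodule_iso B X Y g"
    using g closed by (auto simp: bimodule_iso_def Y_def bij_betw_def)
  then show ?thesis by blast
qed

text \<open>Injections of carriers into \<open>'v\<close> are enough, because the bimodule structure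
  is transported along them. At the base, pairs with scalar zero supply one. In the step, uniqueness
  of duals identifies \<open>Y\<close> with the dual of \<open>X\<close> plus a scalar coordinate,
  and functionals paired with zero supply the next.\<close>

lemma iterated_dual_of_unitization:
  fixes A :: "'a top_vs" and Y :: "('a \<times> complex, 'v) bimodule"
  assumes A: "frechet_algebra A p" and Y: "iterated_dual (unitization A p) n Y"
  shows "\<exists>X :: ('a, 'v) bimodule. iterated_dual A n X"
  using Y
proof induction
  case (base Y \<theta>)
  note reg = topological_bimodule_regular[OF A]
  have "inj_on \<theta> (carrier A \<times> UNIV)" using base by (simp add: bimodule_iso_def bij_betw_def)
  then have "inj_on (\<lambda>a. \<theta> (a, 0)) (carrier (regular_bimodule A))"
    by (auto simp: inj_on_def)
  from bimodule_copy_on[OF this reg] show ?case using iterated_dual.base by blast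
next
  case (step n Y' Y \<theta>)
  note reg = topological_bimodule_regular[OF A] and regU = topological_bimodule_regular_unitization[OF A]
  obtain X :: "('a, 'v) bimodule" where X: "iterated_dual A n X" using step.IH by blast
  have tX: "topological_bimodule A X" by (rule topological_bimodule_iterated_dual[OF X reg])
  obtain \<iota> \<epsilon> where data: "unitization_data A n X \<iota> \<epsilon>"
    and E: "iterated_dual (unitization A p) n (unitization_bimodule X \<iota> \<epsilon>)"
    using iterated_dual_unitization[OF A X] by blast
  let ?E = "unitization_bimodule X \<iota> \<epsilon>"
    and ?D = "unitization_bimodule (dual_bimodule X) (\<lambda>a. \<lambda>x\<in>carrier X. \<epsilon> a x) (\<lambda>a f. f (\<iota> a))"
  have tE: "topological_bimodule (unitization A p) ?E"
    by (rule topological_bimodule_iterated_dual[OF E regU])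
  obtain \<eta> where "bimodule_iso (unitization A p) ?E Y' \<eta>"
    using iterated_dual_unique[OF E step.hyps(1) regU] by blast
  then obtain \<zeta> where \<zeta>: "bimodule_iso (unitization A p) (dual_bimodule ?E) (dual_bimodule Y') \<zeta>"
    using bimodule_iso_dual tE by blast
  have "bimodule_iso (unitization A p) (dual_bimodule ?E) ?D (\<lambda>F. (\<lambda>x\<in>carrier X. F (x, 0), F (\<zero>\<^bsub>X\<^esub>, 1)))"
    by (rule dual_unitization_bimodule[OF tX]) (simp_all add: unitization_dataD[OF data])
  note bimodule_iso_sym[OF this topological_bimodule_dual[OF tE]]
  note bimodule_iso_trans[OF bimodule_iso_trans[OF this \<zeta>] step.hyps(2)]
  then obtain g where "bimodule_iso (unitization A p) ?D Y g" by blast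
  then have "inj_on g (continuous_functionals X \<times> UNIV)" by (simp add: bimodule_iso_def bij_betw_def)
  then have "inj_on (\<lambda>f. g (f, 0)) (carrier (dual_bimodule X))" by (auto simp: inj_on_def)
  from bimodule_copy_on[OF this topological_bimodule_dual[OF tX]]
  show ?case using iterated_dual.step[OF X] by blast
qed

section \<open>Room in \<open>'v\<close> for a further scalar coordinate\<close>

lemma iterated_dual_copy_base:
  assumes "iterated_dual A n (X :: ('a, 'v) bimodule)"
  shows "\<exists>(Y :: ('a, 'v) bimodule) \<theta>. bimodule_iso A (regular_bimodule A) Y \<theta>"
  using assms
proof induction
  case (base Y \<theta>)
  then show ?case by (intro exI)
qed

text \<open>Cardinal arithmetic: an infinite cardinal absorbs a nonzero factor that is no
  larger.\<close>

lemma ex_inj_prod_complex: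
  includes cardinal_syntax
  fixes g :: "complex \<Rightarrow> 'v"
  assumes "inj g"
  shows "\<exists>h :: 'v \<times> complex \<Rightarrow> 'v. inj h"
proof -
  have le: "|UNIV :: complex set| \<le>o |UNIV :: 'v set|" using assms card_of_ordLeq[of "UNIV :: complex set" "UNIV :: 'v set"] by auto
  have "infinite (UNIV :: 'v set)"
    using assms finite_imageD[of g UNIV] finite_subset[of "range g" UNIV] infinite_UNIV_char_0 by blast
  then have "|(UNIV :: 'v set) \<times> (UNIV :: complex set)| \<le>o |UNIV :: 'v set|"
    using card_of_Times_infinite[OF _ _ le] ordIso_imp_ordLeq by blast
  then show ?thesis
    using card_of_ordLeq[of "(UNIV :: 'v set) \<times> (UNIV :: complex set)" "UNIV :: 'v set"] by auto
qed

section \<open>Transfer of weak amenability\<close>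

lemma weakly_amenable_even:
  fixes A :: "'a top_vs"
  assumes A: "frechet_algebra A p" and n: "even n"
    and U: "n_weakly_amenable TYPE('v) n (unitization A p)"
  shows "n_weakly_amenable TYPE('v) n A"
proof -
  let ?U = "unitization A p"
  note reg = topological_bimodule_regular[OF A] and regU = topological_bimodule_regular_unitization[OF A]
    and vsA = frechet_algebraD(1)[OF A] and m = frechet_algebraD(5)[OF A]
  note DA = complex_vector_spaceD[OF vsA]
  obtain Y :: "('a \<times> complex, 'v) bimodule" where Y: "iterated_dual ?U n Y"
    "\<And>D. continuous_derivation ?U Y D \<Longrightarrow> inner_derivation ?U Y D"
    using U unfolding n_weakly_amenable_def by blast
  obtain X :: "('a, 'v) bimodule" where X: "iterated_dual A n X"
    using iterated_dual_of_unitization[OF A Y(1)] by blast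
  obtain \<iota> \<epsilon> where data: "unitization_data A n X \<iota> \<epsilon>" and E: "iterated_dual ?U n (unitization_bimodule X \<iota> \<epsilon>)"
    using iterated_dual_unitization[OF A X] by blast
  let ?E = "unitization_bimodule X \<iota> \<epsilon>"
  have tX: "topological_bimodule A X" by (rule topological_bimodule_iterated_dual[OF X reg])
  then have vsX: "complex_vector_space X" and topX: "topspace (topo X) = carrier X"
    and act: "\<And>a x. a \<in> carrier A \<Longrightarrow> x \<in> carrier X \<Longrightarrow> lact X a x \<in> carrier X"
      "\<And>a x. a \<in> carrier A \<Longrightarrow> x \<in> carrier X \<Longrightarrow> ract X x a \<in> carrier X"
    by (auto simp: topological_bimodule_def continuous_linear_def)
  note D = complex_vector_spaceD[OF vsX] and Ax = complex_vector_space_axioms[OF vsX]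
  interpret M: Module.module complex_ring X by (rule vsX)
  have tY: "topological_bimodule ?U Y" by (rule topological_bimodule_iterated_dual[OF Y(1) regU])
  obtain \<theta> where \<theta>: "bimodule_iso ?U Y ?E \<theta>" using iterated_dual_unique[OF Y(1) E regU] by blast
  \<comment> \<open>The hypothesis speaks of a copy about which nothing explicit is known; it is
    moved to the model with a scalar coordinate.\<close>
  have inner: "inner_derivation ?U ?E d" if "continuous_derivation ?U ?E d" for d
    using derivations_inner_iso[OF \<theta> tY Y(2) that] complex_vector_space_unitization[OF vsA]
    by (force simp: m DA)
  have "inner_derivation A X d" if d: "continuous_derivation A X d" for d
  proof -
    have dX: "d a \<in> carrier X" if "a \<in> carrier A" for a using d that by (auto simp: continuous_derivation_def)
    have lin: "d (a \<oplus>\<^bsub>A\<^esub> b) = d a \<oplus>\<^bsub>X\<^esub> d b" "d (c \<odot>\<^bsub>A\<^esub> a) = c \<odot>\<^bsub>X\<^esub> d a"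
      "d (a \<otimes>\<^bsub>A\<^esub> b) = lact X a (d b) \<oplus>\<^bsub>X\<^esub> ract X (d a) b"
      if "a \<in> carrier A" "b \<in> carrier A" for a b c
      using d that by (auto simp: continuous_derivation_def)
    have "continuous_map (topo A) (topo X) d" using d by (simp add: continuous_derivation_def)
    then have "continuous_map (prod_topology (topo A) (euclidean :: complex topology)) (topo X) (d \<circ> fst)"
      by (rule continuous_map_compose[OF continuous_map_fst])
    then have "continuous_map (topo ?U) (topo ?E) (\<lambda>y. (d (fst y), 0))"
      by (simp add: topo_unitization_eq_prod[OF A] continuous_map_paired o_def)
    \<comment> \<open>For even \<open>n\<close> the map \<open>\<epsilon>\<close> is zero, so the
      last coordinate of the Leibniz rule reads \<open>0 = 0\<close>.\<close>
    then have "continuous_derivation ?U ?E (\<lambda>y. (d (fst y), 0))"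
      by (auto simp: continuous_derivation_def dX lin m DA D act unitization_dataD[OF data] n M.a_ac)
    from inner[OF this] obtain w where w: "w \<in> carrier ?E"
      "\<forall>b\<in>carrier ?U. (d (fst b), 0) = lact ?E b w \<ominus>\<^bsub>?E\<^esub> ract ?E w b"
      unfolding inner_derivation_def by blast
    obtain x t where xt: "w = (x, t)" by fastforce
    have x: "x \<in> carrier X"
      "\<forall>b\<in>carrier ?U. (d (fst b), 0) = lact ?E b (x, t) \<ominus>\<^bsub>?E\<^esub> ract ?E (x, t) b"
      using w by (simp_all only: xt unitization_bimodule_simps mem_Times_iff fst_conv)
    have "d a = lact X a x \<ominus>\<^bsub>X\<^esub> ract X x a" if a: "a \<in> carrier A" for a
    proof -
      note \<iota>a = unitization_dataD(2)[OF data a]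
      have vsE: "complex_vector_space ?E" by (rule complex_vector_space_unitization_bimodule[OF vsX])
      have cl: "lact ?E (a, 0) (x, t) \<in> carrier ?E" "ract ?E (x, t) (a, 0) \<in> carrier ?E"
        using x a \<iota>a by (simp_all add: act D)
      \<comment> \<open>Evaluation at \<open>(a, 0)\<close>: the scalar \<open>t\<close> of the
        implementing element contributes \<open>t \<iota> a\<close> to both actions, and these terms
        cancel.\<close>
      have "d a = (lact X a x \<oplus>\<^bsub>X\<^esub> t \<odot>\<^bsub>X\<^esub> \<iota> a) \<oplus>\<^bsub>X\<^esub> (-1) \<odot>\<^bsub>X\<^esub> (ract X x a \<oplus>\<^bsub>X\<^esub> t \<odot>\<^bsub>X\<^esub> \<iota> a)"
        using bspec[OF x(2), of "(a, 0)"] x(1) a \<iota>a unfolding minus_eq_smult[OF vsE cl] by (simp add: D act)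
      also have "\<dots> = (lact X a x \<oplus>\<^bsub>X\<^esub> (-1) \<odot>\<^bsub>X\<^esub> ract X x a) \<oplus>\<^bsub>X\<^esub> ((-1) \<odot>\<^bsub>X\<^esub> (t \<odot>\<^bsub>X\<^esub> \<iota> a) \<oplus>\<^bsub>X\<^esub> t \<odot>\<^bsub>X\<^esub> \<iota> a)"
        using x a \<iota>a by (simp add: Ax(6) D act M.a_ac)
      also have "\<dots> = lact X a x \<ominus>\<^bsub>X\<^esub> ract X x a"
        using x a \<iota>a by (simp add: Ax(4) D act minus_eq_smult[OF vsX])
      finally show ?thesis .
    qed
    then show ?thesis using x(1) by (auto simp: inner_derivation_def)
  qed
  then show ?thesis using X by (auto simp: n_weakly_amenable_def)
qed

lemma weakly_amenable_odd:
  fixes A :: "'a top_vs"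
  assumes A: "frechet_algebra A p" and nz: "\<exists>a\<in>carrier A. a \<noteq> \<zero>\<^bsub>A\<^esub>" and n: "odd n"
    and wa: "n_weakly_amenable TYPE('v) n A"
  shows "n_weakly_amenable TYPE('v) n (unitization A p)"
proof -
  let ?U = "unitization A p"
  note reg = topological_bimodule_regular[OF A] and regU = topological_bimodule_regular_unitization[OF A]
    and vsA = frechet_algebraD(1)[OF A] and m = frechet_algebraD(5)[OF A]
  note DA = complex_vector_spaceD[OF vsA] and AxA = complex_vector_space_axioms[OF vsA]
  interpret MA: Module.module complex_ring A by (rule vsA)
  obtain X :: "('a, 'v) bimodule" where X: "iterated_dual A n X"
    "\<And>d. continuous_derivation A X d \<Longrightarrow> inner_derivation A X d"
    using wa unfolding n_weakly_amenable_def by blast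
  obtain \<iota> \<epsilon> where data: "unitization_data A n X \<iota> \<epsilon>" and E: "iterated_dual ?U n (unitization_bimodule X \<iota> \<epsilon>)"
    using iterated_dual_unitization[OF A X(1)] by blast
  let ?E = "unitization_bimodule X \<iota> \<epsilon>"
  note dat = unitization_dataD[OF data]
  have tX: "topological_bimodule A X" by (rule topological_bimodule_iterated_dual[OF X(1) reg])
  then have vsX: "complex_vector_space X" and topX: "topspace (topo X) = carrier X"
    and act: "\<And>a x. a \<in> carrier A \<Longrightarrow> x \<in> carrier X \<Longrightarrow> lact X a x \<in> carrier X"
      "\<And>a x. a \<in> carrier A \<Longrightarrow> x \<in> carrier X \<Longrightarrow> ract X x a \<in> carrier X"
    and actc: "\<And>a x c. a \<in> carrier A \<Longrightarrow> x \<in> carrier X \<Longrightarrow> lact X a (c \<odot>\<^bsub>X\<^esub> x) = c \<odot>\<^bsub>X\<^esub> lact X a x"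
      "\<And>a x c. a \<in> carrier A \<Longrightarrow> x \<in> carrier X \<Longrightarrow> ract X (c \<odot>\<^bsub>X\<^esub> x) a = c \<odot>\<^bsub>X\<^esub> ract X x a"
    by (auto simp: topological_bimodule_def continuous_linear_def)
  note D = complex_vector_spaceD[OF vsX] and Ax = complex_vector_space_axioms[OF vsX]
  interpret M: Module.module complex_ring X by (rule vsX)
  have tE: "topological_bimodule ?U ?E" by (rule topological_bimodule_iterated_dual[OF E regU])
  have vsE: "complex_vector_space ?E" by (rule complex_vector_space_unitization_bimodule[OF vsX])
  have e_add: "\<epsilon> a (x \<oplus>\<^bsub>X\<^esub> y) = \<epsilon> a x + \<epsilon> a y" and e_smult: "\<epsilon> a (c \<odot>\<^bsub>X\<^esub> x) = c * \<epsilon> a x"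
    if "a \<in> carrier A" "x \<in> carrier X" "y \<in> carrier X" for a x y c
    using dat(3)[OF that(1)] that D by (auto simp: continuous_functionals_def)
  have e_minus: "\<epsilon> a (x \<ominus>\<^bsub>X\<^esub> y) = \<epsilon> a x - \<epsilon> a y"
    if "a \<in> carrier A" "x \<in> carrier X" "y \<in> carrier X" for a x y
    using that D by (simp add: minus_eq_smult[OF vsX] e_add e_smult)
  have inner: "inner_derivation ?U ?E d" if d: "continuous_derivation ?U ?E d" for d
  proof -
    define \<delta> where "\<delta> = (\<lambda>a. fst (d (a, 0)))"
    \<comment> \<open>The restriction makes \<open>\<phi>\<close> extensional, as membership in
      \<open>continuous_functionals A\<close> requires.\<close>
    define \<phi> where "\<phi> = (\<lambda>a\<in>carrier A. snd (d (a, 0)))"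
    have dE: "d y \<in> carrier X \<times> UNIV" if "y \<in> carrier A \<times> UNIV" for y
      using d that by (auto simp: continuous_derivation_def)
    have \<delta>X: "\<delta> a \<in> carrier X" if "a \<in> carrier A" for a using dE[of "(a, 0)"] that by (auto simp: \<delta>_def)
    have d0: "d (a, 0) = (\<delta> a, \<phi> a)" if "a \<in> carrier A" for a using that by (simp add: \<delta>_def \<phi>_def)
    have d_add: "d (y \<oplus>\<^bsub>?U\<^esub> y') = d y \<oplus>\<^bsub>?E\<^esub> d y'"
      and d_mult: "d (y \<otimes>\<^bsub>?U\<^esub> y') = lact ?E y (d y') \<oplus>\<^bsub>?E\<^esub> ract ?E (d y) y'"
      and d_smult: "d (c \<odot>\<^bsub>?U\<^esub> y) = c \<odot>\<^bsub>?E\<^esub> d y"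
      if "y \<in> carrier A \<times> UNIV" "y' \<in> carrier A \<times> UNIV" for y y' c
      using d that by (auto simp: continuous_derivation_def)
    have add: "\<delta> (a \<oplus>\<^bsub>A\<^esub> b) = \<delta> a \<oplus>\<^bsub>X\<^esub> \<delta> b" "\<phi> (a \<oplus>\<^bsub>A\<^esub> b) = \<phi> a + \<phi> b"
      if "a \<in> carrier A" "b \<in> carrier A" for a b
      using d_add[of "(a, 0)" "(b, 0)"] that DA by (auto simp: d0)
    have smult: "\<delta> (c \<odot>\<^bsub>A\<^esub> a) = c \<odot>\<^bsub>X\<^esub> \<delta> a" "\<phi> (c \<odot>\<^bsub>A\<^esub> a) = c * \<phi> a"
      if "a \<in> carrier A" for a c
      using d_smult[of "(a, 0)" "(a, 0)" c] that DA by (auto simp: d0)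
    \<comment> \<open>For odd \<open>n\<close> the terms with \<open>\<iota>\<close> vanish, which
      leaves the Leibniz rule of \<open>A\<close> in the first coordinate.\<close>
    have mult: "\<delta> (a \<otimes>\<^bsub>A\<^esub> b) = lact X a (\<delta> b) \<oplus>\<^bsub>X\<^esub> ract X (\<delta> a) b"
      "\<phi> (a \<otimes>\<^bsub>A\<^esub> b) = \<epsilon> a (\<delta> b) + \<epsilon> b (\<delta> a)"
      if "a \<in> carrier A" "b \<in> carrier A" for a b
      using d_mult[of "(a, 0)" "(b, 0)"] that
      by (auto simp: d0 m DA D act \<delta>X dat(13)[OF n])
    \<comment> \<open>The identity is idempotent and acts as the identity map on both sides, so its
      image equals twice itself.\<close>
    have e: "d (\<zero>\<^bsub>A\<^esub>, 1) = (\<zero>\<^bsub>X\<^esub>, 0)"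
    proof -
      obtain x t where xt: "d (\<zero>\<^bsub>A\<^esub>, 1) = (x, t)" "x \<in> carrier X" using dE[of "(\<zero>\<^bsub>A\<^esub>, 1)"] DA by auto
      have "\<zero>\<^bsub>A\<^esub> \<otimes>\<^bsub>A\<^esub> \<zero>\<^bsub>A\<^esub> = \<zero>\<^bsub>A\<^esub>"
        using reg DA(1) unfolding topological_bimodule_def continuous_linear_def by auto
      then have "(x, t) = (x \<oplus>\<^bsub>X\<^esub> x, t + t)"
        using d_mult[of "(\<zero>\<^bsub>A\<^esub>, 1)" "(\<zero>\<^bsub>A\<^esub>, 1)"] xt
        by (simp add: DA D dat Ax(8) AxA)
      then show ?thesis using xt M.add.l_cancel_one by auto
    qed
    have dfull: "d (a, z) = (\<delta> a, \<phi> a)" if a: "a \<in> carrier A" for a z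
    proof -
      have "(a, z) = (a, 0) \<oplus>\<^bsub>?U\<^esub> (z \<odot>\<^bsub>?U\<^esub> (\<zero>\<^bsub>A\<^esub>, 1))" using a DA by simp
      then have "d (a, z) = d (a, 0) \<oplus>\<^bsub>?E\<^esub> z \<odot>\<^bsub>?E\<^esub> d (\<zero>\<^bsub>A\<^esub>, 1)"
        using d_add[of "(a, 0)" "z \<odot>\<^bsub>?U\<^esub> (\<zero>\<^bsub>A\<^esub>, 1)"] d_smult[of "(\<zero>\<^bsub>A\<^esub>, 1)" "(\<zero>\<^bsub>A\<^esub>, 1)" z] a DA by simp
      then show ?thesis using a \<delta>X D by (simp add: d0 e)
    qed
    have dc: "continuous_map (prod_topology (topo A) euclidean) (prod_topology (topo X) euclidean) d"
      using d by (simp add: continuous_derivation_def topo_unitization_eq_prod[OF A])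
    have "continuous_map (topo A) (prod_topology (topo A) (euclidean :: complex topology)) (\<lambda>a. (a, 0))"
      by (simp add: continuous_map_paired)
    from continuous_map_compose[OF this dc] have "continuous_map (topo A) (prod_topology (topo X) euclidean) (\<lambda>a. d (a, 0))"
      by (simp add: o_def)
    then have \<delta>c: "continuous_map (topo A) (topo X) \<delta>"
      and \<phi>c': "continuous_map (topo A) euclidean (\<lambda>a. snd (d (a, 0)))"
      by (auto simp: continuous_map_pairwise o_def \<delta>_def)
    have \<phi>c: "continuous_map (topo A) euclidean \<phi>"
      using \<phi>c' by (rule continuous_map_eq) (simp add: \<phi>_def frechet_algebraD(6)[OF A])
    have \<phi>A: "\<phi> \<in> continuous_functionals A"
      using \<phi>c add(2) smult(2) unfolding continuous_functionals_def by (auto simp: \<phi>_def)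
    have "continuous_derivation A X \<delta>"
      using \<delta>X \<delta>c add smult mult by (auto simp: continuous_derivation_def)
    from X(2)[OF this] obtain x where x: "x \<in> carrier X"
      "\<And>a. a \<in> carrier A \<Longrightarrow> \<delta> a = lact X a x \<ominus>\<^bsub>X\<^esub> ract X x a"
      by (auto simp: inner_derivation_def)
    \<comment> \<open>Inserting the inner form of \<open>\<delta>\<close> gives
      \<open>\<epsilon>(ab) x - \<epsilon>(ba) x\<close> from the first term and its negative from
      the second.\<close>
    have \<phi>_mult: "\<phi> (a \<otimes>\<^bsub>A\<^esub> b) = 0" if "a \<in> carrier A" "b \<in> carrier A" for a b
      using that x(1) by (simp add: mult(2) x(2) e_minus act dat(10,11))
    then obtain z \<kappa> where z: "z \<in> carrier X" "\<kappa> \<in> continuous_functionals X"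
      "\<forall>a\<in>carrier A. lact X a z = \<zero>\<^bsub>X\<^esub> \<and> ract X z a = \<zero>\<^bsub>X\<^esub> \<and> \<kappa> (\<iota> a) + \<epsilon> a z = \<phi> a \<and>
        (\<forall>x\<in>carrier X. \<kappa> (lact X a x) = 0 \<and> \<kappa> (ract X x a) = 0)"
      using unitization_data_annihilator[OF data \<phi>A] by blast
    \<comment> \<open>For odd \<open>n\<close> the argument of \<open>\<kappa>\<close> is zero, so
      \<open>z\<close> alone represents \<open>\<phi>\<close>.\<close>
    have ez: "\<epsilon> a z = \<phi> a" if "a \<in> carrier A" for a
      using z that dat(13)[OF n that] continuous_functionals_zero[OF z(2) vsX] by auto
    have "continuous_map (topo A) (topo X) (\<lambda>a. \<phi> a \<odot>\<^bsub>X\<^esub> z)"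
      using continuous_map_compose[OF \<phi>c dat(1)[OF z(1)]] by (simp add: o_def)
    \<comment> \<open>Both sides of the Leibniz rule are zero: \<open>\<phi>\<close> kills products,
      and \<open>z\<close> is annihilated by both actions.\<close>
    then have "continuous_derivation A X (\<lambda>a. \<phi> a \<odot>\<^bsub>X\<^esub> z)"
      using z add(2) smult(2) \<phi>_mult
      by (simp add: continuous_derivation_def D Ax(5,7) actc)
    from X(2)[OF this] obtain w where w: "w \<in> carrier X"
      "\<And>a. a \<in> carrier A \<Longrightarrow> \<phi> a \<odot>\<^bsub>X\<^esub> z = lact X a w \<ominus>\<^bsub>X\<^esub> ract X w a"
      by (auto simp: inner_derivation_def)
    have \<phi>0: "\<phi> a = 0" if a: "a \<in> carrier A" for a
    proof -
      have "\<phi> a * \<phi> a = \<epsilon> a (\<phi> a \<odot>\<^bsub>X\<^esub> z)" using a z by (simp add: e_smult[OF _ _ z(1)] ez)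
      \<comment> \<open>Pairing \<open>a w\<close> and \<open>w a\<close> with \<open>a\<close> both
        yield the pairing of \<open>w\<close> with \<open>aa\<close>.\<close>
      also have "\<dots> = 0" using a w(1) by (simp add: w(2) e_minus act dat(10,11))
      finally show ?thesis by simp
    qed
    \<comment> \<open>Left and right action of \<open>(a, c)\<close> on \<open>(x, 0)\<close> share
      the term \<open>c x\<close> and the last coordinate \<open>\<epsilon> a x\<close>. Their
      difference thus has last coordinate zero, which is why \<open>\<phi>\<close> had to
      vanish.\<close>
    have "d (a, c) = lact ?E (a, c) (x, 0) \<ominus>\<^bsub>?E\<^esub> ract ?E (x, 0) (a, c)" if a: "a \<in> carrier A" for a c
    proof -
      have cl: "lact ?E (a, c) (x, 0) \<in> carrier ?E" "ract ?E (x, 0) (a, c) \<in> carrier ?E"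
        using x a dat(2)[OF a] by (simp_all add: act D)
      have "lact X a x \<ominus>\<^bsub>X\<^esub> ract X x a = (lact X a x \<oplus>\<^bsub>X\<^esub> c \<odot>\<^bsub>X\<^esub> x) \<oplus>\<^bsub>X\<^esub> (-1) \<odot>\<^bsub>X\<^esub> (ract X x a \<oplus>\<^bsub>X\<^esub> c \<odot>\<^bsub>X\<^esub> x)"
      proof -
        have "(lact X a x \<oplus>\<^bsub>X\<^esub> c \<odot>\<^bsub>X\<^esub> x) \<oplus>\<^bsub>X\<^esub> (-1) \<odot>\<^bsub>X\<^esub> (ract X x a \<oplus>\<^bsub>X\<^esub> c \<odot>\<^bsub>X\<^esub> x)
            = (lact X a x \<oplus>\<^bsub>X\<^esub> (-1) \<odot>\<^bsub>X\<^esub> ract X x a) \<oplus>\<^bsub>X\<^esub> ((-1) \<odot>\<^bsub>X\<^esub> (c \<odot>\<^bsub>X\<^esub> x) \<oplus>\<^bsub>X\<^esub> c \<odot>\<^bsub>X\<^esub> x)"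
          using x a by (simp add: Ax(6) D act M.a_ac)
        then show ?thesis using x a by (simp add: Ax(4) D act minus_eq_smult[OF vsX])
      qed
      then show ?thesis
        unfolding minus_eq_smult[OF vsE cl] using x a by (simp add: D act dat(13)[OF n a] dfull \<phi>0)
    qed
    then show ?thesis using x(1) unfolding inner_derivation_def
      by (intro bexI[of _ "(x, 0)"]) auto
  qed
  \<comment> \<open>The multiples of a nonzero \<open>a\<close> form a copy of the scalars in
    \<open>A\<close>, and a copy of \<open>A\<close> itself lies in \<open>'v\<close>. This lets the
    model be moved from \<open>'v \<times> complex\<close> back into \<open>'v\<close>.\<close>
  obtain g :: "complex \<Rightarrow> 'v" where g: "inj g"
  proof -
    obtain Y :: "('a, 'v) bimodule" and \<theta> where \<theta>: "bimodule_iso A (regular_bimodule A) Y \<theta>"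
      using iterated_dual_copy_base[OF X(1)] by blast
    obtain a where a: "a \<in> carrier A" "a \<noteq> \<zero>\<^bsub>A\<^esub>" using nz by blast
    have "c = c'" if "c \<odot>\<^bsub>A\<^esub> a = c' \<odot>\<^bsub>A\<^esub> a" for c c'
    proof (rule ccontr)
      assume "c \<noteq> c'"
      then have "a = inverse (c - c') \<odot>\<^bsub>A\<^esub> ((c - c') \<odot>\<^bsub>A\<^esub> a)"
        using a AxA(7)[OF a(1), of "inverse (c - c')" "c - c'"] AxA(8)[OF a(1)] by simp
      also have "(c - c') \<odot>\<^bsub>A\<^esub> a = \<zero>\<^bsub>A\<^esub>"
        using smult_minus[OF vsA a(1), of c c'] that a DA by (simp add: MA.r_neg a_minus_def)
      finally show False using a DA by simp
    qed
    moreover have "inj_on \<theta> (carrier A)" using \<theta> by (simp add: bimodule_iso_def bij_betw_def)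
    ultimately have "inj (\<lambda>c. \<theta> (c \<odot>\<^bsub>A\<^esub> a))" using a DA by (auto simp: inj_on_def)
    then show thesis by (rule that)
  qed
  then obtain h :: "'v \<times> complex \<Rightarrow> 'v" where h: "inj h" using ex_inj_prod_complex by blast
  obtain Y :: "('a \<times> complex, 'v) bimodule" and \<theta> where Y: "iterated_dual ?U n Y" "bimodule_iso ?U ?E Y \<theta>"
    using iterated_dual_copy[OF E h regU] by blast
  have "inner_derivation ?U Y d" if "continuous_derivation ?U Y d" for d
    using derivations_inner_iso[OF Y(2) tE inner that] complex_vector_space_unitization[OF vsA]
    by (force simp: m DA)
  then show ?thesis using Y(1) by (auto simp: n_weakly_amenable_def)
qed

theorem theorem3p7:
  fixes A :: "'a top_vs" and p :: "nat \<Rightarrow> 'a \<Rightarrow> real" and n :: nat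
  assumes "frechet_algebra A p"
    and "montel A"
    and "\<not> has_identity A"
    and "n \<ge> 1"
  shows "(n_weakly_amenable TYPE('v) (2 * n) (unitization A p)
            \<longrightarrow> n_weakly_amenable TYPE('v) (2 * n) A) \<and>
         (n_weakly_amenable TYPE('v) (2 * n - 1) A
            \<longrightarrow> n_weakly_amenable TYPE('v) (2 * n - 1) (unitization A p))"
proof -
  \<comment> \<open>In the zero algebra the zero element is an identity.\<close>
  have "\<exists>a\<in>carrier A. a \<noteq> \<zero>\<^bsub>A\<^esub>"
  proof (rule ccontr)
    assume "\<not> ?thesis"
    then have "a = \<zero>\<^bsub>A\<^esub>" if "a \<in> carrier A" for a using that by blast
    moreover have "\<zero>\<^bsub>A\<^esub> \<in> carrier A" by (rule complex_vector_spaceD(1)[OF frechet_algebraD(1)[OF assms(1)]])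
    ultimately have "has_identity A"
      unfolding has_identity_def using frechet_algebraD(5)[OF assms(1)] by metis
    with assms(3) show False by blast
  qed
  \<comment> \<open>For \<open>n = 0\<close> truncated subtraction would give the even number
    \<open>0\<close>.\<close>
  moreover have "odd (2 * n - 1)" using assms(4) by simp
  ultimately show ?thesis
    using weakly_amenable_even[OF assms(1), of "2 * n"] weakly_amenable_odd[OF assms(1), of "2 * n - 1"] by auto
qed

end
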